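(* Let $\beta\in\mathbb R$. (1) Let $1<p<\infty$ and $\Omega\subset\mathbb R^{2n+1}$ open; if $\beta+Q<0$ assume also $0\notin\Omega$. Then for every $u\in D^{1,p}_L(\Omega,N^{p+\beta})$, $$\Big(\frac{|Q+\beta|}{p}\Big)^p\int_\Omega|u|^pN^\beta\frac{r^{p(2\gamma-1)}}{N^{p(2\gamma-1)}}d\xi\le\int_\Omega|\nabla_Lu|^pN^{p+\beta}d\xi,$$ in particular $\big(\frac{|Q-p|}{p}\big)^p\int_\Omega\frac{|u|^p}{N^p}\frac{r^{p(2\gamma-1)}}{N^{p(2\gamma-1)}}d\xi\le\int_\Omega|\nabla_Lu|^pd\xi$ for $u\in D^{1,p}_L(\Omega)$. If $\Omega\cup\{0\}$ is a neighbourhood of the origin the constant $(|Q+\beta|/p)^p$ is sharp. (2) Let $p=Q$, $R>0$, $\Omega=\{\xi:N(\xi)<R\}$, $\beta<-1$. Then for every $u\in D^{1,p}_L(\Omega,(\ln(R/N))^{p+\beta})$, $$\Big(\frac{|\beta+1|}{p}\Big)^p\int_\Omega\frac{|u|^p}{N^p}\Big(\ln\frac RN\Big)^\beta\frac{r^{p(2\gamma-1)}}{N^{p(2\gamma-1)}}d\xi\le\int_\Omega|\nabla_Lu|^p\Big(\ln\frac RN\Big)^{p+\beta}d\xi,$$ in particular $\big(\frac{p-1}{p}\big)^p\int_\Omega\frac{|u|^p}{(N\ln(R/N))^p}\frac{r^{p(2\gamma-1)}}{N^{p(2\gamma-1)}}d\xi\le\int_\Omega|\nabla_Lu|^pd\xi$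 for $u\in D^{1,p}_L(\Omega)$; the constant $(|\beta+1|/p)^p$ is sharp.
   Context: Let $\xi=(x,y,t)\in\mathbb R^n\times\mathbb R^n\times\mathbb R$, $r=|(x,y)|$, $\gamma\ge1$. The Heisenberg–Greiner vector fields are $X_i=\partial_{x_i}+2\gamma y_ir^{2\gamma-2}\partial_t$, $Y_i=\partial_{y_i}-2\gamma x_ir^{2\gamma-2}\partial_t$ ($i=1,\dots,n$), and $\nabla_L=(X_1,\dots,X_n,Y_1,\dots,Y_n)$. $N(x,y,t)=(r^{4\gamma}+t^2)^{1/(4\gamma)}$ and $Q=2n+2\gamma$. For a weight $w>0$ a.e., $w\in L^1_{loc}(\Omega)$, $D^{1,p}_L(\Omega,w)$ is the closure of $C^\infty_0(\Omega)$ in the norm $(\int_\Omega|\nabla_Lu|^pw\,d\xi)^{1/p}$, and $D^{1,p}_L(\Omega)=D^{1,p}_L(\Omega,1)$. "Sharp" means the constant cannot be replaced by any larger one. *)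

theory Defs
  imports "HOL-Analysis.Analysis"
begin

type_synonym 'n pt = "(real^'n) \<times> (real^'n) \<times> real"

definition xc :: "'n::finite pt \<Rightarrow> real^'n" where "xc \<xi> = fst \<xi>"
definition yc :: "'n::finite pt \<Rightarrow> real^'n" where "yc \<xi> = fst (snd \<xi>)"
definition tc :: "'n::finite pt \<Rightarrow> real" where "tc \<xi> = snd (snd \<xi>)"

definition rr :: "'n::finite pt \<Rightarrow> real" where "rr \<xi> = sqrt ((norm (xc \<xi>))^2 + (norm (yc \<xi>))^2)"

definition NN :: "real \<Rightarrow> 'n::finite pt \<Rightarrow> real" where
  "NN \<gamma> \<xi> = (rr \<xi> powr (4*\<gamma>) + (tc \<xi>)^2) powr (1/(4*\<gamma>))"

definition QQ :: "'n::finite itself \<Rightarrow> real \<Rightarrow> real" where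
  "QQ _ \<gamma> = 2 * real CARD('n) + 2*\<gamma>"

fun Ck :: "nat \<Rightarrow> ('a::euclidean_space \<Rightarrow> real) \<Rightarrow> bool" where
  "Ck 0 f = continuous_on UNIV f"
| "Ck (Suc k) f = ((\<forall>x. f differentiable (at x)) \<and>
       (\<forall>v. Ck k (\<lambda>x. frechet_derivative f (at x) v)))"

definition smooth :: "('a::euclidean_space \<Rightarrow> real) \<Rightarrow> bool" where
  "smooth f \<longleftrightarrow> (\<forall>k. Ck k f)"

definition test_fun :: "'a::euclidean_space set \<Rightarrow> ('a \<Rightarrow> real) \<Rightarrow> bool" where
  "test_fun \<Omega> f \<longleftrightarrow> smooth f \<and> compact (closure {x. f x \<noteq> 0}) \<and> closure {x. f x \<noteq> 0} \<subseteq> \<Omega>"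

definition Xf :: "real \<Rightarrow> ('n::finite pt \<Rightarrow> real) \<Rightarrow> 'n \<Rightarrow> 'n pt \<Rightarrow> real" where
  "Xf \<gamma> f i \<xi> = frechet_derivative f (at \<xi>) (axis i 1, 0, 0)
      + 2*\<gamma> * (yc \<xi> $ i) * rr \<xi> powr (2*\<gamma>-2) * frechet_derivative f (at \<xi>) (0, 0, 1)"

definition Yf :: "real \<Rightarrow> ('n::finite pt \<Rightarrow> real) \<Rightarrow> 'n \<Rightarrow> 'n pt \<Rightarrow> real" where
  "Yf \<gamma> f i \<xi> = frechet_derivative f (at \<xi>) (0, axis i 1, 0)
      - 2*\<gamma> * (xc \<xi> $ i) * rr \<xi> powr (2*\<gamma>-2) * frechet_derivative f (at \<xi>) (0, 0, 1)"

text \<open>Horizontal gradient nabla_L f = (X_1 f,...,X_n f, Y_1 f, ..., Y_n f), as a pair of vectors;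
  its norm (product norm) is the Euclidean norm in R^(2n).\<close>
definition gradL :: "real \<Rightarrow> ('n::finite pt \<Rightarrow> real) \<Rightarrow> 'n pt \<Rightarrow> (real^'n) \<times> (real^'n)" where
  "gradL \<gamma> f \<xi> = ((\<chi> i. Xf \<gamma> f i \<xi>), (\<chi> i. Yf \<gamma> f i \<xi>))"

text \<open>Elements of D^{1,p}_L(Omega, w): pairs (u, g) where g plays the role of nabla_L u,
  such that some sequence phi_k of C_0^infinity(Omega) functions converges to u a.e. in Omega
  and nabla_L phi_k converges to g in the norm (int_Omega |.|^p w)^(1/p).\<close>
definition DL :: "real \<Rightarrow> real \<Rightarrow> 'n::finite pt set \<Rightarrow> ('n pt \<Rightarrow> real)
     \<Rightarrow> (('n pt \<Rightarrow> real) \<times> ('n pt \<Rightarrow> (real^'n) \<times> (real^'n))) set" where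
  "DL \<gamma> p \<Omega> w = {(u, g). u \<in> borel_measurable lborel \<and> g \<in> borel_measurable lborel \<and>
     (\<exists>\<phi>::nat \<Rightarrow> 'n pt \<Rightarrow> real. (\<forall>k. test_fun \<Omega> (\<phi> k)) \<and>
        (AE \<xi> in lborel. \<xi> \<in> \<Omega> \<longrightarrow> (\<lambda>k. \<phi> k \<xi>) \<longlonglongrightarrow> u \<xi>) \<and>
        (\<lambda>k. \<integral>\<^sup>+ \<xi>. ennreal (norm (gradL \<gamma> (\<phi> k) \<xi> - g \<xi>) powr p * w \<xi>) * indicator \<Omega> \<xi> \<partial>lborel)
          \<longlonglongrightarrow> 0)}"

end

(* The orbits of the one-parameter group P_tau(x,y,t) = (e^tau (rotation of (x,y) by the angle
   tau t / r^(2 gamma)), e^(2 gamma tau) t) are horizontal curves transversal to the level sets of N: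
   N grows by the factor e^tau, Lebesgue measure by e^(Q tau) (the rotation angle is rotation invariant,
   so the twist preserves measure), and |d/dtau phi(P_tau)| <= |nabla_L phi| N (N/r)^(2 gamma - 1).
   Hence N^(-Q) (r/N)^(p(2 gamma - 1)) dxi is flow invariant, and both inequalities are one-dimensional
   weighted Hardy inequalities in the variable ln N along the orbits, with their sharp constants; they pass
   to the closure by Fatou's lemma.

   For sharpness take u = h(ln N), with h the one-dimensional extremal power times a smooth cutoff with a
   long plateau. Such u is not smooth on r = 0; it is the limit of h(ln((r^2 + delta)^(2 gamma) + t^2) / (4 gamma)),
   which are smooth. Flow invariance gives all shells e^j <= N < e^(j+1) the same mass, so the plateau
   dominates the two transition regions. *)
theory Submission
  imports Defs
begin

section \<open>Lebesgue measure under the horizontal flow\<close>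

text \<open>The flow is the horizontal gradient flow of N with its time rescaled to ln N: away from
  r = 0 the horizontal gradient of N is parallel to the velocity of the flow. Hence the
  Cauchy-Schwarz step that bounds the derivative along an orbit is an equality for functions of N,
  and the one-dimensional constant survives.

  The twist t / r^(2 gamma) is singular on r = 0, so Jacobians and a coarea formula are avoided.
  Invariance of the measure comes from Tonelli and an average over angles, and no space of orbits is
  formed: Hoelder is applied on the half-orbit issuing from each point, and the double integral over
  points and times is moved by invariance.

  The half-orbit has to run where phi dies out. For Q + beta > 0 this is outward, by compact
  support; for Q + beta < 0 it is inward, which is where 0 outside Omega enters. For the logarithmic
  weight the extremal sequence concentrates at the origin, not at the sphere N = R: its plateau is
  long in ln ln (R/N).\<close>

lemma borel_measurable_coord [measurable]:
  "xc \<in> borel_measurable borel" "yc \<in> borel_measurable borel" "tc \<in> borel_measurable borel"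
  "rr \<in> borel_measurable borel" "NN \<gamma> \<in> borel_measurable borel"
proof -
  show x: "xc \<in> borel_measurable borel" unfolding xc_def by (simp add: borel_prod[symmetric])
  show y: "yc \<in> borel_measurable borel" unfolding yc_def
    by (intro borel_measurable_continuous_onI continuous_intros)
  show t: "tc \<in> borel_measurable borel" unfolding tc_def
    by (intro borel_measurable_continuous_onI continuous_intros)
  show r: "rr \<in> borel_measurable borel" using x y unfolding rr_def by measurable
  show "NN \<gamma> \<in> borel_measurable borel" using r t unfolding NN_def by measurable
qed

lemma pt_simps [simp]: "xc (x, y, t) = x" "yc (x, y, t) = y" "tc (x, y, t) = t"
  by (auto simp: xc_def yc_def tc_def)

lemma pt_eta: "\<xi> = (xc \<xi>, yc \<xi>, tc \<xi>)"
  by (simp add: xc_def yc_def tc_def)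

section \<open>Translations, scalings and shears of Lebesgue measure\<close>

lemma nn_integral_lborel_translate:
  fixes f :: "'a::euclidean_space \<Rightarrow> ennreal"
  assumes [measurable]: "f \<in> borel_measurable borel"
  shows "(\<integral>\<^sup>+x. f (c + x) \<partial>lborel) = (\<integral>\<^sup>+x. f x \<partial>lborel)"
  by (subst (2) lborel_distr_plus[of c, symmetric]) (simp add: nn_integral_distr)

lemma nn_integral_lborel_scale:
  fixes f :: "'a::euclidean_space \<Rightarrow> ennreal"
  assumes [measurable]: "f \<in> borel_measurable borel" and c: "c > 0"
  shows "(\<integral>\<^sup>+x. f x \<partial>lborel) = ennreal (c ^ DIM('a)) * (\<integral>\<^sup>+x. f (c *\<^sub>R x) \<partial>lborel)"
  using c by (subst lborel_affine[of c 0])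
    (simp_all add: nn_integral_density nn_integral_distr nn_integral_cmult)

text \<open>On each slice with fixed second component the shear is a translation, so Tonelli with
  that slice innermost suffices and no determinant is computed.\<close>

lemma nn_integral_shear_fst:
  fixes f :: "'a::euclidean_space \<times> 'b::euclidean_space \<Rightarrow> ennreal"
  assumes [measurable]: "f \<in> borel_measurable borel" "h \<in> borel_measurable borel"
  shows "(\<integral>\<^sup>+z. f (h (snd z) + fst z, snd z) \<partial>lborel) = (\<integral>\<^sup>+z. f z \<partial>lborel)"
proof -
  have [measurable]: "f \<in> borel_measurable (borel \<Otimes>\<^sub>M borel)" by (simp add: borel_prod)
  have "(\<integral>\<^sup>+z. f (h (snd z) + fst z, snd z) \<partial>(lborel \<Otimes>\<^sub>M lborel)) =
      (\<integral>\<^sup>+y. (\<integral>\<^sup>+x. f (h y + x, y) \<partial>lborel) \<partial>lborel)"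
    by (subst lborel_pair.nn_integral_snd[symmetric]) simp_all
  also have "\<dots> = (\<integral>\<^sup>+y. (\<integral>\<^sup>+x. f (x, y) \<partial>lborel) \<partial>lborel)"
    by (intro nn_integral_cong nn_integral_lborel_translate) measurable
  also have "\<dots> = (\<integral>\<^sup>+z. f z \<partial>(lborel \<Otimes>\<^sub>M lborel))"
    by (subst lborel_pair.nn_integral_snd[symmetric]) simp_all
  finally show ?thesis by (simp add: lborel_prod)
qed

lemma nn_integral_shear_snd:
  fixes f :: "'a::euclidean_space \<times> 'b::euclidean_space \<Rightarrow> ennreal"
  assumes [measurable]: "f \<in> borel_measurable borel" "h \<in> borel_measurable borel"
  shows "(\<integral>\<^sup>+z. f (fst z, h (fst z) + snd z) \<partial>lborel) = (\<integral>\<^sup>+z. f z \<partial>lborel)"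
proof -
  have [measurable]: "f \<in> borel_measurable (borel \<Otimes>\<^sub>M borel)" by (simp add: borel_prod)
  have "(\<integral>\<^sup>+z. f (fst z, h (fst z) + snd z) \<partial>(lborel \<Otimes>\<^sub>M lborel)) =
      (\<integral>\<^sup>+x. (\<integral>\<^sup>+y. f (x, h x + y) \<partial>lborel) \<partial>lborel)"
    by (subst lborel.nn_integral_fst[symmetric]) simp_all
  also have "\<dots> = (\<integral>\<^sup>+x. (\<integral>\<^sup>+y. f (x, y) \<partial>lborel) \<partial>lborel)"
    by (intro nn_integral_cong nn_integral_lborel_translate) measurable
  also have "\<dots> = (\<integral>\<^sup>+z. f z \<partial>(lborel \<Otimes>\<^sub>M lborel))"
    by (subst lborel.nn_integral_fst[symmetric]) simp_all
  finally show ?thesis by (simp add: lborel_prod)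
qed

text \<open>In complex notation z = x + iy this is multiplication by exp (-i \<alpha>),
  simultaneously in all n planes, with t fixed.\<close>

definition rot :: "real \<Rightarrow> 'n::finite pt \<Rightarrow> 'n pt" where
  "rot \<alpha> \<xi> = (cos \<alpha> *\<^sub>R xc \<xi> + sin \<alpha> *\<^sub>R yc \<xi>, cos \<alpha> *\<^sub>R yc \<xi> - sin \<alpha> *\<^sub>R xc \<xi>, tc \<xi>)"

lemma rot_rot: "rot \<alpha> (rot \<beta> \<xi>) = rot (\<alpha> + \<beta>) \<xi>"
  by (simp add: rot_def cos_add sin_add algebra_simps)

lemma rot_0 [simp]: "rot 0 \<xi> = \<xi>"
  by (simp add: rot_def pt_eta[symmetric])

lemma rot_periodic: "rot (\<alpha> + 2 * pi) \<xi> = rot \<alpha> \<xi>"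
  by (simp add: rot_def)

lemma tc_rot [simp]: "tc (rot \<alpha> \<xi>) = tc \<xi>"
  by (simp add: rot_def)

lemma rr_rot [simp]: "rr (rot \<alpha> \<xi>) = rr \<xi>"
proof -
  have "(norm (cos \<alpha> *\<^sub>R xc \<xi> + sin \<alpha> *\<^sub>R yc \<xi>))\<^sup>2 + (norm (cos \<alpha> *\<^sub>R yc \<xi> - sin \<alpha> *\<^sub>R xc \<xi>))\<^sup>2
     = ((cos \<alpha>)\<^sup>2 + (sin \<alpha>)\<^sup>2) * ((norm (xc \<xi>))\<^sup>2 + (norm (yc \<xi>))\<^sup>2)"
    by (simp only: power2_norm_eq_inner inner_add_left inner_add_right inner_diff_left inner_diff_right
        inner_scaleR_left inner_scaleR_right inner_commute[of "yc \<xi>" "xc \<xi>"]) algebra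
  then show ?thesis by (simp add: rr_def rot_def)
qed

lemma measurable_rot [measurable]:
  "(\<lambda>z. rot (fst z) (snd z)) \<in> borel_measurable (borel :: (real \<times> 'n::finite pt) measure)"
  unfolding rot_def xc_def yc_def tc_def
  by (intro borel_measurable_continuous_onI continuous_intros)

lemma measurable_rot' [measurable (raw)]:
  assumes "f \<in> borel_measurable M" "g \<in> borel_measurable M"
  shows "(\<lambda>z. rot (f z) (g z)) \<in> borel_measurable M"
  using measurable_compose[OF borel_measurable_Pair[OF assms] measurable_rot] by simp

lemma nn_integral_rot:
  fixes f :: "'n::finite pt \<Rightarrow> ennreal"
  assumes [measurable]: "f \<in> borel_measurable borel"
  shows "(\<integral>\<^sup>+\<xi>. f (rot \<alpha> \<xi>) \<partial>lborel) = (\<integral>\<^sup>+\<xi>. f \<xi> \<partial>lborel)"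
proof -
  have *: "(\<integral>\<^sup>+\<xi>. f (rot \<alpha> \<xi>) \<partial>lborel) = (\<integral>\<^sup>+\<xi>. f \<xi> \<partial>lborel)"
    if "cos (\<alpha>/2) \<noteq> 0" and [measurable]: "f \<in> borel_measurable borel" for \<alpha> and f :: "'n pt \<Rightarrow> ennreal"
  proof -
    \<comment> \<open>a rotation is a product of three shears\<close>
    define T where "T = tan (\<alpha>/2)"
    define A where "A = (\<lambda>z::'n pt. (T *\<^sub>R fst (snd z) + fst z, snd z))"
    define B where "B = (\<lambda>z::'n pt. (fst z, (- sin \<alpha> *\<^sub>R fst z, 0) + snd z))"
    have [measurable]: "A \<in> borel_measurable borel" "B \<in> borel_measurable borel"
      unfolding A_def B_def by (intro borel_measurable_continuous_onI continuous_intros)+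
    have s: "sin \<alpha> = 2 * sin (\<alpha>/2) * cos (\<alpha>/2)" and c: "cos \<alpha> = 2 * (cos (\<alpha>/2))\<^sup>2 - 1"
      using sin_double[of "\<alpha>/2"] cos_double_cos[of "\<alpha>/2"] by simp_all
    have "T * sin \<alpha> = 2 * (sin (\<alpha>/2))\<^sup>2" unfolding T_def s tan_def using that
      by (simp add: power2_eq_square)
    then have e1: "1 - T * sin \<alpha> = cos \<alpha>" by (simp add: c sin_squared_eq)
    have e2: "T * (1 + cos \<alpha>) = sin \<alpha>" unfolding T_def s c tan_def using that
      by (simp add: power2_eq_square)
    have rot: "rot \<alpha> z = A (B (A z))" for z
    proof -
      obtain x y t where z: "z = (x, y, t)" by (metis prod_cases3)
      have "A (B (A z)) = ((1 - T * sin \<alpha>) *\<^sub>R x + (T * (1 + (1 - T * sin \<alpha>))) *\<^sub>R y,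
          (1 - T * sin \<alpha>) *\<^sub>R y - sin \<alpha> *\<^sub>R x, t)"
        unfolding A_def B_def z by (simp add: vec_eq_iff algebra_simps)
      then show ?thesis unfolding e1 e2 by (simp add: rot_def z)
    qed
    have mT: "(\<lambda>y::(real^'n) \<times> real. T *\<^sub>R fst y) \<in> borel_measurable borel"
      "(\<lambda>x::real^'n. (- sin \<alpha> *\<^sub>R x, 0::real)) \<in> borel_measurable borel"
      by (intro borel_measurable_continuous_onI continuous_intros)+
    have "(\<integral>\<^sup>+\<xi>. f (A (B (A \<xi>))) \<partial>lborel) = (\<integral>\<^sup>+\<xi>. f (A (B \<xi>)) \<partial>lborel)"
      using nn_integral_shear_fst[OF _ mT(1), of "\<lambda>z. f (A (B z))"]
      unfolding A_def[THEN fun_cong, symmetric] by measurable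
    also have "\<dots> = (\<integral>\<^sup>+\<xi>. f (A \<xi>) \<partial>lborel)"
      using nn_integral_shear_snd[OF _ mT(2), of "\<lambda>z. f (A z)"]
      unfolding B_def[THEN fun_cong, symmetric] by measurable
    also have "\<dots> = (\<integral>\<^sup>+\<xi>. f \<xi> \<partial>lborel)"
      using nn_integral_shear_fst[OF _ mT(1), of f]
      unfolding A_def[THEN fun_cong, symmetric] by measurable
    finally show ?thesis by (simp add: rot)
  qed
  show ?thesis
  proof (cases "cos (\<alpha>/2) = 0")
    \<comment> \<open>For \<alpha> an odd multiple of \<pi> the shear coefficient tan (\<alpha>/2)
      does not exist. The cosine of \<alpha>/4 is then nonzero, so the rotation by \<alpha>/2 is
      covered by the regular case and is applied twice.\<close>
    case True
    then have "cos (\<alpha>/2/2) \<noteq> 0" using cos_double_cos[of "\<alpha>/4"] by auto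
    moreover have "rot (\<alpha>/2) (rot (\<alpha>/2) \<xi>) = rot \<alpha> \<xi>" for \<xi> :: "'n pt" by (simp add: rot_rot)
    ultimately show ?thesis using *[of "\<alpha>/2" f] *[of "\<alpha>/2" "\<lambda>\<xi>. f (rot (\<alpha>/2) \<xi>)"] by simp
  qed (use * in auto)
qed

text \<open>The shift is reduced modulo the period to some \<open>a\<close> in [0, P). The window
  [a, a+P) is cut at P, and the piece beyond P is moved back by one period to fill [0, a).\<close>

lemma nn_integral_periodic_shift:
  fixes g :: "real \<Rightarrow> ennreal"
  assumes [measurable]: "g \<in> borel_measurable borel" and P: "P > 0" and per: "\<And>x. g (x + P) = g x"
  shows "(\<integral>\<^sup>+\<theta>. g (\<alpha> + \<theta>) * indicator {0..<P} \<theta> \<partial>lborel) = (\<integral>\<^sup>+\<theta>. g \<theta> * indicator {0..<P} \<theta> \<partial>lborel)"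
proof -
  have pern: "g (x + of_nat n * P) = g x" for x n
  proof (induction n)
    case (Suc n)
    have "x + of_nat (Suc n) * P = (x + of_nat n * P) + P" by (simp add: algebra_simps)
    with Suc show ?case by (simp only: per)
  qed simp
  have peri: "g (x + of_int k * P) = g x" for x k
  proof (cases "k \<ge> 0")
    case True then show ?thesis using pern[of x "nat k"] by simp
  next
    case False then show ?thesis using pern[of "x + of_int k * P" "nat (-k)"] by (simp add: algebra_simps)
  qed
  define a where "a = \<alpha> - of_int \<lfloor>\<alpha>/P\<rfloor> * P"
  have a: "0 \<le> a" "a < P" unfolding a_def using P floor_divide_lower[of P \<alpha>] floor_divide_upper[of P \<alpha>]
    by (auto simp: algebra_simps)
  have ga: "g (\<alpha> + \<theta>) = g (a + \<theta>)" for \<theta>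
    using peri[of "a + \<theta>" "\<lfloor>\<alpha>/P\<rfloor>"] by (simp add: a_def algebra_simps)
  have "(\<integral>\<^sup>+\<theta>. g (a + \<theta>) * indicator {0..<P} \<theta> \<partial>lborel)
     = (\<integral>\<^sup>+\<theta>. g (a + \<theta>) * indicator {a..<a+P} (a + \<theta>) \<partial>lborel)"
    by (intro nn_integral_cong) (auto simp: indicator_def)
  also have "\<dots> = (\<integral>\<^sup>+\<theta>. g \<theta> * indicator {a..<a+P} \<theta> \<partial>lborel)"
    by (rule nn_integral_lborel_translate) measurable
  also have "\<dots> = (\<integral>\<^sup>+\<theta>. g \<theta> * indicator {a..<P} \<theta> + g \<theta> * indicator {P..<P+a} \<theta> \<partial>lborel)"
    using a by (intro nn_integral_cong) (auto simp: indicator_def)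
  also have "\<dots> = (\<integral>\<^sup>+\<theta>. g \<theta> * indicator {a..<P} \<theta> \<partial>lborel) + (\<integral>\<^sup>+\<theta>. g \<theta> * indicator {P..<P+a} \<theta> \<partial>lborel)"
    by (rule nn_integral_add) measurable
  also have "(\<integral>\<^sup>+\<theta>. g \<theta> * indicator {P..<P+a} \<theta> \<partial>lborel) = (\<integral>\<^sup>+\<theta>. g (P + \<theta>) * indicator {P..<P+a} (P + \<theta>) \<partial>lborel)"
    by (rule nn_integral_lborel_translate[symmetric]) measurable
  also have "\<dots> = (\<integral>\<^sup>+\<theta>. g \<theta> * indicator {0..<a} \<theta> \<partial>lborel)"
    using per by (intro nn_integral_cong) (auto simp: indicator_def add.commute)
  also have "(\<integral>\<^sup>+\<theta>. g \<theta> * indicator {a..<P} \<theta> \<partial>lborel) + \<dots>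
     = (\<integral>\<^sup>+\<theta>. g \<theta> * indicator {a..<P} \<theta> + g \<theta> * indicator {0..<a} \<theta> \<partial>lborel)"
    by (rule nn_integral_add[symmetric]) measurable
  also have "\<dots> = (\<integral>\<^sup>+\<theta>. g \<theta> * indicator {0..<P} \<theta> \<partial>lborel)"
    using a by (intro nn_integral_cong) (auto simp: indicator_def)
  finally show ?thesis by (simp add: ga)
qed

text \<open>Because \<open>a\<close> is constant on rotation circles, following the twist by a
  constant rotation only adds a constant to the angle. Averaging that constant over a full period
  erases \<open>a\<close>. The function \<open>a\<close> may be merely Borel, which admits the twist
  below with its singularity on r = 0.\<close>

lemma nn_integral_twisted_rot:
  fixes f :: "'n::finite pt \<Rightarrow> ennreal"
  assumes f[measurable]: "f \<in> borel_measurable borel"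
    and a[measurable]: "a \<in> borel_measurable borel" and inv: "\<And>\<theta> \<xi>. a (rot \<theta> \<xi>) = a \<xi>"
  shows "(\<integral>\<^sup>+\<xi>. f (rot (a \<xi>) \<xi>) \<partial>lborel) = (\<integral>\<^sup>+\<xi>. f \<xi> \<partial>lborel)"
proof -
  \<comment> \<open>average over a further rotation by a constant angle\<close>
  let ?J = "{0..<2*pi}"
  have J: "(\<integral>\<^sup>+\<theta>. c * indicator ?J \<theta> \<partial>lborel) = ennreal (2*pi) * c" for c
    by (subst nn_integral_cmult_indicator) (auto simp: mult.commute)
  have m: "(\<lambda>(\<theta>, \<xi>). f (rot (b \<xi> + \<theta>) \<xi>) * indicator ?J \<theta>) \<in> borel_measurable (borel \<Otimes>\<^sub>M borel)"
    if [measurable]: "b \<in> borel_measurable borel" for b :: "'n pt \<Rightarrow> real"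
    by measurable
  have av: "ennreal (2*pi) * (\<integral>\<^sup>+\<xi>. f (rot (b \<xi>) \<xi>) \<partial>lborel)
     = (\<integral>\<^sup>+\<xi>. \<integral>\<^sup>+\<theta>. f (rot (b \<xi> + \<theta>) \<xi>) * indicator ?J \<theta> \<partial>lborel \<partial>lborel)"
    if b[measurable]: "b \<in> borel_measurable borel" and inv: "\<And>\<theta> \<xi>. b (rot \<theta> \<xi>) = b \<xi>" for b :: "'n pt \<Rightarrow> real"
  proof -
    have "(\<integral>\<^sup>+\<xi>. \<integral>\<^sup>+\<theta>. f (rot (b \<xi> + \<theta>) \<xi>) * indicator ?J \<theta> \<partial>lborel \<partial>lborel)
      = (\<integral>\<^sup>+\<theta>. \<integral>\<^sup>+\<xi>. f (rot (b \<xi> + \<theta>) \<xi>) * indicator ?J \<theta> \<partial>lborel \<partial>lborel)"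
      by (rule lborel_pair.Fubini') (use m[OF b] in simp)
    also have "\<dots> = (\<integral>\<^sup>+\<theta>. (\<integral>\<^sup>+\<xi>. f (rot (b \<xi> + \<theta>) \<xi>) \<partial>lborel) * indicator ?J \<theta> \<partial>lborel)"
      by (intro nn_integral_cong nn_integral_multc) measurable
    also have "\<dots> = (\<integral>\<^sup>+\<theta>. (\<integral>\<^sup>+\<xi>. f (rot (b \<xi>) \<xi>) \<partial>lborel) * indicator ?J \<theta> \<partial>lborel)"
      using nn_integral_rot[of "\<lambda>\<xi>. f (rot (b \<xi>) \<xi>)"] by (simp add: inv rot_rot)
    finally show ?thesis by (simp add: J)
  qed
  have "(\<integral>\<^sup>+\<theta>. f (rot (a \<xi> + \<theta>) \<xi>) * indicator ?J \<theta> \<partial>lborel)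
      = (\<integral>\<^sup>+\<theta>. f (rot \<theta> \<xi>) * indicator ?J \<theta> \<partial>lborel)" for \<xi>
    by (rule nn_integral_periodic_shift[of "\<lambda>\<theta>. f (rot \<theta> \<xi>)" "2*pi"]) (auto simp: rot_periodic)
  then have "ennreal (2*pi) * (\<integral>\<^sup>+\<xi>. f (rot (a \<xi>) \<xi>) \<partial>lborel) = ennreal (2*pi) * (\<integral>\<^sup>+\<xi>. f (rot 0 \<xi>) \<partial>lborel)"
    using av[OF a inv] av[of "\<lambda>_. 0"] by simp
  then show ?thesis by (simp add: ennreal_mult_cancel_left)
qed

section \<open>Anisotropic dilations and the twisted flow\<close>

definition dil :: "real \<Rightarrow> real \<Rightarrow> 'n::finite pt \<Rightarrow> 'n pt" where
  "dil \<gamma> \<tau> \<xi> = (exp \<tau> *\<^sub>R xc \<xi>, exp \<tau> *\<^sub>R yc \<xi>, exp (2*\<gamma>*\<tau>) *\<^sub>R tc \<xi>)"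

lemma measurable_dil [measurable (raw)]:
  assumes "f \<in> borel_measurable M" "g \<in> borel_measurable M"
  shows "(\<lambda>z. dil \<gamma> (f z) (g z) :: 'n::finite pt) \<in> borel_measurable M"
proof -
  have "(\<lambda>z. dil \<gamma> (fst z) (snd z)) \<in> borel_measurable (borel :: (real \<times> 'n pt) measure)"
    unfolding dil_def xc_def yc_def tc_def
    by (intro borel_measurable_continuous_onI continuous_intros)
  from measurable_compose[OF borel_measurable_Pair[OF assms] this] show ?thesis by simp
qed

text \<open>Scaling one block of coordinates at a time: x and y each contribute exp \<tau> to the
  power n and t contributes exp (2\<gamma>\<tau>). This is what makes Q = 2n + 2\<gamma> the
  homogeneous dimension.\<close>

lemma nn_integral_dil:
  fixes f :: "'n::finite pt \<Rightarrow> ennreal"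
  assumes [measurable]: "f \<in> borel_measurable borel"
  shows "(\<integral>\<^sup>+\<xi>. f \<xi> \<partial>lborel) = ennreal (exp (QQ TYPE('n) \<gamma> * \<tau>)) * (\<integral>\<^sup>+\<xi>. f (dil \<gamma> \<tau> \<xi>) \<partial>lborel)"
proof -
  have [measurable]: "f \<in> borel_measurable (borel \<Otimes>\<^sub>M borel \<Otimes>\<^sub>M borel)" by (simp add: borel_prod)
  define e where "e = ennreal (exp \<tau> ^ CARD('n))"
  define e' where "e' = ennreal (exp (2*\<gamma>*\<tau>))"
  have split: "(\<integral>\<^sup>+\<xi>. g \<xi> \<partial>lborel) = (\<integral>\<^sup>+x. \<integral>\<^sup>+y. \<integral>\<^sup>+t. g (x, y, t) \<partial>lborel \<partial>lborel \<partial>lborel)"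
    if [measurable]: "g \<in> borel_measurable (borel \<Otimes>\<^sub>M borel \<Otimes>\<^sub>M borel)" for g :: "'n pt \<Rightarrow> ennreal"
  proof -
    have "(\<integral>\<^sup>+\<xi>. g \<xi> \<partial>lborel) = (\<integral>\<^sup>+\<xi>. g \<xi> \<partial>(lborel \<Otimes>\<^sub>M lborel \<Otimes>\<^sub>M lborel))" by (simp add: lborel_prod)
    also have "\<dots> = (\<integral>\<^sup>+x. \<integral>\<^sup>+z. g (x, z) \<partial>lborel \<Otimes>\<^sub>M lborel \<partial>lborel)"
      by (subst sigma_finite_measure.nn_integral_fst) (auto simp: lborel_prod sigma_finite_lborel borel_prod that[unfolded borel_prod])
    also have "\<dots> = (\<integral>\<^sup>+x. \<integral>\<^sup>+y. \<integral>\<^sup>+t. g (x, y, t) \<partial>lborel \<partial>lborel \<partial>lborel)"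
      by (intro nn_integral_cong lborel.nn_integral_fst[symmetric]) measurable
    finally show ?thesis .
  qed
  have "(\<integral>\<^sup>+\<xi>. f \<xi> \<partial>lborel) = (\<integral>\<^sup>+x. \<integral>\<^sup>+y. \<integral>\<^sup>+t. f (x, y, t) \<partial>lborel \<partial>lborel \<partial>lborel)"
    by (rule split) measurable
  also have "\<dots> = (\<integral>\<^sup>+x. \<integral>\<^sup>+y. e' * \<integral>\<^sup>+t. f (x, y, exp (2*\<gamma>*\<tau>) *\<^sub>R t) \<partial>lborel \<partial>lborel \<partial>lborel)"
    unfolding e'_def using nn_integral_lborel_scale[of "\<lambda>t. f (_, _, t)" "exp (2*\<gamma>*\<tau>)"]
    by (intro nn_integral_cong) simp
  also have "\<dots> = (\<integral>\<^sup>+x. e * \<integral>\<^sup>+y. e' * \<integral>\<^sup>+t. f (x, exp \<tau> *\<^sub>R y, exp (2*\<gamma>*\<tau>) *\<^sub>R t) \<partial>lborel \<partial>lborel \<partial>lborel)"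
    unfolding e_def
    using nn_integral_lborel_scale[of "\<lambda>y. e' * \<integral>\<^sup>+t. f (_, y, exp (2*\<gamma>*\<tau>) *\<^sub>R t) \<partial>lborel" "exp \<tau>"]
    by (intro nn_integral_cong) simp
  also have "\<dots> = e * (\<integral>\<^sup>+x. e * \<integral>\<^sup>+y. e' * \<integral>\<^sup>+t. f (exp \<tau> *\<^sub>R x, exp \<tau> *\<^sub>R y, exp (2*\<gamma>*\<tau>) *\<^sub>R t) \<partial>lborel \<partial>lborel \<partial>lborel)"
    unfolding e_def
    using nn_integral_lborel_scale[of "\<lambda>x. e * \<integral>\<^sup>+y. e' * \<integral>\<^sup>+t. f (x, exp \<tau> *\<^sub>R y, exp (2*\<gamma>*\<tau>) *\<^sub>R t) \<partial>lborel \<partial>lborel" "exp \<tau>"]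
    by (simp add: e_def)
  also have "\<dots> = e * (e * (e' * (\<integral>\<^sup>+x. \<integral>\<^sup>+y. \<integral>\<^sup>+t. f (dil \<gamma> \<tau> (x, y, t)) \<partial>lborel \<partial>lborel \<partial>lborel)))"
    by (simp add: nn_integral_cmult dil_def)
  also have "(\<integral>\<^sup>+x. \<integral>\<^sup>+y. \<integral>\<^sup>+t. f (dil \<gamma> \<tau> (x, y, t)) \<partial>lborel \<partial>lborel \<partial>lborel) = (\<integral>\<^sup>+\<xi>. f (dil \<gamma> \<tau> \<xi>) \<partial>lborel)"
    by (rule split[symmetric]) (simp add: borel_prod)
  also have "e * (e * (e' * (\<integral>\<^sup>+\<xi>. f (dil \<gamma> \<tau> \<xi>) \<partial>lborel))) =
     (e * e * e') * (\<integral>\<^sup>+\<xi>. f (dil \<gamma> \<tau> \<xi>) \<partial>lborel)"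
    by (simp only: mult.assoc)
  also have "e * e * e' = ennreal (exp (QQ TYPE('n) \<gamma> * \<tau>))"
  proof -
    have "QQ TYPE('n) \<gamma> * \<tau> = real CARD('n) * \<tau> + real CARD('n) * \<tau> + 2*\<gamma>*\<tau>"
      by (simp add: QQ_def algebra_simps)
    then have "exp (QQ TYPE('n) \<gamma> * \<tau>) = exp \<tau> ^ CARD('n) * exp \<tau> ^ CARD('n) * exp (2*\<gamma>*\<tau>)"
      by (simp only: exp_add exp_of_nat_mult)
    then show ?thesis by (simp only: e_def e'_def) (simp add: ennreal_mult')
  qed
  finally show ?thesis .
qed

text \<open>The angular speed of the flow. It is homogeneous of degree 0 and rotation invariant,
  hence constant along every orbit; this is why the flow has a closed form and is a one-parameter
  group.\<close>

definition twist :: "real \<Rightarrow> 'n::finite pt \<Rightarrow> real" where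
  "twist \<gamma> \<xi> = tc \<xi> / rr \<xi> powr (2*\<gamma>)"

definition flow :: "real \<Rightarrow> real \<Rightarrow> 'n::finite pt \<Rightarrow> 'n pt" where
  "flow \<gamma> \<tau> \<xi> = dil \<gamma> \<tau> (rot (\<tau> * twist \<gamma> \<xi>) \<xi>)"

lemma rr_dil: "rr (dil \<gamma> \<tau> \<xi>) = exp \<tau> * rr \<xi>"
  by (simp add: rr_def dil_def power_mult_distrib distrib_left[symmetric] real_sqrt_mult)

lemma rr_nonneg [simp]: "rr \<xi> \<ge> 0"
  by (simp add: rr_def)

lemma NN_nonneg [simp]: "NN \<gamma> \<xi> \<ge> 0"
  by (simp add: NN_def)

lemma tc_dil: "tc (dil \<gamma> \<tau> \<xi>) = exp (2*\<gamma>*\<tau>) * tc \<xi>"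
  by (simp add: dil_def)

lemma NN_dil:
  assumes "\<gamma> > 0" shows "NN \<gamma> (dil \<gamma> \<tau> \<xi>) = exp \<tau> * NN \<gamma> \<xi>"
proof -
  have "rr (dil \<gamma> \<tau> \<xi>) powr (4*\<gamma>) + (tc (dil \<gamma> \<tau> \<xi>))\<^sup>2 = exp (4*\<gamma>*\<tau>) * (rr \<xi> powr (4*\<gamma>) + (tc \<xi>)\<^sup>2)"
    by (simp add: rr_dil tc_dil powr_mult exp_powr_real power_mult_distrib exp_double[symmetric] algebra_simps)
  then show ?thesis using assms by (simp add: NN_def powr_mult exp_powr_real)
qed

lemma twist_dil:
  shows "twist \<gamma> (dil \<gamma> \<tau> \<xi>) = twist \<gamma> \<xi>"
  by (simp add: twist_def rr_dil tc_dil powr_mult exp_powr_real algebra_simps)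

lemma twist_rot: "twist \<gamma> (rot \<alpha> \<xi>) = twist \<gamma> \<xi>"
  by (simp add: twist_def)

lemma NN_rot: "NN \<gamma> (rot \<alpha> \<xi>) = NN \<gamma> \<xi>"
  by (simp add: NN_def)

lemma measurable_twist [measurable]: "twist \<gamma> \<in> borel_measurable borel"
  unfolding twist_def by measurable

lemma measurable_flow [measurable (raw)]:
  assumes [measurable]: "f \<in> borel_measurable M" "g \<in> borel_measurable M"
  shows "(\<lambda>z. flow \<gamma> (f z) (g z)) \<in> borel_measurable M"
  unfolding flow_def by measurable

lemma flow_scales: "\<gamma> > 0 \<Longrightarrow> NN \<gamma> (flow \<gamma> \<tau> \<xi>) = exp \<tau> * NN \<gamma> \<xi>"
  "rr (flow \<gamma> \<tau> \<xi>) = exp \<tau> * rr \<xi>"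
  by (simp_all add: flow_def NN_dil NN_rot rr_dil)

lemma dil_rot: "dil \<gamma> \<tau> (rot \<alpha> \<xi>) = rot \<alpha> (dil \<gamma> \<tau> \<xi>)"
  by (simp add: dil_def rot_def algebra_simps)

lemma dil_dil: "dil \<gamma> \<tau> (dil \<gamma> \<sigma> \<xi>) = dil \<gamma> (\<tau> + \<sigma>) \<xi>"
  by (simp add: dil_def exp_add algebra_simps)

lemma flow_flow: "flow \<gamma> \<tau> (flow \<gamma> \<sigma> \<xi>) = flow \<gamma> (\<tau> + \<sigma>) \<xi>"
  by (simp add: flow_def twist_dil twist_rot dil_rot rot_rot dil_dil algebra_simps)

lemma nn_integral_flow:
  fixes f :: "'n::finite pt \<Rightarrow> ennreal"
  assumes [measurable]: "f \<in> borel_measurable borel"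
  shows "(\<integral>\<^sup>+\<xi>. f \<xi> \<partial>lborel) = ennreal (exp (QQ TYPE('n) \<gamma> * \<tau>)) * (\<integral>\<^sup>+\<xi>. f (flow \<gamma> \<tau> \<xi>) \<partial>lborel)"
proof -
  have "(\<integral>\<^sup>+\<xi>. f (dil \<gamma> \<tau> (rot (\<tau> * twist \<gamma> \<xi>) \<xi>)) \<partial>lborel) = (\<integral>\<^sup>+\<xi>. f (dil \<gamma> \<tau> \<xi>) \<partial>lborel)"
    by (rule nn_integral_twisted_rot[of "\<lambda>\<xi>. f (dil \<gamma> \<tau> \<xi>)" "\<lambda>\<xi>. \<tau> * twist \<gamma> \<xi>"]) (measurable, simp add: twist_rot)
  then show ?thesis using nn_integral_dil[of f \<gamma> \<tau>] by (simp add: flow_def)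
qed

section \<open>Hardy's inequality along a measure-preserving flow\<close>

text \<open>The convex function z powr p lies above its tangent at \<open>c\<close>. The tangent
  inequality is Young's inequality for z and c powr (p-1) with conjugate exponent q = p/(p-1),
  multiplied by p.\<close>

lemma Young_powr:
  fixes p z c :: real
  assumes "p > 1" "z \<ge> 0" "c \<ge> 0"
  shows "p * (c powr (p-1) * z) \<le> z powr p + (p-1) * c powr p"
proof -
  define q where "q = p / (p-1)"
  have q: "q > 1" "1/p + 1/q = 1" using assms by (auto simp: q_def field_simps)
  have "z * (c powr (p-1)) \<le> z powr p / p + (c powr (p-1)) powr q / q"
    by (rule Youngs_inequality) (use assms q in auto)
  moreover have "(c powr (p-1)) powr q = c powr p" using assms by (simp add: powr_powr q_def)
  moreover have "c powr p / q = (p-1) * c powr p / p" by (simp add: q_def)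
  ultimately have "p * (z * c powr (p-1)) \<le> p * (z powr p / p + (p-1) * c powr p / p)"
    using assms by (intro mult_left_mono) auto
  also have "\<dots> = z powr p + (p-1) * c powr p"
    using assms by (simp only: distrib_left) simp
  finally show ?thesis by (simp add: mult_ac)
qed

text \<open>Hoelder's inequality with \<open>b\<close> in place of \<open>\<integral>g\<close>, which may be infinite.\<close>

lemma nn_integral_power_mean:
  fixes g k :: "'a \<Rightarrow> real"
  assumes p: "p > 1" and [measurable]: "g \<in> borel_measurable M" "k \<in> borel_measurable M"
    and g: "\<And>x. g x \<ge> 0" and k: "\<And>x. k x \<ge> 0" and gk: "\<And>x. g x \<noteq> 0 \<Longrightarrow> k x > 0"
    and K: "(\<integral>\<^sup>+x. ennreal (k x) \<partial>M) = ennreal K" "K > 0"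
    and b: "b \<ge> 0" "ennreal b \<le> (\<integral>\<^sup>+x. ennreal (g x) \<partial>M)"
  shows "ennreal (b powr p) \<le> ennreal (K powr (p-1)) * (\<integral>\<^sup>+x. ennreal (k x powr (1-p) * g x powr p) \<partial>M)"
    (is "_ \<le> _ * ?I")
proof (cases "?I = \<infinity>")
  case True then show ?thesis using K by (simp add: ennreal_mult_eq_top_iff top_unique)
next
  case False
  then obtain i where i: "?I = ennreal i" "i \<ge> 0" by (metis ennreal_cases infinity_ennreal_def)
  \<comment> \<open>The tangent point: if \<open>b\<close> is the integral of g, this is the mean of
    g/k for the measure k/K. The pointwise tangent inequality at \<open>c\<close> for g/k,
    multiplied by k and integrated, then yields the optimal bound.\<close>
  define c where "c = b / K"
  have c: "c \<ge> 0" using b K by (simp add: c_def)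
  have pw: "p * (c powr (p-1) * g x) \<le> k x powr (1-p) * g x powr p + (p-1) * c powr p * k x" for x
  proof (cases "g x = 0")
    case True then show ?thesis using p k[of x] by simp
  next
    case False
    then have kx: "k x > 0" by (rule gk)
    have "p * (c powr (p-1) * (g x / k x)) \<le> (g x / k x) powr p + (p-1) * c powr p"
      by (rule Young_powr) (use p c g k in auto)
    then have "k x * (p * (c powr (p-1) * (g x / k x))) \<le> k x * ((g x / k x) powr p + (p-1) * c powr p)"
      using kx by (intro mult_left_mono) auto
    moreover have "k x * (g x / k x) powr p = k x powr (1-p) * g x powr p"
      using kx g[of x] by (simp add: powr_divide powr_diff)
    ultimately show ?thesis using kx by (simp add: distrib_left mult_ac)
  qed
  have "ennreal (p * c powr (p-1) * b) = ennreal (p * c powr (p-1)) * ennreal b"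
    using p b by (simp add: ennreal_mult)
  also have "\<dots> \<le> ennreal (p * c powr (p-1)) * (\<integral>\<^sup>+x. ennreal (g x) \<partial>M)"
    by (intro mult_left_mono b) auto
  also have "\<dots> = (\<integral>\<^sup>+x. ennreal (p * (c powr (p-1) * g x)) \<partial>M)"
    using p g by (subst nn_integral_cmult[symmetric]) (auto simp: ennreal_mult' mult.assoc intro!: nn_integral_cong)
  also have "\<dots> \<le> (\<integral>\<^sup>+x. ennreal (k x powr (1-p) * g x powr p) + ennreal ((p-1) * c powr p) * ennreal (k x) \<partial>M)"
    using pw p k by (intro nn_integral_mono) (simp add: ennreal_mult'[symmetric] ennreal_plus[symmetric] del: ennreal_plus)
  also have "\<dots> = ennreal i + ennreal ((p-1) * c powr p) * ennreal K"
    by (simp add: nn_integral_add nn_integral_cmult K i)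
  also have "\<dots> = ennreal (i + (p-1) * c powr p * K)"
    using p K i by (simp add: ennreal_mult'[symmetric] ennreal_plus[symmetric] del: ennreal_plus)
  finally have "p * c powr (p-1) * b \<le> i + (p-1) * c powr p * K"
    using i p K by (subst (asm) ennreal_le_iff) auto
  \<comment> \<open>With this \<open>c\<close> both sides contain the same quantity, p times on the
    left and p-1 times on the right, so exactly one copy remains.\<close>
  moreover have "c powr (p-1) * b = b powr p * K powr (1-p)" "c powr p * K = b powr p * K powr (1-p)"
    using b K by (cases "b = 0"; simp add: c_def powr_divide powr_diff)+
  ultimately have "p * (b powr p * K powr (1-p)) \<le> i + (p-1) * (b powr p * K powr (1-p))"
    by (simp only: mult.assoc)
  then have "b powr p * K powr (1-p) \<le> i" by (simp add: left_diff_distrib)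
  then have "K powr (p-1) * (b powr p * K powr (1-p)) \<le> K powr (p-1) * i"
    by (intro mult_left_mono) auto
  moreover have "K powr (p-1) * K powr (1-p) = 1" using K by (simp add: powr_add[symmetric])
  ultimately have "b powr p \<le> K powr (p-1) * i" by (simp add: mult_ac)
  then show ?thesis unfolding i using i by (simp add: ennreal_mult'[symmetric])
qed

text \<open>Weighted Hoelder on each orbit, then Tonelli and invariance of the measure. The weights \<open>k\<close> and \<open>A\<close>
  play the role of the Schur test functions of the one-dimensional Hardy operator.\<close>

lemma flow_hardy:
  fixes P :: "real \<Rightarrow> 'a \<Rightarrow> 'a" and \<phi> G k A v w :: "'a \<Rightarrow> real"
  assumes sf: "sigma_finite_measure M" and p: "p > 1"
    and P [measurable]: "(\<lambda>z. P (fst z) (snd z)) \<in> measurable (borel \<Otimes>\<^sub>M M) M"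
    and inv: "\<And>\<tau> f. f \<in> borel_measurable M \<Longrightarrow> (\<integral>\<^sup>+x. f (P \<tau> x) \<partial>M) = (\<integral>\<^sup>+x. f x \<partial>M)"
    and rev: "\<And>\<tau> x. P (-\<tau>) (P \<tau> x) = x"
    and [measurable]: "\<phi> \<in> borel_measurable M" "G \<in> borel_measurable M" "k \<in> borel_measurable M"
      "A \<in> borel_measurable M" "v \<in> borel_measurable M" "w \<in> borel_measurable M"
    and k: "\<And>x. k x \<ge> 0" and A: "\<And>x. A x \<ge> 0" and v: "\<And>x. v x \<ge> 0"
    and Gk: "\<And>x. G x \<noteq> 0 \<Longrightarrow> k x > 0"
    and bound: "AE x in M. ennreal \<bar>\<phi> x\<bar> \<le> (\<integral>\<^sup>+\<tau>. ennreal \<bar>G (P \<tau> x)\<bar> * indicator {0..} \<tau> \<partial>lborel)"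
    and H1: "AE x in M. \<phi> x \<noteq> 0 \<longrightarrow> (\<exists>K>0. (\<integral>\<^sup>+\<tau>. ennreal (k (P \<tau> x)) * indicator {0..} \<tau> \<partial>lborel) = ennreal K
        \<and> v x * K powr (p-1) \<le> A x)"
    and H2: "AE x in M. G x \<noteq> 0 \<longrightarrow> ennreal (k x powr (1-p)) * (\<integral>\<^sup>+\<tau>. ennreal (A (P (-\<tau>) x)) * indicator {0..} \<tau> \<partial>lborel)
        \<le> ennreal (w x)"
  shows "(\<integral>\<^sup>+x. ennreal (\<bar>\<phi> x\<bar> powr p * v x) \<partial>M) \<le> (\<integral>\<^sup>+x. ennreal (\<bar>G x\<bar> powr p * w x) \<partial>M)"
proof -
  interpret M: sigma_finite_measure M by (rule sf)
  interpret L: pair_sigma_finite lborel M ..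
  have P1[measurable (raw)]: "(\<lambda>z. P (f z) (g z)) \<in> measurable N M"
    if "f \<in> borel_measurable N" "g \<in> measurable N M" for f g and N :: "'c measure"
    using measurable_compose[OF measurable_Pair[OF that] P] by simp
  define B where "B x = k x powr (1-p) * \<bar>G x\<bar> powr p" for x
  have [measurable]: "B \<in> borel_measurable M" unfolding B_def by measurable
  have "AE x in M. ennreal (\<bar>\<phi> x\<bar> powr p * v x) \<le> (\<integral>\<^sup>+\<tau>. ennreal (A x) * ennreal (B (P \<tau> x)) * indicator {0..} \<tau> \<partial>lborel)"
    using bound H1 AE_space
  proof eventually_elim
    case (elim x)
    note x[measurable] = elim(3)
    show ?case
    proof (cases "\<phi> x = 0")
      case False
      with elim(2) obtain K where K: "K > 0" "(\<integral>\<^sup>+\<tau>. ennreal (k (P \<tau> x)) * indicator {0..} \<tau> \<partial>lborel) = ennreal K"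
        "v x * K powr (p-1) \<le> A x" by blast
      \<comment> \<open>Hoelder on the half-orbit from x: the derivative |G| is the integrand,
        \<bar>\<phi> x\<bar> takes the place of \<open>b\<close>, and both functions are cut off to
        \<tau> \<ge> 0.\<close>
      have "ennreal (\<bar>\<phi> x\<bar> powr p) \<le> ennreal (K powr (p-1)) *
        (\<integral>\<^sup>+\<tau>. ennreal ((k (P \<tau> x) * indicator {0..} \<tau>) powr (1-p) * (\<bar>G (P \<tau> x)\<bar> * indicator {0..} \<tau>) powr p) \<partial>lborel)"
      proof (rule nn_integral_power_mean[OF p])
        show "(\<integral>\<^sup>+\<tau>. ennreal (k (P \<tau> x) * indicator {0..} \<tau>) \<partial>lborel) = ennreal K"
          unfolding K(2)[symmetric] by (intro nn_integral_cong) (auto simp: indicator_def)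
        have "(\<integral>\<^sup>+\<tau>. ennreal (\<bar>G (P \<tau> x)\<bar> * indicator {0..} \<tau>) \<partial>lborel) = (\<integral>\<^sup>+\<tau>. ennreal \<bar>G (P \<tau> x)\<bar> * indicator {0..} \<tau> \<partial>lborel)"
          by (intro nn_integral_cong) (auto simp: indicator_def)
        then show "ennreal \<bar>\<phi> x\<bar> \<le> (\<integral>\<^sup>+\<tau>. ennreal (\<bar>G (P \<tau> x)\<bar> * indicator {0..} \<tau>) \<partial>lborel)"
          using elim(1) by simp
      qed (use K k Gk in \<open>auto simp: indicator_def split: if_splits\<close>)
      also have "(\<integral>\<^sup>+\<tau>. ennreal ((k (P \<tau> x) * indicator {0..} \<tau>) powr (1-p) * (\<bar>G (P \<tau> x)\<bar> * indicator {0..} \<tau>) powr p) \<partial>lborel)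
         = (\<integral>\<^sup>+\<tau>. ennreal (B (P \<tau> x)) * indicator {0..} \<tau> \<partial>lborel)"
        by (intro nn_integral_cong) (auto simp: indicator_def B_def)
      finally have "ennreal (v x) * ennreal (\<bar>\<phi> x\<bar> powr p) \<le> ennreal (v x) * (ennreal (K powr (p-1)) * \<dots>)"
        by (rule mult_left_mono) simp
      also have "\<dots> = ennreal (v x * K powr (p-1)) * (\<integral>\<^sup>+\<tau>. ennreal (B (P \<tau> x)) * indicator {0..} \<tau> \<partial>lborel)"
        using v by (simp add: ennreal_mult mult.assoc)
      also have "\<dots> \<le> ennreal (A x) * (\<integral>\<^sup>+\<tau>. ennreal (B (P \<tau> x)) * indicator {0..} \<tau> \<partial>lborel)"
        using K by (intro mult_right_mono ennreal_leI) auto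
      also have "\<dots> = (\<integral>\<^sup>+\<tau>. ennreal (A x) * ennreal (B (P \<tau> x)) * indicator {0..} \<tau> \<partial>lborel)"
        by (subst nn_integral_cmult[symmetric]) (auto simp: mult.assoc)
      finally show ?thesis using v[of x] by (simp add: ennreal_mult mult.commute)
    qed (use p in simp)
  qed
  then have "(\<integral>\<^sup>+x. ennreal (\<bar>\<phi> x\<bar> powr p * v x) \<partial>M)
      \<le> (\<integral>\<^sup>+x. \<integral>\<^sup>+\<tau>. ennreal (A x) * ennreal (B (P \<tau> x)) * indicator {0..} \<tau> \<partial>lborel \<partial>M)"
    by (rule nn_integral_mono_AE)
  also have "\<dots> = (\<integral>\<^sup>+\<tau>. \<integral>\<^sup>+x. ennreal (A x) * ennreal (B (P \<tau> x)) * indicator {0..} \<tau> \<partial>M \<partial>lborel)"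
    by (rule L.Fubini') measurable
  \<comment> \<open>At each fixed time invariance moves the flow from \<open>B\<close> to
    \<open>A\<close>. The gradient term is then evaluated at x itself, and what multiplies it is the
    backward orbit integral of \<open>A\<close> that \<open>H2\<close> controls.\<close>
  also have "\<dots> = (\<integral>\<^sup>+\<tau>. \<integral>\<^sup>+x. ennreal (A (P (-\<tau>) x)) * ennreal (B x) * indicator {0..} \<tau> \<partial>M \<partial>lborel)"
  proof (rule nn_integral_cong)
    fix \<tau> :: real
    have "(\<integral>\<^sup>+x. ennreal (A (P (-\<tau>) (P \<tau> x))) * ennreal (B (P \<tau> x)) * indicator {0..} \<tau> \<partial>M)
       = (\<integral>\<^sup>+x. ennreal (A (P (-\<tau>) x)) * ennreal (B x) * indicator {0..} \<tau> \<partial>M)"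
      by (rule inv[of "\<lambda>x. ennreal (A (P (-\<tau>) x)) * ennreal (B x) * indicator {0..} \<tau>"]) measurable
    then show "(\<integral>\<^sup>+x. ennreal (A x) * ennreal (B (P \<tau> x)) * indicator {0..} \<tau> \<partial>M)
       = (\<integral>\<^sup>+x. ennreal (A (P (-\<tau>) x)) * ennreal (B x) * indicator {0..} \<tau> \<partial>M)" by (simp add: rev)
  qed
  also have "\<dots> = (\<integral>\<^sup>+x. \<integral>\<^sup>+\<tau>. ennreal (A (P (-\<tau>) x)) * ennreal (B x) * indicator {0..} \<tau> \<partial>lborel \<partial>M)"
    by (rule L.Fubini'[symmetric]) measurable
  also have "\<dots> \<le> (\<integral>\<^sup>+x. ennreal (\<bar>G x\<bar> powr p * w x) \<partial>M)"
  proof (rule nn_integral_mono_AE)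
    show "AE x in M. (\<integral>\<^sup>+\<tau>. ennreal (A (P (-\<tau>) x)) * ennreal (B x) * indicator {0..} \<tau> \<partial>lborel) \<le> ennreal (\<bar>G x\<bar> powr p * w x)"
      using H2 AE_space
    proof eventually_elim
      case (elim x)
      note [measurable] = elim(2)
      show ?case
      proof (cases "G x = 0")
        case False
        have "(\<integral>\<^sup>+\<tau>. ennreal (A (P (-\<tau>) x)) * ennreal (B x) * indicator {0..} \<tau> \<partial>lborel)
          = ennreal (B x) * (\<integral>\<^sup>+\<tau>. ennreal (A (P (-\<tau>) x)) * indicator {0..} \<tau> \<partial>lborel)"
          by (subst nn_integral_cmult[symmetric]) (auto simp: mult_ac)
        also have "\<dots> = ennreal (\<bar>G x\<bar> powr p) * (ennreal (k x powr (1-p)) * (\<integral>\<^sup>+\<tau>. ennreal (A (P (-\<tau>) x)) * indicator {0..} \<tau> \<partial>lborel))"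
          unfolding B_def by (simp add: ennreal_mult mult_ac)
        also have "\<dots> \<le> ennreal (\<bar>G x\<bar> powr p) * ennreal (w x)"
          using elim False by (intro mult_left_mono) auto
        finally show ?thesis by (simp add: ennreal_mult')
      qed (use p in \<open>simp add: B_def\<close>)
    qed
  qed
  finally show ?thesis .
qed

text \<open>The zero at T bounds the value at 0 by the variation on [0, T]. Integrating over the
  whole half-line removes T from the bound, since T changes from orbit to orbit.\<close>

lemma abs_le_nn_integral_deriv:
  fixes f f' :: "real \<Rightarrow> real"
  assumes "T \<ge> 0" "f T = 0"
    and d: "\<And>\<tau>. (f has_real_derivative f' \<tau>) (at \<tau>)" and c: "\<And>\<tau>. isCont f' \<tau>"
  shows "ennreal \<bar>f 0\<bar> \<le> (\<integral>\<^sup>+\<tau>. ennreal \<bar>f' \<tau>\<bar> * indicator {0..} \<tau> \<partial>lborel)"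
proof -
  have I: "has_bochner_integral lborel (\<lambda>x. f' x * indicator {0..T} x) (f T - f 0)"
    by (rule has_bochner_integral_FTC_Icc_real) (use assms in auto)
  have "ennreal \<bar>f 0\<bar> = ennreal (norm (\<integral>x. f' x * indicator {0..T} x \<partial>lborel))"
    using has_bochner_integral_integral_eq[OF I] assms by simp
  also have "\<dots> \<le> (\<integral>\<^sup>+x. ennreal (norm (f' x * indicator {0..T} x)) \<partial>lborel)"
    by (rule integral_norm_bound_ennreal) (use I in \<open>simp add: has_bochner_integral_iff\<close>)
  also have "\<dots> \<le> (\<integral>\<^sup>+\<tau>. ennreal \<bar>f' \<tau>\<bar> * indicator {0..} \<tau> \<partial>lborel)"
    by (intro nn_integral_mono) (auto simp: indicator_def)
  finally show ?thesis .
qed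

text \<open>Convexity of \<open>z \<mapsto> z powr p\<close> applied to \<open>a = (1-t) (g/(1-t)) + t (d/t)\<close>.\<close>

lemma powr_split:
  fixes a g d t p :: real
  assumes "p > 1" "0 < t" "t < 1" "0 \<le> a" "0 \<le> g" "0 \<le> d" "a \<le> g + d"
  shows "a powr p \<le> (1-t) powr (1-p) * g powr p + t powr (1-p) * d powr p"
proof -
  have ag: "a powr p \<le> (g + d) powr p" using assms by (intro powr_mono2) auto
  \<comment> \<open>The exponent is negative. This settles the degenerate cases, where only one of
    the two summands is present and its coefficient has to be at least 1.\<close>
  have ge1: "1 \<le> r powr (1-p)" if "0 < r" "r < 1" for r
    using powr_mono2'[of "1-p" r 1] that assms by auto
  consider "g = 0" | "d = 0" | "g > 0" "d > 0" using assms by linarith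
  then show ?thesis
  proof cases
    case 1
    then show ?thesis using ag mult_right_mono[OF ge1[of t], of "d powr p"] assms by simp
  next
    case 2
    then show ?thesis using ag mult_right_mono[OF ge1[of "1-t"], of "g powr p"] assms by simp
  next
    case 3
    have "(g + d) powr p = ((1-t) *\<^sub>R (g/(1-t)) + t *\<^sub>R (d/t)) powr p" using assms by simp
    also have "\<dots> \<le> (1-t) * (g/(1-t)) powr p + t * (d/t) powr p"
      using convex_onD[OF powr_convex[of p], of t "g/(1-t)" "d/t"] assms 3 by auto
    also have "\<dots> = (1-t) powr (1-p) * g powr p + t powr (1-p) * d powr p"
      using assms by (simp add: powr_divide powr_diff)
    finally show ?thesis using ag by simp
  qed
qed

section \<open>The gauge and horizontal derivatives\<close>

lemma continuous_on_rr: "continuous_on UNIV rr"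
  unfolding rr_def xc_def yc_def by (intro continuous_intros)

lemma continuous_on_tc: "continuous_on UNIV tc"
  unfolding tc_def by (intro continuous_intros)

lemma rr_eq_0_iff: "rr \<xi> = 0 \<longleftrightarrow> xc \<xi> = 0 \<and> yc \<xi> = 0"
  by (simp add: rr_def sum_power2_eq_zero_iff)

lemma continuous_on_NN:
  assumes "\<gamma> > 0" shows "continuous_on UNIV (NN \<gamma>)"
  unfolding NN_def
  by (intro continuous_on_powr' continuous_intros continuous_on_rr continuous_on_tc)
     (use assms in auto)

lemma NN_power:
  assumes "\<gamma> > 0" shows "NN \<gamma> \<xi> powr (4*\<gamma>) = rr \<xi> powr (4*\<gamma>) + (tc \<xi>)\<^sup>2"
  using assms by (simp add: NN_def powr_powr)

lemma NN_eq_0_iff: "\<gamma> > 0 \<Longrightarrow> NN \<gamma> \<xi> = 0 \<longleftrightarrow> \<xi> = 0"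
proof -
  assume "\<gamma> > 0"
  then have "NN \<gamma> \<xi> = 0 \<longleftrightarrow> rr \<xi> powr (4*\<gamma>) + (tc \<xi>)\<^sup>2 = 0" by (simp add: NN_def)
  also have "\<dots> \<longleftrightarrow> rr \<xi> = 0 \<and> tc \<xi> = 0" by (subst add_nonneg_eq_0_iff) auto
  also have "\<dots> \<longleftrightarrow> \<xi> = 0"
    by (metis rr_eq_0_iff pt_eta pt_simps zero_prod_def)
  finally show ?thesis .
qed

lemma NN_pos: "\<gamma> > 0 \<Longrightarrow> \<xi> \<noteq> 0 \<Longrightarrow> NN \<gamma> \<xi> > 0"
  using NN_eq_0_iff[of \<gamma> \<xi>] NN_nonneg[of \<gamma> \<xi>] by linarith

lemma rr_le_NN: "\<gamma> > 0 \<Longrightarrow> rr \<xi> \<le> NN \<gamma> \<xi>"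
proof -
  assume g: "\<gamma> > 0"
  have "rr \<xi> = (rr \<xi> powr (4*\<gamma>)) powr (1/(4*\<gamma>))" using g by (simp add: powr_powr)
  also have "\<dots> \<le> NN \<gamma> \<xi>" unfolding NN_def using g by (intro powr_mono2) auto
  finally show ?thesis .
qed

lemma tc_le_NN: "\<gamma> > 0 \<Longrightarrow> \<bar>tc \<xi>\<bar> \<le> NN \<gamma> \<xi> powr (2*\<gamma>)"
proof -
  assume g: "\<gamma> > 0"
  have "(tc \<xi>)\<^sup>2 \<le> NN \<gamma> \<xi> powr (4*\<gamma>)" unfolding NN_power[OF g] by simp
  also have "\<dots> = (NN \<gamma> \<xi> powr (2*\<gamma>))\<^sup>2" by (simp add: power2_eq_square powr_add[symmetric])
  finally show ?thesis by (simp add: abs_le_square_iff[symmetric])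
qed

text \<open>Compares the two topologies: gauge balls are Euclidean-bounded, hence compact, and small
  gauge balls lie in a given Euclidean ball.\<close>

lemma norm_pt_le:
  assumes "\<gamma> > 0" shows "norm \<xi> \<le> 2 * NN \<gamma> \<xi> + NN \<gamma> \<xi> powr (2*\<gamma>)"
proof -
  have "norm \<xi> \<le> norm (xc \<xi>) + (norm (yc \<xi>) + \<bar>tc \<xi>\<bar>)"
    using norm_Pair_le[of "xc \<xi>" "(yc \<xi>, tc \<xi>)"] norm_Pair_le[of "yc \<xi>" "tc \<xi>"] pt_eta[of \<xi>] by simp
  moreover have "norm (xc \<xi>) \<le> rr \<xi>" "norm (yc \<xi>) \<le> rr \<xi>"
    unfolding rr_def by (auto intro: real_le_rsqrt)
  ultimately show ?thesis using rr_le_NN[OF assms, of \<xi>] tc_le_NN[OF assms, of \<xi>] by linarith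
qed

lemma compact_NN_le:
  assumes "\<gamma> > 0" shows "compact {\<xi>::'n::finite pt. NN \<gamma> \<xi> \<le> B}"
  unfolding compact_eq_bounded_closed
proof
  show "bounded {\<xi>::'n pt. NN \<gamma> \<xi> \<le> B}"
    unfolding bounded_iff
  proof (intro exI ballI)
    fix \<xi> :: "'n pt" assume "\<xi> \<in> {\<xi>. NN \<gamma> \<xi> \<le> B}"
    then have "2 * NN \<gamma> \<xi> + NN \<gamma> \<xi> powr (2*\<gamma>) \<le> 2 * B + B powr (2*\<gamma>)"
      using assms by (intro add_mono powr_mono2) auto
    then show "norm \<xi> \<le> 2 * B + B powr (2*\<gamma>)" using norm_pt_le[OF assms, of \<xi>] by linarith
  qed
  show "closed {\<xi>::'n pt. NN \<gamma> \<xi> \<le> B}"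
    using assms by (intro closed_Collect_le continuous_on_NN continuous_intros)
qed

section \<open>Derivatives of smooth functions along the flow\<close>

lemma smooth_differentiable: "smooth f \<Longrightarrow> f differentiable (at x)"
  unfolding smooth_def by (metis Ck.simps(2))

lemma smooth_has_derivative: "smooth f \<Longrightarrow> (f has_derivative frechet_derivative f (at x)) (at x)"
  using smooth_differentiable frechet_derivative_works by blast

lemma smooth_linear: "smooth f \<Longrightarrow> linear (frechet_derivative f (at x))"
  by (intro linear_frechet_derivative smooth_differentiable)

lemma smooth_continuous: "smooth f \<Longrightarrow> continuous_on UNIV f"
  unfolding smooth_def by (metis Ck.simps(1))

lemma smooth_deriv: "smooth f \<Longrightarrow> smooth (\<lambda>x. frechet_derivative f (at x) v)"
  unfolding smooth_def by (metis Ck.simps(2))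

lemma smooth_measurable [measurable_dest]: "smooth f \<Longrightarrow> f \<in> borel_measurable borel"
  by (intro borel_measurable_continuous_onI smooth_continuous)

text \<open>\<open>Ck\<close> only speaks of derivatives in fixed directions. Expanding a varying
  direction in the basis makes the derivative along the flow a finite sum of products, so its
  continuity and measurability can be read off.\<close>

lemma linear_inner_Basis_sum:
  fixes F :: "'a::euclidean_space \<Rightarrow> real"
  assumes "linear F" shows "F v = (\<Sum>b\<in>Basis. (v \<bullet> b) * F b)"
proof -
  have "F v = F (\<Sum>b\<in>Basis. (v \<bullet> b) *\<^sub>R b)" by (simp add: euclidean_representation)
  also have "\<dots> = (\<Sum>b\<in>Basis. (v \<bullet> b) * F b)"
    by (simp add: linear_sum[OF assms] linear_cmul[OF assms])
  finally show ?thesis .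
qed

text \<open>\<open>gen\<close> is the velocity field of \<open>flow\<close>. It is horizontal where \<open>r > 0\<close>, with coefficients \<open>hor\<close> in the frame
  \<open>X\<^sub>i, Y\<^sub>i\<close>; on \<open>r = 0\<close> the division \<open>t / 0 = 0\<close> makes \<open>flow\<close> a pure dilation.\<close>

definition hor :: "real \<Rightarrow> 'n::finite pt \<Rightarrow> (real^'n) \<times> (real^'n)" where
  "hor \<gamma> \<xi> = (xc \<xi> + twist \<gamma> \<xi> *\<^sub>R yc \<xi>, yc \<xi> - twist \<gamma> \<xi> *\<^sub>R xc \<xi>)"

definition gen :: "real \<Rightarrow> 'n::finite pt \<Rightarrow> 'n pt" where
  "gen \<gamma> \<xi> = (fst (hor \<gamma> \<xi>), snd (hor \<gamma> \<xi>), 2*\<gamma>*tc \<xi>)"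

lemma measurable_gen [measurable]: "gen \<gamma> \<in> borel_measurable borel"
  unfolding gen_def hor_def fst_conv snd_conv by (intro borel_measurable_Pair) measurable

lemma flow_explicit:
  "flow \<gamma> \<tau> \<xi> = (exp \<tau> *\<^sub>R (cos (\<tau> * twist \<gamma> \<xi>) *\<^sub>R xc \<xi> + sin (\<tau> * twist \<gamma> \<xi>) *\<^sub>R yc \<xi>),
     exp \<tau> *\<^sub>R (cos (\<tau> * twist \<gamma> \<xi>) *\<^sub>R yc \<xi> - sin (\<tau> * twist \<gamma> \<xi>) *\<^sub>R xc \<xi>), exp (2*\<gamma>*\<tau>) * tc \<xi>)"
  by (simp add: flow_def dil_def rot_def)

lemma twist_flow: "twist \<gamma> (flow \<gamma> \<tau> \<xi>) = twist \<gamma> \<xi>"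
  by (simp add: flow_def twist_dil twist_rot)

lemma flow_deriv: "((\<lambda>\<tau>. flow \<gamma> \<tau> \<xi>) has_vector_derivative gen \<gamma> (flow \<gamma> \<tau> \<xi>)) (at \<tau>)"
proof -
  let ?h = "twist \<gamma> \<xi>"
  have 1: "((\<lambda>\<tau>. exp \<tau> *\<^sub>R (cos (\<tau> * ?h) *\<^sub>R xc \<xi> + sin (\<tau> * ?h) *\<^sub>R yc \<xi>)) has_vector_derivative
     fst (gen \<gamma> (flow \<gamma> \<tau> \<xi>))) (at \<tau>)"
    unfolding gen_def hor_def twist_flow unfolding flow_explicit
    by (rule derivative_eq_intros refl | simp)+ (simp add: algebra_simps)
  have 2: "((\<lambda>\<tau>. exp \<tau> *\<^sub>R (cos (\<tau> * ?h) *\<^sub>R yc \<xi> - sin (\<tau> * ?h) *\<^sub>R xc \<xi>)) has_vector_derivative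
     fst (snd (gen \<gamma> (flow \<gamma> \<tau> \<xi>)))) (at \<tau>)"
    unfolding gen_def hor_def twist_flow unfolding flow_explicit
    by (rule derivative_eq_intros refl | simp)+ (simp add: algebra_simps)
  have 3: "((\<lambda>\<tau>. exp (2*\<gamma>*\<tau>) * tc \<xi>) has_vector_derivative snd (snd (gen \<gamma> (flow \<gamma> \<tau> \<xi>)))) (at \<tau>)"
    unfolding gen_def hor_def twist_flow unfolding flow_explicit
    by (auto intro!: derivative_eq_intros simp: has_real_derivative_iff_has_vector_derivative[symmetric])
  have eq: "(\<lambda>\<tau>. flow \<gamma> \<tau> \<xi>) = (\<lambda>\<tau>. (exp \<tau> *\<^sub>R (cos (\<tau> * ?h) *\<^sub>R xc \<xi> + sin (\<tau> * ?h) *\<^sub>R yc \<xi>),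
     exp \<tau> *\<^sub>R (cos (\<tau> * ?h) *\<^sub>R yc \<xi> - sin (\<tau> * ?h) *\<^sub>R xc \<xi>), exp (2*\<gamma>*\<tau>) * tc \<xi>))"
    by (rule ext) (rule flow_explicit)
  show ?thesis unfolding eq
    using has_vector_derivative_Pair[OF 1 has_vector_derivative_Pair[OF 2 3]] by simp
qed

lemma continuous_gen_flow: "continuous_on UNIV (\<lambda>\<tau>. gen \<gamma> (flow \<gamma> \<tau> \<xi>))"
  unfolding gen_def hor_def twist_flow unfolding flow_explicit xc_def yc_def tc_def fst_conv snd_conv
  by (intro continuous_intros)

lemma flow_0 [simp]: "flow \<gamma> 0 \<xi> = \<xi>"
  by (simp add: flow_def dil_def pt_eta[symmetric])

text \<open>A combination of the frame with coefficients (a, b) has t-component 2\<gamma>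
  r^(2\<gamma>-2) (a \<bullet> y - b \<bullet> x). For \<open>hor\<close> this is 2\<gamma>
  r^(2\<gamma>) times the twist, and it must equal the velocity 2\<gamma>t of the dilation. That
  requirement fixes the angular speed t / r^(2\<gamma>).\<close>

lemma inner_hor_gradL:
  assumes f: "smooth f" and r: "rr \<xi> \<noteq> 0"
  shows "frechet_derivative f (at \<xi>) (gen \<gamma> \<xi>) = hor \<gamma> \<xi> \<bullet> gradL \<gamma> f \<xi>"
proof -
  let ?D = "frechet_derivative f (at \<xi>)"
  obtain a b where ab: "hor \<gamma> \<xi> = (a, b)" by fastforce
  note lin = smooth_linear[OF f, of \<xi>]
  have g: "gen \<gamma> \<xi> = (\<Sum>i\<in>UNIV. (a $ i) *\<^sub>R (axis i 1, 0, 0)) + (\<Sum>i\<in>UNIV. (b $ i) *\<^sub>R (0, axis i 1, 0)) + (2*\<gamma>*tc \<xi>) *\<^sub>R (0, 0, 1)"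
  proof -
    have s: "(\<Sum>i\<in>UNIV. (z $ i) *\<^sub>R axis i (1::real)) = z" for z :: "real^'a"
      using basis_expansion[of z] by (simp add: scalar_mult_eq_scaleR)
    have e: "(\<Sum>i\<in>UNIV. (a $ i) *\<^sub>R (axis i 1, 0, 0)) = (a, 0, 0::real)"
      "(\<Sum>i\<in>UNIV. (b $ i) *\<^sub>R (0, axis i 1, 0)) = (0, b, 0::real)"
      by (auto simp: prod_eq_iff fst_sum snd_sum s)
    show ?thesis unfolding e by (simp add: gen_def ab)
  qed
  have D: "?D (gen \<gamma> \<xi>) = (\<Sum>i\<in>UNIV. (a $ i) * ?D (axis i 1, 0, 0)) + (\<Sum>i\<in>UNIV. (b $ i) * ?D (0, axis i 1, 0)) + 2*\<gamma>*tc \<xi> * ?D (0, 0, 1)"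
    unfolding g by (simp only: linear_add[OF lin] linear_sum[OF lin] linear_cmul[OF lin] real_scaleR_def)
  define q where "q = 2*\<gamma>*rr \<xi> powr (2*\<gamma>-2)"
  have "hor \<gamma> \<xi> \<bullet> gradL \<gamma> f \<xi> = (\<Sum>i\<in>UNIV. (a $ i) * (?D (axis i 1, 0, 0) + q * (yc \<xi> $ i) * ?D (0,0,1)))
    + (\<Sum>i\<in>UNIV. (b $ i) * (?D (0, axis i 1, 0) - q * (xc \<xi> $ i) * ?D (0,0,1)))"
    by (simp add: ab gradL_def inner_vec_def Xf_def Yf_def q_def mult_ac)
  also have "\<dots> = (\<Sum>i\<in>UNIV. (a $ i) * ?D (axis i 1, 0, 0)) + (\<Sum>i\<in>UNIV. (b $ i) * ?D (0, axis i 1, 0))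
     + q * (a \<bullet> yc \<xi> - b \<bullet> xc \<xi>) * ?D (0,0,1)"
    by (simp add: inner_vec_def sum.distrib sum_subtractf sum_distrib_left sum_distrib_right algebra_simps)
  also have "q * (a \<bullet> yc \<xi> - b \<bullet> xc \<xi>) = 2*\<gamma>*tc \<xi>"
  proof -
    have a: "a = xc \<xi> + twist \<gamma> \<xi> *\<^sub>R yc \<xi>" and b: "b = yc \<xi> - twist \<gamma> \<xi> *\<^sub>R xc \<xi>"
      using ab by (auto simp: hor_def)
    have "a \<bullet> yc \<xi> - b \<bullet> xc \<xi> = twist \<gamma> \<xi> * (rr \<xi>)\<^sup>2"
      unfolding a b by (simp add: inner_simps inner_commute[of "yc \<xi>" "xc \<xi>"] rr_def power2_norm_eq_inner algebra_simps)
    moreover have "rr \<xi> powr (2*\<gamma>-2) * (rr \<xi>)\<^sup>2 = rr \<xi> powr (2*\<gamma>)"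
      using r rr_nonneg[of \<xi>] by (simp add: powr_diff powr_numeral)
    ultimately show ?thesis using r unfolding q_def twist_def
      by (simp add: mult_ac)
  qed
  finally show ?thesis unfolding D by simp
qed

text \<open>The vectors (x, y) and (y, -x) are orthogonal of length r, so the squared norm is (1 +
  twist^2) r^2, and 1 + twist^2 = (N/r)^(4\<gamma>) by the definition of N.\<close>

lemma norm_hor:
  assumes "\<gamma> > 0" "rr \<xi> \<noteq> 0"
  shows "norm (hor \<gamma> \<xi>) = NN \<gamma> \<xi> powr (2*\<gamma>) * rr \<xi> powr (1-2*\<gamma>)"
proof -
  have r: "rr \<xi> > 0" using assms rr_nonneg[of \<xi>] by linarith
  have "(norm (hor \<gamma> \<xi>))\<^sup>2 = (1 + (twist \<gamma> \<xi>)\<^sup>2) * (rr \<xi>)\<^sup>2"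
  proof -
    have "(norm (hor \<gamma> \<xi>))\<^sup>2 = (norm (xc \<xi> + twist \<gamma> \<xi> *\<^sub>R yc \<xi>))\<^sup>2 + (norm (yc \<xi> - twist \<gamma> \<xi> *\<^sub>R xc \<xi>))\<^sup>2"
      by (simp add: hor_def norm_Pair)
    also have "\<dots> = (1 + (twist \<gamma> \<xi>)\<^sup>2) * ((norm (xc \<xi>))\<^sup>2 + (norm (yc \<xi>))\<^sup>2)"
      by (simp only: power2_norm_eq_inner inner_add_left inner_add_right inner_diff_left inner_diff_right
        inner_scaleR_left inner_scaleR_right inner_commute[of "yc \<xi>" "xc \<xi>"]) algebra
    finally show ?thesis by (simp add: rr_def)
  qed
  also have "1 + (twist \<gamma> \<xi>)\<^sup>2 = NN \<gamma> \<xi> powr (4*\<gamma>) * rr \<xi> powr (-4*\<gamma>)"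
  proof -
    have "(rr \<xi> powr (2*\<gamma>))\<^sup>2 = rr \<xi> powr (4*\<gamma>)" by (simp add: power2_eq_square powr_add[symmetric])
    then show ?thesis using r unfolding NN_power[OF assms(1)] twist_def
      by (simp add: power_divide powr_minus field_simps)
  qed
  also have "NN \<gamma> \<xi> powr (4*\<gamma>) * rr \<xi> powr (-4*\<gamma>) * (rr \<xi>)\<^sup>2 = (NN \<gamma> \<xi> powr (2*\<gamma>) * rr \<xi> powr (1-2*\<gamma>))\<^sup>2"
  proof -
    have "(NN \<gamma> \<xi> powr (2*\<gamma>))\<^sup>2 = NN \<gamma> \<xi> powr (4*\<gamma>)" by (simp add: power2_eq_square powr_add[symmetric])
    moreover have "(rr \<xi> powr (1-2*\<gamma>))\<^sup>2 = rr \<xi> powr (2 - 4*\<gamma>)"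
      by (simp add: power2_eq_square powr_add[symmetric])
    moreover have "rr \<xi> powr (-4*\<gamma>) * (rr \<xi>)\<^sup>2 = rr \<xi> powr (2 - 4*\<gamma>)"
      using r by (simp add: powr_diff powr_minus powr_numeral field_simps)
    ultimately show ?thesis by (simp add: power_mult_distrib mult.assoc)
  qed
  finally show ?thesis by (simp add: power2_eq_iff_nonneg)
qed

section \<open>The invariant measure and Hardy's inequality for weights in N\<close>

definition hdens :: "real \<Rightarrow> real \<Rightarrow> 'n::finite pt \<Rightarrow> real" where
  "hdens \<gamma> p \<xi> = NN \<gamma> \<xi> powr (- QQ TYPE('n) \<gamma>) * (rr \<xi> powr (p*(2*\<gamma>-1)) / NN \<gamma> \<xi> powr (p*(2*\<gamma>-1)))"

lemma hdens_nonneg [simp]: "hdens \<gamma> p \<xi> \<ge> 0"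
  by (simp add: hdens_def)

lemma measurable_hdens [measurable]: "hdens \<gamma> p \<in> borel_measurable borel"
  unfolding hdens_def by measurable

lemma hdens_flow:
  assumes "\<gamma> > 0"
  shows "hdens \<gamma> p (flow \<gamma> \<tau> \<xi> :: 'n::finite pt) = exp (- QQ TYPE('n) \<gamma> * \<tau>) * hdens \<gamma> p \<xi>"
  unfolding hdens_def flow_scales(1)[OF assms] flow_scales(2)
  by (simp add: powr_mult exp_powr_real)

abbreviation hmeas :: "real \<Rightarrow> real \<Rightarrow> 'n::finite pt measure" where
  "hmeas \<gamma> p \<equiv> density lborel (\<lambda>\<xi>. ennreal (hdens \<gamma> p \<xi>))"

lemma nn_integral_hmeas_flow:
  fixes f :: "'n::finite pt \<Rightarrow> ennreal"
  assumes "\<gamma> > 0" and [measurable]: "f \<in> borel_measurable borel"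
  shows "(\<integral>\<^sup>+\<xi>. f (flow \<gamma> \<tau> \<xi>) \<partial>hmeas \<gamma> p) = (\<integral>\<^sup>+\<xi>. f \<xi> \<partial>hmeas \<gamma> p)"
proof -
  have "(\<integral>\<^sup>+\<xi>. f \<xi> \<partial>hmeas \<gamma> p) = (\<integral>\<^sup>+\<xi>. ennreal (hdens \<gamma> p \<xi>) * f \<xi> \<partial>lborel)"
    by (simp add: nn_integral_density)
  also have "\<dots> = ennreal (exp (QQ TYPE('n) \<gamma> * \<tau>)) * (\<integral>\<^sup>+\<xi>. ennreal (hdens \<gamma> p (flow \<gamma> \<tau> \<xi>)) * f (flow \<gamma> \<tau> \<xi>) \<partial>lborel)"
    by (rule nn_integral_flow) simp
  also have "\<dots> = (\<integral>\<^sup>+\<xi>. ennreal (hdens \<gamma> p \<xi>) * f (flow \<gamma> \<tau> \<xi>) \<partial>lborel)"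
    by (subst nn_integral_cmult[symmetric])
       (auto simp: hdens_flow[OF assms(1)] mult.assoc[symmetric] ennreal_mult'[symmetric] exp_add[symmetric])
  also have "\<dots> = (\<integral>\<^sup>+\<xi>. f (flow \<gamma> \<tau> \<xi>) \<partial>hmeas \<gamma> p)"
    by (simp add: nn_integral_density)
  finally show ?thesis by simp
qed

lemma sigma_finite_hmeas: "sigma_finite_measure (hmeas \<gamma> p)"
  by (subst sigma_finite_measure.sigma_finite_iff_density_finite[OF sigma_finite_lborel]) auto

text \<open>Along an orbit N is multiplied by exp (e*\<tau>), so with weights depending on N only
  the conditions \<open>H1\<close> and \<open>H2\<close> become integrals in one variable x = N. The
  sign \<open>e\<close> orients the half-orbits, and \<open>vanish\<close> provides a zero of \<phi>
  on each of them. \<open>S\<close> is the range of gauge values outside which \<phi> and its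
  derivative vanish; there \<open>k\<close> is allowed to be 0. The power N^(p-Q) on the right is
  what remains of \<open>hdens\<close> after the length of the velocity is taken into
  account.\<close>

lemma gauge_hardy:
  fixes \<phi> :: "'n::finite pt \<Rightarrow> real" and k A v w :: "real \<Rightarrow> real"
  assumes \<gamma>: "\<gamma> \<ge> 1" and p: "p > 1" and sm: "smooth \<phi>" and e: "e = 1 \<or> e = (-1::real)"
    and [measurable]: "k \<in> borel_measurable borel" "A \<in> borel_measurable borel"
      "v \<in> borel_measurable borel" "w \<in> borel_measurable borel"
    and k: "\<And>x. k x \<ge> 0" and A: "\<And>x. A x \<ge> 0" and v: "\<And>x. v x \<ge> 0" and w: "\<And>x. w x \<ge> 0"
    and vanish: "\<And>\<xi>. \<xi> \<noteq> 0 \<Longrightarrow> \<exists>T\<ge>0. \<phi> (flow \<gamma> (e*T) \<xi>) = 0"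
    and S: "\<And>\<xi>. \<xi> \<noteq> 0 \<Longrightarrow> NN \<gamma> \<xi> \<notin> S \<Longrightarrow> \<phi> \<xi> = 0 \<and> frechet_derivative \<phi> (at \<xi>) = (\<lambda>_. 0)"
    and kS: "\<And>x. x \<in> S \<Longrightarrow> k x > 0"
    and H1: "\<And>x. x \<in> S \<Longrightarrow> x > 0 \<Longrightarrow> \<exists>K>0. (\<integral>\<^sup>+\<tau>. ennreal (k (exp (e*\<tau>) * x)) * indicator {0..} \<tau> \<partial>lborel) = ennreal K
        \<and> v x * K powr (p-1) \<le> A x"
    and H2: "\<And>x. x \<in> S \<Longrightarrow> x > 0 \<Longrightarrow> ennreal (k x powr (1-p)) * (\<integral>\<^sup>+\<tau>. ennreal (A (exp (-e*\<tau>) * x)) * indicator {0..} \<tau> \<partial>lborel)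
        \<le> ennreal (w x)"
  shows "(\<integral>\<^sup>+\<xi>. ennreal (\<bar>\<phi> \<xi>\<bar> powr p * v (NN \<gamma> \<xi>) * hdens \<gamma> p \<xi>) \<partial>lborel)
     \<le> (\<integral>\<^sup>+\<xi>. ennreal (norm (gradL \<gamma> \<phi> \<xi>) powr p * w (NN \<gamma> \<xi>) * NN \<gamma> \<xi> powr (p - QQ TYPE('n) \<gamma>)) \<partial>lborel)"
proof -
  have g0: "\<gamma> > 0" using \<gamma> by simp
  define G where "G \<xi> = frechet_derivative \<phi> (at \<xi>) (gen \<gamma> \<xi>)" for \<xi>
  have G_sum: "G \<xi> = (\<Sum>b\<in>Basis. (gen \<gamma> \<xi> \<bullet> b) * frechet_derivative \<phi> (at \<xi>) b)" for \<xi>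
    unfolding G_def by (rule linear_inner_Basis_sum[OF smooth_linear[OF sm]])
  have [measurable]: "(\<lambda>\<xi>. frechet_derivative \<phi> (at \<xi>) b) \<in> borel_measurable borel" for b
    by (rule smooth_measurable[OF smooth_deriv[OF sm]])
  have [measurable]: "G \<in> borel_measurable borel"
    unfolding G_sum[abs_def] by measurable
  note [measurable] = smooth_measurable[OF sm]
  have G0: "G 0 = 0" unfolding G_sum
    by (simp add: gen_def hor_def xc_def yc_def tc_def zero_prod_def[symmetric])
  \<comment> \<open>The fixed point of the flow is negligible: 0 \<open>powr\<close> anything is 0,
    so the density itself vanishes at the origin.\<close>
  have AE0: "AE \<xi> in hmeas \<gamma> p. P \<xi>" if "\<And>\<xi>::'n pt. \<xi> \<noteq> 0 \<Longrightarrow> P \<xi>" for P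
  proof (subst AE_density)
    have "hdens \<gamma> p (0::'n pt) = 0" by (simp add: hdens_def iffD2[OF NN_eq_0_iff[OF g0] refl])
    then show "AE \<xi> in lborel. 0 < ennreal (hdens \<gamma> p \<xi>) \<longrightarrow> P \<xi>"
      using that by (metis (no_types, lifting) AE_I2 ennreal_0 less_irrefl)
  qed simp
  have "(\<integral>\<^sup>+\<xi>. ennreal (\<bar>\<phi> \<xi>\<bar> powr p * v (NN \<gamma> \<xi>)) \<partial>hmeas \<gamma> p) \<le> (\<integral>\<^sup>+\<xi>. ennreal (\<bar>e * G \<xi>\<bar> powr p * w (NN \<gamma> \<xi>)) \<partial>hmeas \<gamma> p)"
  proof (rule flow_hardy[where P = "\<lambda>\<tau>. flow \<gamma> (e*\<tau>)" and k = "\<lambda>\<xi>. if \<xi> = 0 then 0 else k (NN \<gamma> \<xi>)" and A = "\<lambda>\<xi>. A (NN \<gamma> \<xi>)", OF sigma_finite_hmeas p])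
    show "(\<lambda>z. flow \<gamma> (e * fst z) (snd z)) \<in> borel \<Otimes>\<^sub>M hmeas \<gamma> p \<rightarrow>\<^sub>M hmeas \<gamma> p"
      by measurable
    show "(\<integral>\<^sup>+ x. f (flow \<gamma> (e * \<tau>) x) \<partial>hmeas \<gamma> p) = integral\<^sup>N (hmeas \<gamma> p) f"
      if "f \<in> borel_measurable (hmeas \<gamma> p)" for \<tau> and f :: "'n pt \<Rightarrow> ennreal"
      using that by (intro nn_integral_hmeas_flow g0) simp
    show "flow \<gamma> (e * - \<tau>) (flow \<gamma> (e * \<tau>) x) = x" for \<tau> and x :: "'n pt"
      by (simp add: flow_flow)
    show "e * G x \<noteq> 0 \<Longrightarrow> 0 < (if x = 0 then 0 else k (NN \<gamma> x))" for x
      using G0 S[of x] kS[of "NN \<gamma> x"] by (cases "NN \<gamma> x \<in> S") (auto simp: G_def)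
    have nz: "flow \<gamma> \<tau> \<xi> \<noteq> 0" if "\<xi> \<noteq> 0" for \<tau> and \<xi> :: "'n pt"
      using that NN_eq_0_iff[OF g0, of "flow \<gamma> \<tau> \<xi>"] NN_eq_0_iff[OF g0, of \<xi>] by (simp add: flow_scales g0)
    show "AE x in hmeas \<gamma> p. ennreal \<bar>\<phi> x\<bar> \<le> (\<integral>\<^sup>+\<tau>. ennreal \<bar>e * G (flow \<gamma> (e * \<tau>) x)\<bar> * indicator {0..} \<tau> \<partial>lborel)"
    proof (rule AE0)
      fix \<xi> :: "'n pt" assume "\<xi> \<noteq> 0"
      from vanish[OF this] obtain T where T: "T \<ge> 0" "\<phi> (flow \<gamma> (e*T) \<xi>) = 0" by blast
      have "((\<lambda>\<tau>. \<phi> (flow \<gamma> \<tau> \<xi>)) has_real_derivative G (flow \<gamma> \<tau> \<xi>)) (at \<tau>)" for \<tau>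
      proof -
        have "((\<lambda>\<tau>. \<phi> (flow \<gamma> \<tau> \<xi>)) has_derivative (\<lambda>h. frechet_derivative \<phi> (at (flow \<gamma> \<tau> \<xi>)) (h *\<^sub>R gen \<gamma> (flow \<gamma> \<tau> \<xi>)))) (at \<tau>)"
          using has_derivative_compose[OF flow_deriv[unfolded has_vector_derivative_def] smooth_has_derivative[OF sm]] .
        then show ?thesis unfolding has_field_derivative_def G_def
          by (simp add: linear_cmul[OF smooth_linear[OF sm]] mult.commute[of _ "frechet_derivative _ _ _"] mult_commute_abs)
      qed
      note D = this
      have d: "((\<lambda>\<tau>. \<phi> (flow \<gamma> (e*\<tau>) \<xi>)) has_real_derivative e * G (flow \<gamma> (e*\<tau>) \<xi>)) (at \<tau>)" for \<tau>
      proof -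
        have "((\<lambda>\<tau>. e*\<tau>) has_real_derivative e) (at \<tau>)" by (auto intro!: derivative_eq_intros)
        from DERIV_chain2[OF D this] show ?thesis by (simp only: mult.commute[of e "G _"])
      qed
      have cf: "continuous_on UNIV (\<lambda>\<tau>. flow \<gamma> \<tau> \<xi>)"
        unfolding flow_explicit by (intro continuous_intros)
      have "continuous_on UNIV (\<lambda>\<tau>. frechet_derivative \<phi> (at (flow \<gamma> \<tau> \<xi>)) b)" for b
        by (rule continuous_on_compose2[OF smooth_continuous[OF smooth_deriv[OF sm]] cf]) simp
      then have cG: "continuous_on UNIV (\<lambda>\<tau>. G (flow \<gamma> \<tau> \<xi>))" unfolding G_sum
        by (intro continuous_intros continuous_gen_flow)
      have "continuous_on UNIV (\<lambda>\<tau>. G (flow \<gamma> (e*\<tau>) \<xi>))"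
        by (rule continuous_on_compose2[OF cG, of UNIV "\<lambda>\<tau>. e*\<tau>"]) (auto intro: continuous_intros)
      then have c: "isCont (\<lambda>\<tau>. e * G (flow \<gamma> (e*\<tau>) \<xi>)) \<tau>" for \<tau>
        by (intro continuous_intros) (simp add: continuous_on_eq_continuous_at)
      show "ennreal \<bar>\<phi> \<xi>\<bar> \<le> (\<integral>\<^sup>+\<tau>. ennreal \<bar>e * G (flow \<gamma> (e * \<tau>) \<xi>)\<bar> * indicator {0..} \<tau> \<partial>lborel)"
        using abs_le_nn_integral_deriv[OF T(1) _ d c] T by simp
    qed
    show "AE x in hmeas \<gamma> p. \<phi> x \<noteq> 0 \<longrightarrow> (\<exists>K>0. (\<integral>\<^sup>+\<tau>. ennreal (if flow \<gamma> (e * \<tau>) x = 0 then 0 else k (NN \<gamma> (flow \<gamma> (e * \<tau>) x))) * indicator {0..} \<tau> \<partial>lborel) = ennreal K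
        \<and> v (NN \<gamma> x) * K powr (p-1) \<le> A (NN \<gamma> x))"
    proof (rule AE0, rule impI)
      fix x :: "'n pt" assume x: "x \<noteq> 0" "\<phi> x \<noteq> 0"
      then have "NN \<gamma> x \<in> S" using S[of x] by auto
      from H1[OF this NN_pos[OF g0 x(1)]]
      show "\<exists>K>0. (\<integral>\<^sup>+\<tau>. ennreal (if flow \<gamma> (e * \<tau>) x = 0 then 0 else k (NN \<gamma> (flow \<gamma> (e * \<tau>) x))) * indicator {0..} \<tau> \<partial>lborel) = ennreal K
        \<and> v (NN \<gamma> x) * K powr (p-1) \<le> A (NN \<gamma> x)"
        by (simp only: nz[OF x(1)] if_False flow_scales(1)[OF g0])
    qed
    show "AE x in hmeas \<gamma> p. e * G x \<noteq> 0 \<longrightarrow> ennreal ((if x = 0 then 0 else k (NN \<gamma> x)) powr (1-p)) * (\<integral>\<^sup>+\<tau>. ennreal (A (NN \<gamma> (flow \<gamma> (e * - \<tau>) x))) * indicator {0..} \<tau> \<partial>lborel)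
        \<le> ennreal (w (NN \<gamma> x))"
    proof (rule AE0, rule impI)
      fix x :: "'n pt" assume x: "x \<noteq> 0" "e * G x \<noteq> 0"
      then have "NN \<gamma> x \<in> S" using S[of x] by (cases "NN \<gamma> x \<in> S") (auto simp: G_def)
      from H2[OF this NN_pos[OF g0 x(1)]] x
      show "ennreal ((if x = 0 then 0 else k (NN \<gamma> x)) powr (1-p)) * (\<integral>\<^sup>+\<tau>. ennreal (A (NN \<gamma> (flow \<gamma> (e * - \<tau>) x))) * indicator {0..} \<tau> \<partial>lborel)
        \<le> ennreal (w (NN \<gamma> x))" by (simp add: flow_scales g0)
    qed
  qed (use k A v in auto)
  also have "\<dots> = (\<integral>\<^sup>+\<xi>. ennreal (hdens \<gamma> p \<xi>) * ennreal (\<bar>e * G \<xi>\<bar> powr p * w (NN \<gamma> \<xi>)) \<partial>lborel)"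
    by (simp add: nn_integral_density)
  also have "\<dots> \<le> (\<integral>\<^sup>+\<xi>. ennreal (norm (gradL \<gamma> \<phi> \<xi>) powr p * w (NN \<gamma> \<xi>) * NN \<gamma> \<xi> powr (p - QQ TYPE('n) \<gamma>)) \<partial>lborel)"
  proof (rule nn_integral_mono)
    fix \<xi> :: "'n pt"
    have "hdens \<gamma> p \<xi> * \<bar>e * G \<xi>\<bar> powr p \<le> norm (gradL \<gamma> \<phi> \<xi>) powr p * NN \<gamma> \<xi> powr (p - QQ TYPE('n) \<gamma>)"
    proof (cases "rr \<xi> = 0")
      \<comment> \<open>On r = 0 the generator points along t and is not horizontal in general, but
        the density carries a positive power of r and vanishes there.\<close>
      case True
      then show ?thesis using p \<gamma> by (simp add: hdens_def)
    next
      case False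
      let ?N = "NN \<gamma> \<xi>" and ?r = "rr \<xi>"
      have r: "?r > 0" "?N > 0" using False rr_nonneg[of \<xi>] rr_le_NN[OF g0, of \<xi>] by linarith+
      have "\<bar>e * G \<xi>\<bar> \<le> norm (gradL \<gamma> \<phi> \<xi>) * (?N powr (2*\<gamma>) * ?r powr (1-2*\<gamma>))"
        using e Cauchy_Schwarz_ineq2[of "hor \<gamma> \<xi>" "gradL \<gamma> \<phi> \<xi>"]
        unfolding G_def inner_hor_gradL[OF sm False] norm_hor[OF g0 False] by (auto simp: mult.commute)
      then have "\<bar>e * G \<xi>\<bar> powr p \<le> (norm (gradL \<gamma> \<phi> \<xi>) * (?N powr (2*\<gamma>) * ?r powr (1-2*\<gamma>))) powr p"
        using p by (intro powr_mono2) auto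
      also have "\<dots> = norm (gradL \<gamma> \<phi> \<xi>) powr p * (?N powr (2*\<gamma>*p) * ?r powr ((1-2*\<gamma>)*p))"
        by (simp add: powr_mult powr_powr)
      finally have "hdens \<gamma> p \<xi> * \<bar>e * G \<xi>\<bar> powr p \<le> hdens \<gamma> p \<xi> * \<dots>"
        by (rule mult_left_mono) simp
      also have "\<dots> = norm (gradL \<gamma> \<phi> \<xi>) powr p *
         (?N powr (- QQ TYPE('n) \<gamma>) * ?N powr (-(p*(2*\<gamma>-1))) * ?N powr (2*\<gamma>*p)) * (?r powr (p*(2*\<gamma>-1)) * ?r powr ((1-2*\<gamma>)*p))"
        by (simp only: hdens_def divide_inverse powr_minus[symmetric] mult_ac)
      \<comment> \<open>The length of the velocity blows up as r tends to 0, and the density cancels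
        this exactly. This is the origin of the factor (r/N)^(p(2\<gamma>-1)) in the
        inequality.\<close>
      also have "?r powr (p*(2*\<gamma>-1)) * ?r powr ((1-2*\<gamma>)*p) = 1"
        unfolding powr_add[symmetric] using r by (simp add: algebra_simps)
      also have "?N powr (- QQ TYPE('n) \<gamma>) * ?N powr (-(p*(2*\<gamma>-1))) * ?N powr (2*\<gamma>*p) = ?N powr (p - QQ TYPE('n) \<gamma>)"
        unfolding powr_add[symmetric] by (simp add: algebra_simps)
      finally show ?thesis by simp
    qed
    from mult_right_mono[OF this w[of "NN \<gamma> \<xi>"]]
    show "ennreal (hdens \<gamma> p \<xi>) * ennreal (\<bar>e * G \<xi>\<bar> powr p * w (NN \<gamma> \<xi>))
      \<le> ennreal (norm (gradL \<gamma> \<phi> \<xi>) powr p * w (NN \<gamma> \<xi>) * NN \<gamma> \<xi> powr (p - QQ TYPE('n) \<gamma>))"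
      unfolding ennreal_mult'[OF hdens_nonneg, symmetric] by (intro ennreal_leI) (simp add: mult_ac)
  qed
  also have "(\<integral>\<^sup>+\<xi>. ennreal (\<bar>\<phi> \<xi>\<bar> powr p * v (NN \<gamma> \<xi>)) \<partial>hmeas \<gamma> p) = (\<integral>\<^sup>+\<xi>. ennreal (\<bar>\<phi> \<xi>\<bar> powr p * v (NN \<gamma> \<xi>) * hdens \<gamma> p \<xi>) \<partial>lborel)"
    by (simp add: nn_integral_density ennreal_mult'[symmetric] mult.commute)
  finally show ?thesis .
qed

section \<open>Test functions and the power weight\<close>

lemma test_fun_outside:
  assumes f: "test_fun \<Omega> f" and x: "x \<notin> closure {x. f x \<noteq> 0}"
  shows "f x = 0" "frechet_derivative f (at x) = (\<lambda>_. 0)"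
proof -
  let ?U = "- closure {x. f x \<noteq> 0}"
  have z: "f y = 0" if "y \<in> ?U" for y using that closure_subset[of "{x. f x \<noteq> 0}"] by auto
  show "f x = 0" by (rule z) (use x in simp)
  have "(f has_derivative (\<lambda>_. 0)) (at x)"
  proof (rule has_derivative_transform_within_open[of "\<lambda>_. 0" _ _ UNIV ?U])
    show "0 = f y" if "y \<in> ?U" for y using z[OF that] by simp
  qed (use x in auto)
  then show "frechet_derivative f (at x) = (\<lambda>_. 0)" by (rule frechet_derivative_at[symmetric])
qed

lemma test_fun_not_in:
  assumes f: "test_fun \<Omega> f" and x: "x \<notin> \<Omega>"
  shows "f x = 0" "frechet_derivative f (at x) = (\<lambda>_. 0)"
proof -
  have "x \<notin> closure {x. f x \<noteq> 0}" using f x by (auto simp: test_fun_def)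
  then show "f x = 0" "frechet_derivative f (at x) = (\<lambda>_. 0)" by (rule test_fun_outside[OF f])+
qed

lemma gradL_not_in:
  assumes "test_fun \<Omega> \<phi>" "\<xi> \<notin> \<Omega>" shows "gradL \<gamma> \<phi> \<xi> = 0"
  by (simp add: gradL_def Xf_def Yf_def test_fun_not_in(2)[OF assms] zero_prod_def zero_vec_def)

lemma measurable_gradL:
  assumes f: "smooth f" shows "gradL \<gamma> f \<in> borel_measurable (borel :: 'n::finite pt measure)"
proof -
  have [measurable]: "(\<lambda>\<xi>. frechet_derivative f (at \<xi>) b) \<in> borel_measurable borel" for b
    by (rule smooth_measurable[OF smooth_deriv[OF f]])
  have [measurable]: "(\<lambda>\<xi>::'n pt. xc \<xi> $ i) \<in> borel_measurable borel" "(\<lambda>\<xi>::'n pt. yc \<xi> $ i) \<in> borel_measurable borel" for i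
    unfolding xc_def yc_def by (intro borel_measurable_continuous_onI continuous_intros)+
  have v: "(\<lambda>\<xi>. \<chi> i. h i \<xi>) \<in> borel_measurable borel" if [measurable]: "\<And>i. h i \<in> borel_measurable borel"
    for h :: "'n \<Rightarrow> 'n pt \<Rightarrow> real"
  proof -
    have "(\<chi> i. h i \<xi>) = (\<Sum>i\<in>UNIV. h i \<xi> *\<^sub>R axis i (1::real))" for \<xi>
      using basis_expansion[of "\<chi> i. h i \<xi>"] by (simp add: scalar_mult_eq_scaleR)
    then show ?thesis by simp
  qed
  have [measurable]: "Xf \<gamma> f i \<in> borel_measurable borel" "Yf \<gamma> f i \<in> borel_measurable borel" for i
    unfolding Xf_def Yf_def by measurable
  show ?thesis unfolding gradL_def[abs_def] by (intro borel_measurable_Pair v) measurable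
qed

text \<open>An upper bound of N on the support tells when an outward orbit has left it; the lower
  bound that follows does the same for inward orbits.\<close>

lemma test_fun_NN_bounded:
  assumes "\<gamma> > 0" "test_fun \<Omega> \<phi>" shows "\<exists>B. \<forall>\<xi>. \<phi> \<xi> \<noteq> 0 \<longrightarrow> NN \<gamma> \<xi> \<le> B"
proof -
  have "compact (NN \<gamma> ` closure {\<xi>. \<phi> \<xi> \<noteq> 0})"
    using assms by (intro compact_continuous_image continuous_on_subset[OF continuous_on_NN])
      (auto simp: test_fun_def)
  then have "bounded (NN \<gamma> ` closure {\<xi>. \<phi> \<xi> \<noteq> 0})" by (rule compact_imp_bounded)
  then obtain B where "\<forall>\<xi>\<in>closure {\<xi>. \<phi> \<xi> \<noteq> 0}. \<bar>NN \<gamma> \<xi>\<bar> \<le> B" unfolding bounded_iff by auto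
  then show ?thesis using closure_subset[of "{\<xi>. \<phi> \<xi> \<noteq> 0}"] by (intro exI[of _ B]) fastforce
qed

lemma test_fun_NN_bounded_below:
  assumes "\<gamma> > 0" "test_fun \<Omega> \<phi>" "0 \<notin> \<Omega>" shows "\<exists>b>0. \<forall>\<xi>. \<phi> \<xi> \<noteq> 0 \<longrightarrow> b \<le> NN \<gamma> \<xi>"
proof (cases "{\<xi>. \<phi> \<xi> \<noteq> 0} = {}")
  case False
  let ?K = "closure {\<xi>. \<phi> \<xi> \<noteq> 0}"
  have "\<exists>x\<in>?K. \<forall>y\<in>?K. NN \<gamma> x \<le> NN \<gamma> y"
    using assms False by (intro continuous_attains_inf continuous_on_subset[OF continuous_on_NN])
      (auto simp: test_fun_def)
  then obtain x where x: "x \<in> ?K" "\<forall>y\<in>?K. NN \<gamma> x \<le> NN \<gamma> y" by blast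
  then have "x \<noteq> 0" using assms by (auto simp: test_fun_def)
  then show ?thesis using x NN_pos[OF assms(1)] closure_subset[of "{\<xi>. \<phi> \<xi> \<noteq> 0}"] by blast
next
  case True
  then show ?thesis by (intro exI[of _ 1]) auto
qed

lemma nn_integral_exp_decay:
  assumes "c > 0" "C \<ge> 0"
  shows "(\<integral>\<^sup>+\<tau>. ennreal (C * exp (-c*\<tau>)) * indicator {0..} \<tau> \<partial>lborel) = ennreal (C / c)"
proof -
  have "((\<lambda>\<tau>. exp (-c*\<tau>)) \<longlongrightarrow> 0) at_top" using assms by real_asymp
  then have "((\<lambda>\<tau>. - (C / c) * exp (-c*\<tau>)) \<longlongrightarrow> - (C / c) * 0) at_top"
    by (intro tendsto_intros)
  then have "(\<integral>\<^sup>+\<tau>. ennreal (C * exp (-c*\<tau>)) * indicator {0..} \<tau> \<partial>lborel) = ennreal (0 - (- (C / c) * exp (-c*0)))"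
    using assms by (intro nn_integral_FTC_atLeast) (auto intro!: derivative_eq_intros)
  then show ?thesis by simp
qed

text \<open>The extremal power is N^(-a) with a = (Q+\<beta>)/p. Its derivative along an orbit is
  again a multiple of N^(-a), so \<open>k\<close> is chosen as that power: this gives equality in
  Hoelder. Moving in the direction sgn a makes \<open>k\<close> decay like exp (-c\<tau>) with c =
  \<bar>a\<bar>, and the backward integral of \<open>A\<close> decays at the same rate. The two
  integrations give c powr (1-p) and 1/c, together the reciprocal of the constant. For Q + \<beta> =
  0 the constant is 0 and the estimate is trivial.\<close>

lemma hardy_test_power:
  fixes \<phi> :: "'n::finite pt \<Rightarrow> real"
  assumes \<gamma>: "\<gamma> \<ge> 1" and p: "p > 1" and \<phi>: "test_fun \<Omega> \<phi>"
    and nz: "QQ TYPE('n) \<gamma> + \<beta> \<noteq> 0" and Om: "QQ TYPE('n) \<gamma> + \<beta> < 0 \<longrightarrow> 0 \<notin> \<Omega>"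
  shows "(\<integral>\<^sup>+\<xi>. ennreal ((\<bar>QQ TYPE('n) \<gamma> + \<beta>\<bar> / p) powr p * (\<bar>\<phi> \<xi>\<bar> powr p * NN \<gamma> \<xi> powr \<beta> *
               (rr \<xi> powr (p*(2*\<gamma>-1)) / NN \<gamma> \<xi> powr (p*(2*\<gamma>-1))))) \<partial>lborel)
    \<le> (\<integral>\<^sup>+\<xi>. ennreal (norm (gradL \<gamma> \<phi> \<xi>) powr p * NN \<gamma> \<xi> powr (p + \<beta>)) \<partial>lborel)"
proof -
  have g0: "\<gamma> > 0" using \<gamma> by simp
  define Q where "Q = QQ TYPE('n) \<gamma>"
  define a where "a = (Q + \<beta>) / p"
  define c where "c = \<bar>a\<bar>"
  define e where "e = sgn a"
  have a0: "a \<noteq> 0" using nz p by (simp add: a_def Q_def)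
  then have c0: "c > 0" by (simp add: c_def)
  have e: "e = 1 \<or> e = -1" using a0 by (auto simp: e_def sgn_if)
  have ea: "e * a = c" by (simp add: e_def c_def sgn_if abs_if)
  have ap: "a * p = Q + \<beta>" using p by (simp add: a_def)
  have sm: "smooth \<phi>" using \<phi> by (simp add: test_fun_def)
  have "(\<integral>\<^sup>+\<xi>. ennreal (\<bar>\<phi> \<xi>\<bar> powr p * NN \<gamma> \<xi> powr (Q+\<beta>) * hdens \<gamma> p \<xi>) \<partial>lborel)
     \<le> (\<integral>\<^sup>+\<xi>. ennreal (norm (gradL \<gamma> \<phi> \<xi>) powr p * (c powr (-p) * NN \<gamma> \<xi> powr (Q+\<beta>)) * NN \<gamma> \<xi> powr (p - QQ TYPE('n) \<gamma>)) \<partial>lborel)"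
  \<comment> \<open>With \<open>S\<close> everything, \<open>k\<close> has to be positive at all
    reals, whereas 0 \<open>powr\<close> (-a) is 0; the value 1 for x \<le> 0 is a default.
    \<open>A\<close> is v K^(p-1) with the computed K.\<close>
  proof (rule gauge_hardy[OF \<gamma> p sm e, where S = UNIV and k = "\<lambda>x. if x > 0 then x powr (-a) else 1" and A = "\<lambda>x. c powr (1-p) * x powr a"
        and v = "\<lambda>x. x powr (Q+\<beta>)" and w = "\<lambda>x. c powr (-p) * x powr (Q+\<beta>)"])
    fix \<xi> :: "'n pt" assume x0: "\<xi> \<noteq> 0"
    then have N0: "NN \<gamma> \<xi> > 0" by (rule NN_pos[OF g0])
    show "\<exists>T\<ge>0. \<phi> (flow \<gamma> (e * T) \<xi>) = 0"
    proof (cases "a > 0")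
      case True
      then have e1: "e = 1" by (simp add: e_def)
      obtain B where B: "\<And>\<xi>. \<phi> \<xi> \<noteq> 0 \<Longrightarrow> NN \<gamma> \<xi> \<le> B" using test_fun_NN_bounded[OF g0 \<phi>] by blast
      \<comment> \<open>N is multiplied by exp T, which takes it to at least \<bar>B\<bar> + 1,
        strictly beyond the support. The maximum covers points that start out there.\<close>
      define T where "T = max 0 (ln ((\<bar>B\<bar> + 1) / NN \<gamma> \<xi>))"
      have "exp T \<ge> (\<bar>B\<bar> + 1) / NN \<gamma> \<xi>"
        using N0 by (subst exp_ln[symmetric]) (auto simp: T_def simp del: exp_ln)
      then have "NN \<gamma> (flow \<gamma> T \<xi>) > B" using N0 by (simp add: flow_scales g0 field_simps)
      then show ?thesis using B[of "flow \<gamma> T \<xi>"] e1 by (intro exI[of _ T]) (auto simp: T_def)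
    next
      case False
      then have an: "a < 0" using a0 by simp
      then have e1: "e = -1" by (simp add: e_def)
      have "0 \<notin> \<Omega>" using Om an p unfolding a_def Q_def by (auto simp: divide_less_0_iff)
      then obtain B where B: "B > 0" "\<And>\<xi>. \<phi> \<xi> \<noteq> 0 \<Longrightarrow> B \<le> NN \<gamma> \<xi>" using test_fun_NN_bounded_below[OF g0 \<phi>] by blast
      \<comment> \<open>The factor 2 brings N down to at most B/2, strictly below the
        support.\<close>
      define T where "T = max 0 (ln (2 * NN \<gamma> \<xi> / B))"
      have "exp T \<ge> 2 * NN \<gamma> \<xi> / B"
        using N0 B by (subst exp_ln[symmetric]) (auto simp: T_def simp del: exp_ln)
      then have "NN \<gamma> (flow \<gamma> (-T) \<xi>) < B" using N0 B by (simp add: flow_scales g0 exp_minus field_simps)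
      then show ?thesis using B(2)[of "flow \<gamma> (-T) \<xi>"] e1 by (intro exI[of _ T]) (auto simp: T_def)
    qed
  next
    fix x :: real assume x: "x > 0"
    define K where "K = x powr (-a) / c"
    have "(\<integral>\<^sup>+\<tau>. ennreal (if exp (e*\<tau>) * x > 0 then (exp (e*\<tau>) * x) powr (-a) else 1) * indicator {0..} \<tau> \<partial>lborel)
      = (\<integral>\<^sup>+\<tau>. ennreal (x powr (-a) * exp (-c*\<tau>)) * indicator {0..} \<tau> \<partial>lborel)"
      using x by (intro nn_integral_cong) (simp add: powr_mult exp_powr_real ea[symmetric] mult_ac)
    also have "\<dots> = ennreal K" unfolding K_def by (rule nn_integral_exp_decay) (use c0 in auto)
    finally have "(\<integral>\<^sup>+\<tau>. ennreal (if exp (e*\<tau>) * x > 0 then (exp (e*\<tau>) * x) powr (-a) else 1) * indicator {0..} \<tau> \<partial>lborel) = ennreal K" .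
    moreover have "K > 0" using x c0 by (simp add: K_def)
    moreover have "x powr (Q+\<beta>) * K powr (p-1) = c powr (1-p) * x powr a"
    proof -
      have "K powr (p-1) = x powr (-a*(p-1)) * c powr (1-p)"
      proof -
        have "K powr (p-1) = (x powr (-a)) powr (p-1) / c powr (p-1)" unfolding K_def by (simp add: powr_divide)
        then show ?thesis using powr_minus[of c "p-1"] by (simp add: powr_powr divide_inverse)
      qed
      moreover have "x powr (Q+\<beta>) * x powr (-a*(p-1)) = x powr a"
        unfolding powr_add[symmetric] ap[symmetric] by (simp add: algebra_simps)
      ultimately show ?thesis by (simp add: mult_ac)
    qed
    ultimately show "\<exists>K>0. (\<integral>\<^sup>+\<tau>. ennreal (if exp (e*\<tau>) * x > 0 then (exp (e*\<tau>) * x) powr (-a) else 1) * indicator {0..} \<tau> \<partial>lborel) = ennreal K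
        \<and> x powr (Q+\<beta>) * K powr (p-1) \<le> c powr (1-p) * x powr a"
      by (metis order_refl)
    have "(\<integral>\<^sup>+\<tau>. ennreal (c powr (1-p) * (exp (-e*\<tau>) * x) powr a) * indicator {0..} \<tau> \<partial>lborel)
      = (\<integral>\<^sup>+\<tau>. ennreal (c powr (1-p) * x powr a * exp (-c*\<tau>)) * indicator {0..} \<tau> \<partial>lborel)"
      using x by (intro nn_integral_cong) (simp add: powr_mult exp_powr_real ea[symmetric] mult_ac)
    also have "\<dots> = ennreal (c powr (1-p) * x powr a / c)" by (rule nn_integral_exp_decay) (use c0 in auto)
    finally have IA: "(\<integral>\<^sup>+\<tau>. ennreal (c powr (1-p) * (exp (-e*\<tau>) * x) powr a) * indicator {0..} \<tau> \<partial>lborel)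
      = ennreal (c powr (1-p) * x powr a / c)" .
    then have "ennreal ((if x > 0 then x powr (-a) else 1) powr (1-p)) * (\<integral>\<^sup>+\<tau>. ennreal (c powr (1-p) * (exp (-e*\<tau>) * x) powr a) * indicator {0..} \<tau> \<partial>lborel)
        = ennreal ((x powr (-a)) powr (1-p) * (c powr (1-p) * x powr a / c))"
      using x unfolding IA by (simp add: ennreal_mult'[symmetric])
    also have "(x powr (-a)) powr (1-p) * (c powr (1-p) * x powr a / c) = c powr (-p) * x powr (Q+\<beta>)"
    proof -
      have "c powr (1-p) / c = c powr (-p)" using c0 by (simp add: powr_diff powr_minus field_simps)
      moreover have "(x powr (-a)) powr (1-p) * x powr a = x powr (Q+\<beta>)"
        unfolding powr_powr powr_add[symmetric] ap[symmetric] by (simp add: algebra_simps)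
      moreover have "(x powr (-a)) powr (1-p) * (c powr (1-p) * x powr a / c) = (c powr (1-p) / c) * ((x powr (-a)) powr (1-p) * x powr a)"
        by simp
      ultimately show ?thesis by (simp only:)
    qed
    finally show "ennreal ((if x > 0 then x powr (-a) else 1) powr (1-p)) * (\<integral>\<^sup>+\<tau>. ennreal (c powr (1-p) * (exp (-e*\<tau>) * x) powr a) * indicator {0..} \<tau> \<partial>lborel)
        \<le> ennreal (c powr (-p) * x powr (Q+\<beta>))" by simp
  qed (use c0 in auto)
  then have "ennreal (c powr p) * (\<integral>\<^sup>+\<xi>. ennreal (\<bar>\<phi> \<xi>\<bar> powr p * NN \<gamma> \<xi> powr (Q+\<beta>) * hdens \<gamma> p \<xi>) \<partial>lborel)
     \<le> ennreal (c powr p) * (\<integral>\<^sup>+\<xi>. ennreal (norm (gradL \<gamma> \<phi> \<xi>) powr p * (c powr (-p) * NN \<gamma> \<xi> powr (Q+\<beta>)) * NN \<gamma> \<xi> powr (p - Q)) \<partial>lborel)"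
    unfolding Q_def by (rule mult_left_mono) simp
  moreover have "ennreal (c powr p) * (\<integral>\<^sup>+\<xi>. ennreal (\<bar>\<phi> \<xi>\<bar> powr p * NN \<gamma> \<xi> powr (Q+\<beta>) * hdens \<gamma> p \<xi>) \<partial>lborel)
    = (\<integral>\<^sup>+\<xi>. ennreal ((\<bar>QQ TYPE('n) \<gamma> + \<beta>\<bar> / p) powr p * (\<bar>\<phi> \<xi>\<bar> powr p * NN \<gamma> \<xi> powr \<beta> *
               (rr \<xi> powr (p*(2*\<gamma>-1)) / NN \<gamma> \<xi> powr (p*(2*\<gamma>-1))))) \<partial>lborel)"
  proof -
    have 1: "c = \<bar>QQ TYPE('n) \<gamma> + \<beta>\<bar> / p" using p by (simp add: c_def a_def Q_def)
    have 2: "NN \<gamma> \<xi> powr (Q+\<beta>) * hdens \<gamma> p \<xi> = NN \<gamma> \<xi> powr \<beta> * (rr \<xi> powr (p*(2*\<gamma>-1)) / NN \<gamma> \<xi> powr (p*(2*\<gamma>-1)))" for \<xi> :: "'n pt"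
      unfolding hdens_def Q_def mult.assoc[symmetric] powr_add[symmetric] by simp
    note [measurable] = smooth_measurable[OF sm]
    show ?thesis unfolding 1[symmetric] mult.assoc 2
      by (subst nn_integral_cmult[symmetric]) (auto simp: ennreal_mult'[symmetric] mult.assoc)
  qed
  moreover have "ennreal (c powr p) * (\<integral>\<^sup>+\<xi>. ennreal (norm (gradL \<gamma> \<phi> \<xi>) powr p * (c powr (-p) * NN \<gamma> \<xi> powr (Q+\<beta>)) * NN \<gamma> \<xi> powr (p - Q)) \<partial>lborel)
     = (\<integral>\<^sup>+\<xi>. ennreal (norm (gradL \<gamma> \<phi> \<xi>) powr p * NN \<gamma> \<xi> powr (p + \<beta>)) \<partial>lborel)"
  proof -
    have "norm (gradL \<gamma> \<phi> \<xi>) powr p * (c powr (-p) * NN \<gamma> \<xi> powr (Q+\<beta>)) * NN \<gamma> \<xi> powr (p - Q)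
       = c powr (-p) * (norm (gradL \<gamma> \<phi> \<xi>) powr p * NN \<gamma> \<xi> powr (p + \<beta>))" for \<xi>
    proof -
      have "NN \<gamma> \<xi> powr (Q+\<beta>) * NN \<gamma> \<xi> powr (p - Q) = NN \<gamma> \<xi> powr (p + \<beta>)"
        unfolding powr_add[symmetric] by (simp add: algebra_simps)
      then show ?thesis by (simp add: mult_ac)
    qed
    moreover have "ennreal (c powr p) * ennreal (c powr (-p)) = 1"
      using c0 by (simp add: ennreal_mult'[symmetric] powr_add[symmetric])
    moreover note measurable_gradL[OF sm, measurable]
    moreover have "(\<integral>\<^sup>+\<xi>. ennreal (c powr (-p) * (norm (gradL \<gamma> \<phi> \<xi>) powr p * NN \<gamma> \<xi> powr (p + \<beta>))) \<partial>lborel)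
       = ennreal (c powr (-p)) * (\<integral>\<^sup>+\<xi>. ennreal (norm (gradL \<gamma> \<phi> \<xi>) powr p * NN \<gamma> \<xi> powr (p + \<beta>)) \<partial>lborel)"
      unfolding ennreal_mult'[OF powr_ge_zero[of c "-p"]] by (rule nn_integral_cmult) measurable
    ultimately show ?thesis by (simp only: mult.assoc[symmetric] mult_1_left)
  qed
  ultimately show ?thesis by simp
qed

section \<open>The logarithmic weight and passage to the closure\<close>

lemma nn_integral_powr_reflect:
  assumes b: "b > 0" and s: "\<sigma> > (0::real)"
  shows "(\<integral>\<^sup>+\<tau>. ennreal (if \<tau> < \<sigma> then (\<sigma> - \<tau>) powr (b-1) else 0) * indicator {0..} \<tau> \<partial>lborel) = ennreal (\<sigma> powr b / b)"
proof -
  have "(\<integral>\<^sup>+\<tau>. ennreal (if \<tau> < \<sigma> then (\<sigma> - \<tau>) powr (b-1) else 0) * indicator {0..} \<tau> \<partial>lborel)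
    = (\<integral>\<^sup>+u. ennreal (if \<sigma> + (-1) * u < \<sigma> then (\<sigma> - (\<sigma> + (-1) * u)) powr (b-1) else 0) * indicator {0..} (\<sigma> + (-1) * u) \<partial>lborel)"
    by (subst nn_integral_real_affine[where c = "-1" and t = \<sigma>]) auto
  also have "\<dots> = (\<integral>\<^sup>+u. ennreal (if u \<in> {0..\<sigma>} then u powr (b-1) else 0) \<partial>lborel)"
    by (intro nn_integral_cong) (auto simp: indicator_def)
  also have "\<dots> = ennreal (\<sigma> powr b / b)"
  proof (rule nn_integral_has_integral_lborel)
    have "((\<lambda>x. x powr (b-1)) has_integral (\<sigma> powr (b-1+1) / (b-1+1))) {0..\<sigma>}"
      by (rule has_integral_powr_from_0) (use b s in auto)
    then show "((\<lambda>u. if u \<in> {0..\<sigma>} then u powr (b-1) else 0) has_integral (\<sigma> powr b / b)) UNIV"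
      by (subst has_integral_restrict_UNIV) simp
  qed auto
  finally show ?thesis .
qed

lemma nn_integral_powr_tail:
  assumes b: "b > 0" and s: "\<sigma> > (0::real)" and C: "C \<ge> 0"
  shows "(\<integral>\<^sup>+\<tau>. ennreal (C * (\<sigma> + \<tau>) powr (-b-1)) * indicator {0..} \<tau> \<partial>lborel) = ennreal (C * \<sigma> powr (-b) / b)"
proof -
  have "((\<lambda>\<tau>. (\<sigma> + \<tau>) powr (-b)) \<longlongrightarrow> 0) at_top" using b by real_asymp
  then have "((\<lambda>\<tau>. - (C / b) * (\<sigma> + \<tau>) powr (-b)) \<longlongrightarrow> - (C / b) * 0) at_top"
    by (intro tendsto_intros)
  then have "(\<integral>\<^sup>+\<tau>. ennreal (C * (\<sigma> + \<tau>) powr (-b-1)) * indicator {0..} \<tau> \<partial>lborel)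
     = ennreal (0 - (- (C / b) * (\<sigma> + 0) powr (-b)))"
    using b s C by (intro nn_integral_FTC_atLeast) (auto intro!: derivative_eq_intros)
  then show ?thesis by simp
qed

text \<open>In s = ln (R/N) the outward flow is translation: s decreases at unit speed and reaches 0
  at the sphere N = R, where \<phi> vanishes. The extremal is s powr b with b = \<bar>\<beta> +
  1\<bar>/p, and \<open>k\<close> is the power s powr (b-1) of its derivative. The forward integral
  of \<open>k\<close> converges at s = 0 and the backward integral of \<open>A\<close> converges at
  infinity, both because b > 0.\<close>

lemma hardy_test_log:
  fixes \<phi> :: "'n::finite pt \<Rightarrow> real"
  assumes \<gamma>: "\<gamma> \<ge> 1" and R: "R > 0" and \<beta>: "\<beta> < -1" and p: "p = QQ TYPE('n) \<gamma>"
    and \<phi>: "test_fun {\<xi>. NN \<gamma> \<xi> < R} \<phi>"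
  shows "(\<integral>\<^sup>+\<xi>. ennreal ((\<bar>\<beta> + 1\<bar> / p) powr p * (\<bar>\<phi> \<xi>\<bar> powr p / NN \<gamma> \<xi> powr p * ln (R / NN \<gamma> \<xi>) powr \<beta> *
               (rr \<xi> powr (p*(2*\<gamma>-1)) / NN \<gamma> \<xi> powr (p*(2*\<gamma>-1))))) \<partial>lborel)
    \<le> (\<integral>\<^sup>+\<xi>. ennreal (norm (gradL \<gamma> \<phi> \<xi>) powr p * ln (R / NN \<gamma> \<xi>) powr (p + \<beta>)) \<partial>lborel)"
proof -
  have g0: "\<gamma> > 0" using \<gamma> by simp
  have sm: "smooth \<phi>" using \<phi> by (simp add: test_fun_def)
  have p1: "p > 1" unfolding p QQ_def using \<gamma> by (auto intro: add_nonneg_pos)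
  define b where "b = \<bar>\<beta> + 1\<bar> / p"
  have b0: "b > 0" using \<beta> p1 by (simp add: b_def)
  have bp: "b * p = - \<beta> - 1" using \<beta> p1 by (simp add: b_def)
  define s where "s x = ln (R / x)" for x
  have s_pos: "s x > 0" if "0 < x" "x < R" for x using that by (simp add: s_def)
  have s_exp: "s (exp \<tau> * x) = s x - \<tau>" if "0 < x" for x \<tau>
    using that R by (simp add: s_def ln_div ln_mult)
  have lt_R: "exp \<tau> * x < R \<longleftrightarrow> \<tau> < s x" if "0 < x" for x \<tau>
  proof -
    have "exp \<tau> * x < R \<longleftrightarrow> exp \<tau> < R / x" using that by (simp add: field_simps)
    also have "\<dots> \<longleftrightarrow> exp \<tau> < exp (s x)" using that R by (simp add: s_def)
    also have "\<dots> \<longleftrightarrow> \<tau> < s x" by simp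
    finally show ?thesis .
  qed
  have [measurable]: "s \<in> borel_measurable borel" unfolding s_def by measurable
  have "(\<integral>\<^sup>+\<xi>. ennreal (\<bar>\<phi> \<xi>\<bar> powr p * s (NN \<gamma> \<xi>) powr \<beta> * hdens \<gamma> p \<xi>) \<partial>lborel)
     \<le> (\<integral>\<^sup>+\<xi>. ennreal (norm (gradL \<gamma> \<phi> \<xi>) powr p * (b powr (-p) * s (NN \<gamma> \<xi>) powr (p+\<beta>)) * NN \<gamma> \<xi> powr (p - QQ TYPE('n) \<gamma>)) \<partial>lborel)"
  \<comment> \<open>Orbits continue past the sphere, where s is negative. Cutting \<open>k\<close>
    off there ends the forward integral exactly at time s.\<close>
  proof (rule gauge_hardy[OF \<gamma> p1 sm, where e = 1 and S = "{0<..<R}" and k = "\<lambda>x. if 0 < x \<and> x < R then s x powr (b-1) else 0"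
        and A = "\<lambda>x. if 0 < x \<and> x < R then b powr (1-p) * s x powr (-b-1) else 0"
        and v = "\<lambda>x. s x powr \<beta>" and w = "\<lambda>x. b powr (-p) * s x powr (p+\<beta>)"])
    fix \<xi> :: "'n pt" assume x0: "\<xi> \<noteq> 0"
    then have N0: "NN \<gamma> \<xi> > 0" by (rule NN_pos[OF g0])
    define T where "T = max 0 (s (NN \<gamma> \<xi>))"
    have "\<not> NN \<gamma> (flow \<gamma> T \<xi>) < R" using lt_R[OF N0, of T] by (simp add: flow_scales g0 T_def)
    then have "\<phi> (flow \<gamma> T \<xi>) = 0" by (intro test_fun_not_in(1)[OF \<phi>]) simp
    then show "\<exists>T\<ge>0. \<phi> (flow \<gamma> (1 * T) \<xi>) = 0" by (intro exI[of _ T]) (simp add: T_def)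
    assume "NN \<gamma> \<xi> \<notin> {0<..<R}"
    then have "\<xi> \<notin> {\<xi>. NN \<gamma> \<xi> < R}" using N0 by simp
    from test_fun_not_in[OF \<phi> this] show "\<phi> \<xi> = 0 \<and> frechet_derivative \<phi> (at \<xi>) = (\<lambda>_. 0)" by simp
  next
    fix x assume "x \<in> {0<..<R}"
    then have x: "0 < x" "x < R" by auto
    note sx = s_pos[OF x]
    show "(if 0 < x \<and> x < R then s x powr (b-1) else 0) > 0" using x sx by simp
    define K where "K = s x powr b / b"
    have "(\<integral>\<^sup>+\<tau>. ennreal (if 0 < exp (1*\<tau>) * x \<and> exp (1*\<tau>) * x < R then s (exp (1*\<tau>) * x) powr (b-1) else 0) * indicator {0..} \<tau> \<partial>lborel)
       = (\<integral>\<^sup>+\<tau>. ennreal (if \<tau> < s x then (s x - \<tau>) powr (b-1) else 0) * indicator {0..} \<tau> \<partial>lborel)"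
      using x by (intro nn_integral_cong) (simp add: lt_R s_exp)
    also have "\<dots> = ennreal K" unfolding K_def by (rule nn_integral_powr_reflect[OF b0 sx])
    finally have "(\<integral>\<^sup>+\<tau>. ennreal (if 0 < exp (1*\<tau>) * x \<and> exp (1*\<tau>) * x < R then s (exp (1*\<tau>) * x) powr (b-1) else 0) * indicator {0..} \<tau> \<partial>lborel) = ennreal K" .
    moreover have "K > 0" using sx b0 by (simp add: K_def)
    moreover have "s x powr \<beta> * K powr (p-1) = b powr (1-p) * s x powr (-b-1)"
    proof -
      have "K powr (p-1) = (s x powr b) powr (p-1) / b powr (p-1)" unfolding K_def by (simp add: powr_divide)
      then have "K powr (p-1) = s x powr (b*(p-1)) * b powr (1-p)"
        using powr_minus[of b "p-1"] by (simp add: powr_powr divide_inverse)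
      moreover have "s x powr \<beta> * s x powr (b*(p-1)) = s x powr (-b-1)"
      proof -
        have "\<beta> + b*(p-1) = -b-1" using bp by (simp add: algebra_simps)
        then show ?thesis by (simp only: powr_add[symmetric])
      qed
      ultimately show ?thesis by (simp add: mult_ac)
    qed
    ultimately show "\<exists>K>0. (\<integral>\<^sup>+\<tau>. ennreal (if 0 < exp (1*\<tau>) * x \<and> exp (1*\<tau>) * x < R then s (exp (1*\<tau>) * x) powr (b-1) else 0) * indicator {0..} \<tau> \<partial>lborel) = ennreal K
        \<and> s x powr \<beta> * K powr (p-1) \<le> (if 0 < x \<and> x < R then b powr (1-p) * s x powr (-b-1) else 0)"
      using x by (intro exI[of _ K]) simp
    have IA: "(\<integral>\<^sup>+\<tau>. ennreal (if 0 < exp (-1*\<tau>) * x \<and> exp (-1*\<tau>) * x < R then b powr (1-p) * s (exp (-1*\<tau>) * x) powr (-b-1) else 0) * indicator {0..} \<tau> \<partial>lborel)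
       = (\<integral>\<^sup>+\<tau>. ennreal (b powr (1-p) * (s x + \<tau>) powr (-b-1)) * indicator {0..} \<tau> \<partial>lborel)"
    proof (intro nn_integral_cong)
      fix \<tau> :: real
      show "ennreal (if 0 < exp (-1*\<tau>) * x \<and> exp (-1*\<tau>) * x < R then b powr (1-p) * s (exp (-1*\<tau>) * x) powr (-b-1) else 0) * indicator {0..} \<tau>
        = ennreal (b powr (1-p) * (s x + \<tau>) powr (-b-1)) * indicator {0..} \<tau>"
        using x sx lt_R[OF x(1), of "-\<tau>"] s_exp[OF x(1), of "-\<tau>"] by (cases "\<tau> \<ge> 0") auto
    qed
    have "ennreal ((if 0 < x \<and> x < R then s x powr (b-1) else 0) powr (1-p)) *
      (\<integral>\<^sup>+\<tau>. ennreal (if 0 < exp (-1*\<tau>) * x \<and> exp (-1*\<tau>) * x < R then b powr (1-p) * s (exp (-1*\<tau>) * x) powr (-b-1) else 0) * indicator {0..} \<tau> \<partial>lborel)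
      = ennreal ((s x powr (b-1)) powr (1-p) * (b powr (1-p) * s x powr (-b) / b))"
      unfolding IA nn_integral_powr_tail[OF b0 sx powr_ge_zero] using x by (simp add: ennreal_mult'[symmetric])
    also have "(s x powr (b-1)) powr (1-p) * (b powr (1-p) * s x powr (-b) / b) = (b powr (1-p) / b) * ((s x powr (b-1)) powr (1-p) * s x powr (-b))"
      by simp
    also have "b powr (1-p) / b = b powr (-p)" using b0 by (simp add: powr_diff powr_minus field_simps)
    also have "(s x powr (b-1)) powr (1-p) * s x powr (-b) = s x powr (p+\<beta>)"
    proof -
      have "(b-1)*(1-p) + -b = p + \<beta>" using bp by (simp add: algebra_simps)
      then show ?thesis by (simp only: powr_powr powr_add[symmetric])
    qed
    finally show "ennreal ((if 0 < x \<and> x < R then s x powr (b-1) else 0) powr (1-p)) *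
      (\<integral>\<^sup>+\<tau>. ennreal (if 0 < exp (-1*\<tau>) * x \<and> exp (-1*\<tau>) * x < R then b powr (1-p) * s (exp (-1*\<tau>) * x) powr (-b-1) else 0) * indicator {0..} \<tau> \<partial>lborel)
      \<le> ennreal (b powr (-p) * s x powr (p+\<beta>))" by simp
  qed auto
  then have "ennreal (b powr p) * (\<integral>\<^sup>+\<xi>. ennreal (\<bar>\<phi> \<xi>\<bar> powr p * s (NN \<gamma> \<xi>) powr \<beta> * hdens \<gamma> p \<xi>) \<partial>lborel)
     \<le> ennreal (b powr p) * (\<integral>\<^sup>+\<xi>. ennreal (norm (gradL \<gamma> \<phi> \<xi>) powr p * (b powr (-p) * s (NN \<gamma> \<xi>) powr (p+\<beta>)) * NN \<gamma> \<xi> powr (p - QQ TYPE('n) \<gamma>)) \<partial>lborel)"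
    by (rule mult_left_mono) simp
  also have "\<dots> \<le> ennreal (b powr p) * (\<integral>\<^sup>+\<xi>. ennreal (b powr (-p)) * ennreal (norm (gradL \<gamma> \<phi> \<xi>) powr p * s (NN \<gamma> \<xi>) powr (p+\<beta>)) \<partial>lborel)"
  proof (intro mult_left_mono nn_integral_mono)
    fix \<xi> :: "'n pt"
    \<comment> \<open>The exponent is 0, so the factor is 1 off the origin; at the origin 0
      \<open>powr\<close> 0 is 0, hence an inequality.\<close>
    have "NN \<gamma> \<xi> powr (p - QQ TYPE('n) \<gamma>) \<le> 1" by (simp add: p)
    from mult_left_mono[OF this, of "norm (gradL \<gamma> \<phi> \<xi>) powr p * (b powr (-p) * s (NN \<gamma> \<xi>) powr (p+\<beta>))"]
    show "ennreal (norm (gradL \<gamma> \<phi> \<xi>) powr p * (b powr (-p) * s (NN \<gamma> \<xi>) powr (p+\<beta>)) * NN \<gamma> \<xi> powr (p - QQ TYPE('n) \<gamma>))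
      \<le> ennreal (b powr (-p)) * ennreal (norm (gradL \<gamma> \<phi> \<xi>) powr p * s (NN \<gamma> \<xi>) powr (p+\<beta>))"
      unfolding ennreal_mult'[OF powr_ge_zero, symmetric] by (intro ennreal_leI) (simp add: mult_ac)
  qed simp
  also have "\<dots> = ennreal (b powr p) * (ennreal (b powr (-p)) * (\<integral>\<^sup>+\<xi>. ennreal (norm (gradL \<gamma> \<phi> \<xi>) powr p * s (NN \<gamma> \<xi>) powr (p+\<beta>)) \<partial>lborel))"
    using measurable_gradL[OF sm, measurable] by (subst nn_integral_cmult) auto
  also have "\<dots> = (\<integral>\<^sup>+\<xi>. ennreal (norm (gradL \<gamma> \<phi> \<xi>) powr p * s (NN \<gamma> \<xi>) powr (p+\<beta>)) \<partial>lborel)"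
    using b0 by (simp add: mult.assoc[symmetric] ennreal_mult'[symmetric] powr_add[symmetric])
  also have "ennreal (b powr p) * (\<integral>\<^sup>+\<xi>. ennreal (\<bar>\<phi> \<xi>\<bar> powr p * s (NN \<gamma> \<xi>) powr \<beta> * hdens \<gamma> p \<xi>) \<partial>lborel)
    = (\<integral>\<^sup>+\<xi>. ennreal (b powr p * (\<bar>\<phi> \<xi>\<bar> powr p / NN \<gamma> \<xi> powr p * s (NN \<gamma> \<xi>) powr \<beta> *
               (rr \<xi> powr (p*(2*\<gamma>-1)) / NN \<gamma> \<xi> powr (p*(2*\<gamma>-1))))) \<partial>lborel)"
  proof -
    have 2: "\<bar>\<phi> \<xi>\<bar> powr p * s (NN \<gamma> \<xi>) powr \<beta> * hdens \<gamma> p \<xi> = \<bar>\<phi> \<xi>\<bar> powr p / NN \<gamma> \<xi> powr p * s (NN \<gamma> \<xi>) powr \<beta> * (rr \<xi> powr (p*(2*\<gamma>-1)) / NN \<gamma> \<xi> powr (p*(2*\<gamma>-1)))" for \<xi> :: "'n pt"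
      unfolding hdens_def p[symmetric] powr_minus by (simp add: divide_inverse mult_ac)
    note [measurable] = smooth_measurable[OF sm]
    show ?thesis unfolding 2
      by (subst nn_integral_cmult[symmetric]) (auto simp: ennreal_mult'[symmetric])
  qed
  finally show ?thesis unfolding s_def b_def .
qed

text \<open>Fatou handles the left side. On the right, the gradient of an approximant is split as g
  plus an error, with coefficients from convexity instead of Minkowski's inequality, so that
  infinite integrals cause no trouble. The coefficient of the error is fixed while k tends to
  infinity; only afterwards does the coefficient (1-t) powr (1-p) of the main term tend to
  1.\<close>

lemma DL_closure:
  fixes v w :: "'n::finite pt \<Rightarrow> real"
  assumes p: "p > 1" and Om: "\<Omega> \<in> sets borel" and [measurable]: "v \<in> borel_measurable borel" "w \<in> borel_measurable borel"
    and v: "\<And>\<xi>. v \<xi> \<ge> 0" and w: "\<And>\<xi>. w \<xi> \<ge> 0"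
    and test: "\<And>\<phi>. test_fun \<Omega> \<phi> \<Longrightarrow> (\<integral>\<^sup>+\<xi>. ennreal (\<bar>\<phi> \<xi>\<bar> powr p * v \<xi>) \<partial>lborel) \<le> (\<integral>\<^sup>+\<xi>. ennreal (norm (gradL \<gamma> \<phi> \<xi>) powr p * w \<xi>) \<partial>lborel)"
    and ug: "(u, g) \<in> DL \<gamma> p \<Omega> w"
  shows "(\<integral>\<^sup>+\<xi>. ennreal (\<bar>u \<xi>\<bar> powr p * v \<xi>) * indicator \<Omega> \<xi> \<partial>lborel) \<le> (\<integral>\<^sup>+\<xi>. ennreal (norm (g \<xi>) powr p * w \<xi>) * indicator \<Omega> \<xi> \<partial>lborel)"
    (is "?U \<le> ?G")
proof -
  note [measurable] = Om
  from ug obtain \<phi> where [measurable]: "u \<in> borel_measurable borel" "g \<in> borel_measurable borel"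
    and \<phi>: "\<And>k. test_fun \<Omega> (\<phi> k)" and ae: "AE \<xi> in lborel. \<xi> \<in> \<Omega> \<longrightarrow> (\<lambda>k. \<phi> k \<xi>) \<longlonglongrightarrow> u \<xi>"
    and conv: "(\<lambda>k. \<integral>\<^sup>+ \<xi>. ennreal (norm (gradL \<gamma> (\<phi> k) \<xi> - g \<xi>) powr p * w \<xi>) * indicator \<Omega> \<xi> \<partial>lborel) \<longlonglongrightarrow> 0"
    unfolding DL_def by auto
  define d where "d k = (\<integral>\<^sup>+ \<xi>. ennreal (norm (gradL \<gamma> (\<phi> k) \<xi> - g \<xi>) powr p * w \<xi>) * indicator \<Omega> \<xi> \<partial>lborel)" for k
  have sm: "smooth (\<phi> k)" for k using \<phi>[of k] by (simp add: test_fun_def)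
  have [measurable]: "\<phi> k \<in> borel_measurable borel" "gradL \<gamma> (\<phi> k) \<in> borel_measurable borel" for k
    by (rule smooth_measurable[OF sm], rule measurable_gradL[OF sm])
  have "?U \<le> (\<integral>\<^sup>+\<xi>. liminf (\<lambda>k. ennreal (\<bar>\<phi> k \<xi>\<bar> powr p * v \<xi>) * indicator \<Omega> \<xi>) \<partial>lborel)"
  proof (rule nn_integral_mono_AE)
    show "AE \<xi> in lborel. ennreal (\<bar>u \<xi>\<bar> powr p * v \<xi>) * indicator \<Omega> \<xi> \<le> liminf (\<lambda>k. ennreal (\<bar>\<phi> k \<xi>\<bar> powr p * v \<xi>) * indicator \<Omega> \<xi>)"
      using ae
    proof eventually_elim
      case (elim \<xi>)
      show ?case
      proof (cases "\<xi> \<in> \<Omega>")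
        case True
        with elim have l: "(\<lambda>k. \<phi> k \<xi>) \<longlonglongrightarrow> u \<xi>" by simp
        have "(\<lambda>k. \<bar>\<phi> k \<xi>\<bar> powr p) \<longlonglongrightarrow> \<bar>u \<xi>\<bar> powr p"
          by (rule tendsto_powr'[OF tendsto_rabs[OF l] tendsto_const]) (use p in auto)
        then have "(\<lambda>k. ennreal (\<bar>\<phi> k \<xi>\<bar> powr p * v \<xi>)) \<longlonglongrightarrow> ennreal (\<bar>u \<xi>\<bar> powr p * v \<xi>)"
          by (intro tendsto_ennrealI tendsto_mult tendsto_const)
        then show ?thesis using True by (simp add: lim_imp_Liminf)
      qed simp
    qed
  qed
  also have "\<dots> \<le> liminf (\<lambda>k. \<integral>\<^sup>+\<xi>. ennreal (\<bar>\<phi> k \<xi>\<bar> powr p * v \<xi>) * indicator \<Omega> \<xi> \<partial>lborel)"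
    by (rule nn_integral_liminf) measurable
  finally have U: "?U \<le> liminf (\<lambda>k. \<integral>\<^sup>+\<xi>. ennreal (\<bar>\<phi> k \<xi>\<bar> powr p * v \<xi>) * indicator \<Omega> \<xi> \<partial>lborel)" .
  have step: "?U \<le> ennreal ((1-t) powr (1-p)) * ?G" if t: "0 < t" "t < 1" for t
  proof -
    have k: "(\<integral>\<^sup>+\<xi>. ennreal (\<bar>\<phi> k \<xi>\<bar> powr p * v \<xi>) * indicator \<Omega> \<xi> \<partial>lborel)
      \<le> ennreal ((1-t) powr (1-p)) * ?G + ennreal (t powr (1-p)) * d k" for k
    proof -
      have "(\<integral>\<^sup>+\<xi>. ennreal (\<bar>\<phi> k \<xi>\<bar> powr p * v \<xi>) * indicator \<Omega> \<xi> \<partial>lborel) \<le> (\<integral>\<^sup>+\<xi>. ennreal (\<bar>\<phi> k \<xi>\<bar> powr p * v \<xi>) \<partial>lborel)"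
        by (intro nn_integral_mono) (auto simp: indicator_def)
      also have "\<dots> \<le> (\<integral>\<^sup>+\<xi>. ennreal (norm (gradL \<gamma> (\<phi> k) \<xi>) powr p * w \<xi>) \<partial>lborel)"
        by (rule test[OF \<phi>])
      also have "\<dots> \<le> (\<integral>\<^sup>+\<xi>. ennreal ((1-t) powr (1-p)) * (ennreal (norm (g \<xi>) powr p * w \<xi>) * indicator \<Omega> \<xi>)
          + ennreal (t powr (1-p)) * (ennreal (norm (gradL \<gamma> (\<phi> k) \<xi> - g \<xi>) powr p * w \<xi>) * indicator \<Omega> \<xi>) \<partial>lborel)"
      proof (rule nn_integral_mono)
        fix \<xi> :: "'n pt"
        show "ennreal (norm (gradL \<gamma> (\<phi> k) \<xi>) powr p * w \<xi>) \<le> ennreal ((1-t) powr (1-p)) * (ennreal (norm (g \<xi>) powr p * w \<xi>) * indicator \<Omega> \<xi>)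
          + ennreal (t powr (1-p)) * (ennreal (norm (gradL \<gamma> (\<phi> k) \<xi> - g \<xi>) powr p * w \<xi>) * indicator \<Omega> \<xi>)"
        proof (cases "\<xi> \<in> \<Omega>")
          case False
          then show ?thesis using p by (simp add: gradL_not_in[OF \<phi> False])
        next
          case True
          have "norm (gradL \<gamma> (\<phi> k) \<xi>) powr p \<le> (1-t) powr (1-p) * norm (g \<xi>) powr p + t powr (1-p) * norm (gradL \<gamma> (\<phi> k) \<xi> - g \<xi>) powr p"
            by (rule powr_split) (use p t norm_triangle_ineq[of "g \<xi>" "gradL \<gamma> (\<phi> k) \<xi> - g \<xi>"] in auto)
          from mult_right_mono[OF this w[of \<xi>]] True w[of \<xi>] show ?thesis
            by (simp add: ennreal_mult'[symmetric] ennreal_plus[symmetric] distrib_right mult.assoc del: ennreal_plus)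
        qed
      qed
      also have "\<dots> = ennreal ((1-t) powr (1-p)) * ?G + ennreal (t powr (1-p)) * d k"
        unfolding d_def by (simp add: nn_integral_add nn_integral_cmult)
      finally show ?thesis .
    qed
    have "(\<lambda>k. ennreal ((1-t) powr (1-p)) * ?G + ennreal (t powr (1-p)) * d k) \<longlonglongrightarrow> ennreal ((1-t) powr (1-p)) * ?G + ennreal (t powr (1-p)) * 0"
      using conv unfolding d_def[symmetric] by (intro tendsto_add tendsto_const ennreal_tendsto_cmult) auto
    then have "liminf (\<lambda>k. ennreal ((1-t) powr (1-p)) * ?G + ennreal (t powr (1-p)) * d k) = ennreal ((1-t) powr (1-p)) * ?G"
      by (simp add: lim_imp_Liminf)
    moreover have "liminf (\<lambda>k. \<integral>\<^sup>+\<xi>. ennreal (\<bar>\<phi> k \<xi>\<bar> powr p * v \<xi>) * indicator \<Omega> \<xi> \<partial>lborel)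
       \<le> liminf (\<lambda>k. ennreal ((1-t) powr (1-p)) * ?G + ennreal (t powr (1-p)) * d k)"
      by (intro Liminf_mono always_eventually allI k)
    ultimately show ?thesis using U by simp
  qed
  show ?thesis
  proof (cases ?G rule: ennreal_cases)
    case (real G)
    note G = real(2,1)
    \<comment> \<open>The error term is already gone, so t may tend to 0 although its coefficient t
      powr (1-p) blows up.\<close>
    have "((\<lambda>t. (1-t) powr (1-p) * G) \<longlongrightarrow> (1-0) powr (1-p) * G) (at_right 0)"
      by (intro tendsto_mult tendsto_powr tendsto_diff tendsto_const tendsto_ident_at) simp
    then have l: "((\<lambda>t. ennreal ((1-t) powr (1-p) * G)) \<longlongrightarrow> ennreal ((1-0) powr (1-p) * G)) (at_right 0)"
      by (rule tendsto_ennrealI)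
    have e: "\<forall>\<^sub>F t in at_right 0. ?U \<le> ennreal ((1-t) powr (1-p) * G)"
      unfolding eventually_at_right_field
    proof (intro exI[of _ 1] conjI allI impI)
      fix t :: real assume "0 < t" "t < 1"
      have "ennreal ((1-t) powr (1-p) * G) = ennreal ((1-t) powr (1-p)) * ennreal G"
        by (rule ennreal_mult') simp
      with step[OF \<open>0 < t\<close> \<open>t < 1\<close>] G(1) show "?U \<le> ennreal ((1-t) powr (1-p) * G)"
        by (simp only:)
    qed simp
    have "?U \<le> ennreal ((1-0) powr (1-p) * G)"
      by (rule tendsto_lowerbound[OF l e]) simp
    then show ?thesis unfolding G(1) by simp
  next
    case top
    show ?thesis unfolding top by simp
  qed
qed

section \<open>Smooth functions\<close>

text \<open>By uniqueness of derivatives, the recursion of \<open>Ck\<close> can be run with any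
  derivative found by hand in place of \<open>frechet_derivative\<close>.\<close>

lemma CkI:
  fixes f :: "'a::euclidean_space \<Rightarrow> real"
  assumes "\<And>x. (f has_derivative D x) (at x)" and "\<And>v. Ck k (\<lambda>x. D x v)"
  shows "Ck (Suc k) f"
proof -
  have "frechet_derivative f (at x) = D x" for x by (rule frechet_derivative_at[OF assms(1), symmetric])
  then show ?thesis using assms by (auto simp: differentiable_def)
qed

lemma Ck_has_derivative:
  assumes "Ck (Suc k) f" shows "(f has_derivative frechet_derivative f (at x)) (at x)"
  using assms unfolding Ck.simps frechet_derivative_works by blast

text \<open>The recursion mentions continuity only at level 0, where it is recovered from
  differentiability; higher levels follow by applying the induction to the directional
  derivatives.\<close>

lemma Ck_mono: "Ck (Suc k) f \<Longrightarrow> Ck k f"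
proof (induction k arbitrary: f)
  case 0
  then have "f differentiable (at x)" for x by simp
  then show ?case by (simp add: differentiable_imp_continuous_within continuous_at_imp_continuous_on)
next
  case (Suc k)
  then have d: "\<forall>x. f differentiable (at x)" and c: "\<And>v. Ck (Suc k) (\<lambda>x. frechet_derivative f (at x) v)"
    using Ck.simps(2) by blast+
  from Suc.IH[OF c] d show ?case by simp
qed

lemma Ck_const: "Ck k (\<lambda>x::'a::euclidean_space. c)"
proof (induction k arbitrary: c)
  case (Suc k)
  show ?case by (rule CkI[where D = "\<lambda>_ _. 0"]) (use Suc in auto)
qed auto

lemma Ck_linear:
  fixes f :: "'a::euclidean_space \<Rightarrow> real"
  assumes "bounded_linear f" shows "Ck k f"
proof (cases k)
  case 0
  then show ?thesis using assms by (simp add: linear_continuous_on)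
next
  case (Suc j)
  show ?thesis unfolding Suc
    by (rule CkI[where D = "\<lambda>_. f"]) (use assms in \<open>auto intro: bounded_linear_imp_has_derivative Ck_const\<close>)
qed

lemma Ck_add:
  fixes f g :: "'a::euclidean_space \<Rightarrow> real"
  assumes "Ck k f" "Ck k g" shows "Ck k (\<lambda>x. f x + g x)"
  using assms
proof (induction k arbitrary: f g)
  case 0 then show ?case by (auto intro: continuous_intros)
next
  case (Suc k)
  show ?case
    by (rule CkI[OF has_derivative_add[OF Ck_has_derivative[OF Suc.prems(1)] Ck_has_derivative[OF Suc.prems(2)]]])
       (use Suc.prems in \<open>auto intro: Suc.IH\<close>)
qed

lemma Ck_mult:
  fixes f g :: "'a::euclidean_space \<Rightarrow> real"
  assumes "Ck k f" "Ck k g" shows "Ck k (\<lambda>x. f x * g x)"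
  using assms
proof (induction k arbitrary: f g)
  case 0 then show ?case by (auto intro: continuous_intros)
next
  case (Suc k)
  show ?case
    by (rule CkI[OF has_derivative_mult[OF Ck_has_derivative[OF Suc.prems(1)] Ck_has_derivative[OF Suc.prems(2)]]])
       (use Suc.prems Ck_mono[OF Suc.prems(1)] Ck_mono[OF Suc.prems(2)] in \<open>auto intro!: Ck_add Suc.IH\<close>)
qed

lemma Ck_sum:
  fixes f :: "'b \<Rightarrow> 'a::euclidean_space \<Rightarrow> real"
  assumes "\<And>i. i \<in> I \<Longrightarrow> Ck k (f i)" shows "Ck k (\<lambda>x. \<Sum>i\<in>I. f i x)"
  using assms
proof (induction I rule: infinite_finite_induct)
  case (insert i I)
  then show ?case using Ck_add[of k "f i" "\<lambda>x. \<Sum>i\<in>I. f i x"] by simp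
qed (simp_all add: Ck_const)

lemma smooth_const: "smooth (\<lambda>x::'a::euclidean_space. c)" by (simp add: smooth_def Ck_const)
lemma smooth_bounded_linear: "bounded_linear f \<Longrightarrow> smooth (f :: 'a::euclidean_space \<Rightarrow> real)" by (simp add: smooth_def Ck_linear)
lemma smooth_add: "smooth f \<Longrightarrow> smooth g \<Longrightarrow> smooth (\<lambda>x. f x + g x)" by (simp add: smooth_def Ck_add)
lemma smooth_mult: "smooth f \<Longrightarrow> smooth g \<Longrightarrow> smooth (\<lambda>x. f x * g x)" by (simp add: smooth_def Ck_mult)
lemma smooth_sum: "(\<And>i. i \<in> I \<Longrightarrow> smooth (f i)) \<Longrightarrow> smooth (\<lambda>x. \<Sum>i\<in>I. f i x)" by (simp add: smooth_def Ck_sum)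

text \<open>Chain rule for an outer function given by the sequence of its derivatives on a set;
  this covers \<open>ln\<close> and \<open>powr\<close>, which are smooth only on the positive reals.\<close>

lemma smooth_compose_family:
  fixes f :: "'a::euclidean_space \<Rightarrow> real" and g :: "nat \<Rightarrow> real \<Rightarrow> real"
  assumes g: "\<And>k x. x \<in> S \<Longrightarrow> (g k has_real_derivative g (Suc k) x) (at x)"
    and f: "smooth f" and S: "\<And>x. f x \<in> S"
  shows "smooth (\<lambda>x. g j (f x))"
proof -
  have "Ck k (\<lambda>x. g j (f x))" for k j
  proof (induction k arbitrary: j)
    case 0
    have "isCont (\<lambda>x. g j (f x)) x" for x
      by (rule isCont_o2[where g = "g j" and f = f, OF _ DERIV_isCont[OF g[OF S]]])
         (use smooth_continuous[OF f] in \<open>auto simp: continuous_on_eq_continuous_at\<close>)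
    then show ?case by (simp add: continuous_at_imp_continuous_on)
  next
    case (Suc k)
    show ?case
    proof (rule CkI)
      show "((\<lambda>x. g j (f x)) has_derivative (\<lambda>h. g (Suc j) (f x) * frechet_derivative f (at x) h)) (at x)" for x
        using has_derivative_compose[OF smooth_has_derivative[OF f] g[OF S, unfolded has_field_derivative_def]] .
      show "Ck k (\<lambda>x. g (Suc j) (f x) * frechet_derivative f (at x) v)" for v
        using Ck_mult[OF Suc.IH] smooth_deriv[OF f, of v] by (simp add: smooth_def)
    qed
  qed
  then show ?thesis by (simp add: smooth_def)
qed

text \<open>The ordinary derivative, written as a directional derivative so that its smoothness is
  immediate from the definition of \<open>Ck\<close>.\<close>

definition rderiv :: "(real \<Rightarrow> real) \<Rightarrow> real \<Rightarrow> real" where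
  "rderiv h x = frechet_derivative h (at x) 1"

lemma smooth_rderiv: "smooth h \<Longrightarrow> smooth (rderiv h)"
  unfolding rderiv_def by (rule smooth_deriv)

lemma rderiv_works:
  assumes "smooth h" shows "(h has_real_derivative rderiv h x) (at x)"
proof -
  have "frechet_derivative h (at x) = (\<lambda>y. rderiv h x * y)"
  proof
    fix y show "frechet_derivative h (at x) y = rderiv h x * y"
      using linear_cmul[OF smooth_linear[OF assms, of x], of y 1]
      unfolding rderiv_def real_scaleR_def mult_1_right by (simp only: mult.commute)
  qed
  then show ?thesis using smooth_has_derivative[OF assms, of x] by (simp add: has_field_derivative_def mult_commute_abs)
qed

lemma smooth_compose:
  fixes h :: "real \<Rightarrow> real"
  assumes h: "smooth h" and f: "smooth f" shows "smooth (\<lambda>x. h (f x))"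
proof -
  define g where "g k = (rderiv ^^ k) h" for k
  have "smooth (g k)" for k by (induction k) (auto simp: g_def h smooth_rderiv)
  then have "(g k has_real_derivative g (Suc k) x) (at x)" for k x
    using rderiv_works[of "g k" x] by (simp add: g_def)
  from smooth_compose_family[of UNIV g f 0, OF this f] show ?thesis by (simp add: g_def)
qed

lemma smooth_powr:
  assumes f: "smooth f" and pos: "\<And>x. f x > 0" shows "smooth (\<lambda>x. f x powr a)"
proof -
  define g where "g k x = (\<Prod>i<k. a - real i) * x powr (a - real k)" for k :: nat and x :: real
  have "(g k has_real_derivative g (Suc k) x) (at x)" if "x \<in> {0<..}" for k x
    using that unfolding g_def by (auto intro!: derivative_eq_intros simp: algebra_simps)
  from smooth_compose_family[of "{0<..}" g f 0, OF this f] pos show ?thesis by (simp add: g_def)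
qed

text \<open>The derivative of ln f is f powr (-1) times that of f, which is smooth by the power and
  product rules; this gives every level from 1 on, and monotonicity of \<open>Ck\<close> gives level
  0.\<close>

lemma smooth_ln:
  fixes f :: "'a::euclidean_space \<Rightarrow> real"
  assumes f: "smooth f" and pos: "\<And>x. f x > 0" shows "smooth (\<lambda>x. ln (f x))"
proof -
  have "Ck (Suc k) (\<lambda>x. ln (f x))" for k
  proof (rule CkI)
    show "((\<lambda>x. ln (f x)) has_derivative (\<lambda>h. f x powr (-1) * frechet_derivative f (at x) h)) (at x)" for x
      using has_derivative_ln[OF pos smooth_has_derivative[OF f], of x] pos[of x]
      by (simp add: powr_minus_divide divide_inverse mult.commute mult_commute_abs)
    show "Ck k (\<lambda>x. f x powr (-1) * frechet_derivative f (at x) v)" for v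
      using smooth_mult[OF smooth_powr[OF f pos] smooth_deriv[OF f]] unfolding smooth_def by blast
  qed
  then show ?thesis unfolding smooth_def using Ck_mono by blast
qed

lemma smooth_id: "smooth (\<lambda>x::real. x)"
  by (rule smooth_bounded_linear[OF bounded_linear_ident])

lemma smooth_affine: "smooth (\<lambda>x::real. a * x + b)"
  by (intro smooth_add smooth_mult smooth_const smooth_id)


section \<open>A smooth step function\<close>

lemma tendsto_poly_exp: "((\<lambda>y. poly q y * exp (- y)) \<longlongrightarrow> 0) (at_top :: real filter)"
proof -
  have "((\<lambda>y::real. \<Sum>i\<le>degree q. coeff q i * (y ^ i / exp y)) \<longlongrightarrow> (\<Sum>i\<le>degree q. coeff q i * 0)) at_top"
    by (intro tendsto_sum tendsto_mult tendsto_const tendsto_power_div_exp_0)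
  then show ?thesis by (simp add: poly_altdef sum_distrib_right exp_minus divide_inverse mult.assoc)
qed

text \<open>The derivatives of \<open>exp (-1/x)\<close> are \<open>q (1/x) * exp (-1/x)\<close> for polynomials \<open>q\<close>.\<close>

definition flat :: "real poly \<Rightarrow> real \<Rightarrow> real" where
  "flat q x = (if x > 0 then poly q (inverse x) * exp (- inverse x) else 0)"

text \<open>With y = 1/x, differentiating q(y) exp (-y) gives y^2 (q(y) - q'(y)) exp (-y); the
  polynomial \<open>[:0, 0, 1:]\<close> is y^2.\<close>

lemma flat_deriv:
  "(flat q has_real_derivative flat ([:0, 0, 1:] * (q - pderiv q)) x) (at x)"
proof -
  consider "x > 0" | "x < 0" | "x = 0" by linarith
  then show ?thesis
  proof cases
    case 1
    have "((\<lambda>x. poly q (inverse x) * exp (- inverse x)) has_real_derivative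
        poly ([:0, 0, 1:] * (q - pderiv q)) (inverse x) * exp (- inverse x)) (at x)"
      using 1 by (auto intro!: derivative_eq_intros DERIV_chain2[OF poly_DERIV] simp: algebra_simps power2_eq_square)
    then have "((\<lambda>x. poly q (inverse x) * exp (- inverse x)) has_real_derivative flat ([:0, 0, 1:] * (q - pderiv q)) x) (at x)"
      using 1 by (simp add: flat_def)
    then show ?thesis
      by (rule has_field_derivative_transform_within_open[where S = "{0<..}"]) (use 1 in \<open>auto simp: flat_def\<close>)
  next
    case 2
    have "((\<lambda>x. 0) has_real_derivative flat ([:0, 0, 1:] * (q - pderiv q)) x) (at x)"
      using 2 by (simp add: flat_def)
    then show ?thesis
      by (rule has_field_derivative_transform_within_open[where S = "{..<0}"]) (use 2 in \<open>auto simp: flat_def\<close>)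
  next
    case 3
    have r: "((\<lambda>h. flat q h / h) \<longlongrightarrow> 0) (at_right 0)"
    proof -
      \<comment> \<open>Dividing by h multiplies the polynomial by y = 1/h, so the difference
        quotient at 0 has the same form and tends to 0.\<close>
      have "((\<lambda>h. poly (pCons 0 q) (inverse h) * exp (- inverse h)) \<longlongrightarrow> 0) (at_right (0::real))"
        by (rule filterlim_compose[OF tendsto_poly_exp filterlim_inverse_at_top_right])
      moreover have "\<forall>\<^sub>F h in at_right 0. poly (pCons 0 q) (inverse h) * exp (- inverse h) = flat q h / h"
        unfolding eventually_at_right_field by (intro exI[of _ 1]) (auto simp: flat_def divide_inverse)
      ultimately show ?thesis by (rule Lim_transform_eventually)
    qed
    have l: "((\<lambda>h. flat q h / h) \<longlongrightarrow> 0) (at_left 0)"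
    proof (rule Lim_transform_eventually[OF tendsto_const])
      show "\<forall>\<^sub>F h in at_left 0. 0 = flat q h / h"
        unfolding eventually_at_left_field by (intro exI[of _ "-1"]) (auto simp: flat_def)
    qed
    from r l have "((\<lambda>h. flat q h / h) \<longlongrightarrow> 0) (at 0)" by (simp add: filterlim_at_split)
    then show ?thesis using 3 by (simp add: DERIV_def flat_def)
  qed
qed

lemma smooth_flat: "smooth (flat q)"
proof -
  define g where "g k = flat (((\<lambda>q. [:0, 0, 1:] * (q - pderiv q)) ^^ k) q)" for k
  have "(g k has_real_derivative g (Suc k) x) (at x)" for k x
    unfolding g_def using flat_deriv by simp
  from smooth_compose_family[of UNIV g "\<lambda>x. x" 0, OF this smooth_id] show ?thesis by (simp add: g_def)
qed

text \<open>The quotient f(x) / (f(x) + f(1-x)) with f(x) = exp (-1/x) for x > 0 and 0 otherwise.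
  Its denominator is positive because x or 1-x is. The derivative is bounded since it vanishes off
  [0, 1]; this bound later controls the energy of the transition regions.\<close>

lemma smooth_step_exists:
  obtains S :: "real \<Rightarrow> real" and K where "smooth S" "\<And>x. x \<le> 0 \<Longrightarrow> S x = 0" "\<And>x. x \<ge> 1 \<Longrightarrow> S x = 1"
    "\<And>x. 0 \<le> S x" "\<And>x. S x \<le> 1" "\<And>x. \<bar>rderiv S x\<bar> \<le> K"
proof -
  define d where "d x = flat 1 x + flat 1 (1 - x)" for x
  define S where "S x = flat 1 x * d x powr (-1)" for x
  have f0: "flat 1 x \<ge> 0" for x by (simp add: flat_def)
  have fp: "flat 1 x > 0" if "x > 0" for x using that by (simp add: flat_def)
  have d: "d x > 0" for x
    using f0[of x] f0[of "1-x"] fp[of x] fp[of "1-x"] unfolding d_def by (cases "x > 0") auto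
  have "smooth (\<lambda>x. flat 1 (1 - x))"
    using smooth_compose[OF smooth_flat smooth_affine[of "-1" 1]] by simp
  then have sd: "smooth d" unfolding d_def[abs_def] by (intro smooth_add smooth_flat)
  have sS: "smooth S" unfolding S_def[abs_def] by (intro smooth_mult smooth_flat smooth_powr sd d)
  have Sd: "S x = flat 1 x / d x" for x using d[of x] by (simp add: S_def powr_minus_divide)
  have S0: "S x = 0" if "x \<le> 0" for x using that by (simp add: Sd flat_def)
  have S1: "S x = 1" if "x \<ge> 1" for x using that d[of x] by (simp add: Sd d_def flat_def)
  have Sge: "0 \<le> S x" for x using f0 d[of x] by (simp add: Sd)
  have Sle: "S x \<le> 1" for x using f0[of "1-x"] d[of x] by (simp add: Sd d_def)
  have "continuous_on {0..1} (rderiv S)"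
    using smooth_continuous[OF smooth_rderiv[OF sS]] continuous_on_subset by blast
  then have "bounded (rderiv S ` {0..1})" by (intro compact_imp_bounded compact_continuous_image) auto
  then obtain B where "\<forall>y\<in>rderiv S ` {0..1}. norm y \<le> B" unfolding bounded_iff by blast
  then have B: "\<bar>rderiv S x\<bar> \<le> B" if "x \<in> {0..1}" for x using that by auto
  have SB: "\<bar>rderiv S x\<bar> \<le> \<bar>B\<bar>" for x
  proof -
    consider "x < 0" | "x > 1" | "x \<in> {0..1}" by force
    then show ?thesis
    proof cases
      case 1
      have "(S has_real_derivative 0) (at x)"
        by (rule has_field_derivative_transform_within_open[of "\<lambda>_. 0" _ _ "{..<0}"]) (use 1 S0 in auto)
      then show ?thesis using DERIV_unique[OF rderiv_works[OF sS]] by auto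
    next
      case 2
      have "(S has_real_derivative 0) (at x)"
        by (rule has_field_derivative_transform_within_open[of "\<lambda>_. 1" _ _ "{1<..}"]) (use 2 S1 in auto)
      then show ?thesis using DERIV_unique[OF rderiv_works[OF sS]] by auto
    qed (use B[of x] in linarith)
  qed
  show thesis by (rule that[OF sS S0 S1 Sge Sle SB])
qed

section \<open>Functions of the gauge\<close>

text \<open>\<open>areg \<gamma> 0\<close> is \<open>N\<close> to the power \<open>4\<gamma>\<close>; for \<open>\<delta> > 0\<close> the function is smooth, which \<open>N\<close> is not on \<open>r = 0\<close>.\<close>

definition areg :: "real \<Rightarrow> real \<Rightarrow> 'n::finite pt \<Rightarrow> real" where
  "areg \<gamma> \<delta> \<xi> = (xc \<xi> \<bullet> xc \<xi> + yc \<xi> \<bullet> yc \<xi> + \<delta>) powr (2*\<gamma>) + (tc \<xi>)\<^sup>2"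

lemma rr_square: "(rr \<xi>)\<^sup>2 = xc \<xi> \<bullet> xc \<xi> + yc \<xi> \<bullet> yc \<xi>"
  by (simp add: rr_def power2_norm_eq_inner)

lemma rr_square_powr: "(xc \<xi> \<bullet> xc \<xi> + yc \<xi> \<bullet> yc \<xi>) powr a = rr \<xi> powr (2 * a)"
proof -
  have "(rr \<xi>)\<^sup>2 = rr \<xi> powr 2" by (cases "rr \<xi> = 0") (simp_all add: powr_numeral)
  then show ?thesis unfolding rr_square[symmetric] by (simp only: powr_powr)
qed

lemma areg_0: "\<gamma> > 0 \<Longrightarrow> areg \<gamma> 0 \<xi> = NN \<gamma> \<xi> powr (4*\<gamma>)"
  by (simp add: areg_def NN_power rr_square_powr)

lemma areg_mono: "\<gamma> > 0 \<Longrightarrow> \<delta> \<ge> 0 \<Longrightarrow> areg \<gamma> 0 \<xi> \<le> areg \<gamma> \<delta> \<xi>"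
  unfolding areg_def by (intro add_right_mono powr_mono2) auto

lemma areg_pos: "\<delta> > 0 \<Longrightarrow> areg \<gamma> \<delta> \<xi> > 0"
proof -
  assume "\<delta> > 0"
  then have "xc \<xi> \<bullet> xc \<xi> + yc \<xi> \<bullet> yc \<xi> + \<delta> > 0" by (intro add_nonneg_pos add_nonneg_nonneg) auto
  then show ?thesis unfolding areg_def by (intro add_pos_nonneg) auto
qed

definition lreg :: "real \<Rightarrow> real \<Rightarrow> 'n::finite pt \<Rightarrow> real" where
  "lreg \<gamma> \<delta> \<xi> = ln (areg \<gamma> \<delta> \<xi>) / (4*\<gamma>)"

lemma lreg_0: "\<gamma> > 0 \<Longrightarrow> lreg \<gamma> 0 \<xi> = ln (NN \<gamma> \<xi>)"
  by (simp add: lreg_def areg_0 ln_powr)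

lemma smooth_areg:
  assumes "\<delta> > 0" shows "smooth (areg \<gamma> \<delta> :: 'n::finite pt \<Rightarrow> real)"
proof -
  have x: "smooth (\<lambda>\<xi>::'n pt. xc \<xi> $ i)" for i
    unfolding xc_def by (intro smooth_bounded_linear bounded_linear_compose[OF bounded_linear_vec_nth bounded_linear_fst])
  have y: "smooth (\<lambda>\<xi>::'n pt. yc \<xi> $ i)" for i
    unfolding yc_def by (intro smooth_bounded_linear bounded_linear_compose[OF bounded_linear_vec_nth]
        bounded_linear_compose[OF bounded_linear_fst bounded_linear_snd])
  have t: "smooth (tc :: 'n pt \<Rightarrow> real)"
    unfolding tc_def by (intro smooth_bounded_linear bounded_linear_compose[OF bounded_linear_snd bounded_linear_snd])
  have "smooth (\<lambda>\<xi>::'n pt. xc \<xi> \<bullet> xc \<xi> + yc \<xi> \<bullet> yc \<xi> + \<delta>)"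
    unfolding inner_vec_def inner_real_def by (intro smooth_add smooth_sum smooth_mult smooth_const x y)
  moreover have "xc \<xi> \<bullet> xc \<xi> + yc \<xi> \<bullet> yc \<xi> + \<delta> > 0" for \<xi> :: "'n pt"
    using assms by (intro add_nonneg_pos add_nonneg_nonneg) auto
  ultimately have "smooth (\<lambda>\<xi>::'n pt. (xc \<xi> \<bullet> xc \<xi> + yc \<xi> \<bullet> yc \<xi> + \<delta>) powr (2*\<gamma>))"
    by (rule smooth_powr)
  from smooth_add[OF this smooth_mult[OF t t]] show ?thesis
    by (simp add: areg_def[abs_def] power2_eq_square)
qed

lemma smooth_lreg:
  assumes "\<delta> > 0" shows "smooth (lreg \<gamma> \<delta> :: 'n::finite pt \<Rightarrow> real)"
proof -
  have "smooth (\<lambda>\<xi>::'n pt. (1/(4*\<gamma>)) * ln (areg \<gamma> \<delta> \<xi>))"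
    by (intro smooth_mult smooth_const smooth_ln smooth_areg assms areg_pos)
  then show ?thesis by (simp add: lreg_def[abs_def])
qed

lemma lreg_deriv:
  fixes \<xi> :: "'n::finite pt"
  assumes "\<delta> > 0" "\<gamma> > 0"
  shows "(lreg \<gamma> \<delta> has_derivative (\<lambda>v. ((xc \<xi> \<bullet> xc \<xi> + yc \<xi> \<bullet> yc \<xi> + \<delta>) powr (2*\<gamma>-1) * (xc \<xi> \<bullet> xc v + yc \<xi> \<bullet> yc v)
     + tc \<xi> * tc v / (2*\<gamma>)) / areg \<gamma> \<delta> \<xi>)) (at \<xi>)"
proof -
  define \<rho> where "\<rho> \<xi> = xc \<xi> \<bullet> xc \<xi> + yc \<xi> \<bullet> yc \<xi> + \<delta>" for \<xi> :: "'n pt"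
  have \<rho>0: "\<rho> \<xi> > 0" using assms unfolding \<rho>_def by (intro add_nonneg_pos add_nonneg_nonneg) auto
  have x: "(xc has_derivative xc) (at \<xi>)" unfolding xc_def[abs_def] by (intro derivative_intros)
  have y: "(yc has_derivative yc) (at \<xi>)" unfolding yc_def[abs_def] by (intro derivative_intros)
  have t: "(tc has_derivative tc) (at \<xi>)" unfolding tc_def[abs_def] by (intro derivative_intros)
  have d\<rho>: "(\<rho> has_derivative (\<lambda>v. 2 * (xc \<xi> \<bullet> xc v + yc \<xi> \<bullet> yc v))) (at \<xi>)"
    unfolding \<rho>_def[abs_def]
    by (rule has_derivative_eq_rhs[OF has_derivative_add[OF has_derivative_add[OF has_derivative_inner[OF x x] has_derivative_inner[OF y y]] has_derivative_const]])
       (auto simp: inner_commute)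
  have "((\<lambda>z. z powr (2*\<gamma>)) has_real_derivative (2*\<gamma>) * \<rho> \<xi> powr (2*\<gamma>-1)) (at (\<rho> \<xi>))"
    using \<rho>0 by (auto intro!: derivative_eq_intros)
  then have d1: "((\<lambda>\<xi>. \<rho> \<xi> powr (2*\<gamma>)) has_derivative (\<lambda>v. (2*\<gamma>) * \<rho> \<xi> powr (2*\<gamma>-1) * (2 * (xc \<xi> \<bullet> xc v + yc \<xi> \<bullet> yc v)))) (at \<xi>)"
    unfolding has_field_derivative_def using has_derivative_compose[OF d\<rho>] by blast
  have d2: "((\<lambda>\<xi>. (tc \<xi>)\<^sup>2) has_derivative (\<lambda>v. 2 * (tc \<xi> * tc v))) (at \<xi>)"
    by (rule has_derivative_eq_rhs[OF has_derivative_power[OF t]]) auto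
  have dA: "(areg \<gamma> \<delta> has_derivative (\<lambda>v. (2*\<gamma>) * \<rho> \<xi> powr (2*\<gamma>-1) * (2 * (xc \<xi> \<bullet> xc v + yc \<xi> \<bullet> yc v)) + 2 * (tc \<xi> * tc v))) (at \<xi>)"
    using has_derivative_add[OF d1 d2] unfolding areg_def[abs_def] \<rho>_def .
  have "((\<lambda>z. ln z / (4*\<gamma>)) has_real_derivative (1 / areg \<gamma> \<delta> \<xi>) / (4*\<gamma>)) (at (areg \<gamma> \<delta> \<xi>))"
    using areg_pos[OF assms(1), of \<gamma> \<xi>] assms by (auto intro!: derivative_eq_intros)
  then have "(lreg \<gamma> \<delta> has_derivative (\<lambda>v. (1 / areg \<gamma> \<delta> \<xi>) / (4*\<gamma>) * ((2*\<gamma>) * \<rho> \<xi> powr (2*\<gamma>-1) * (2 * (xc \<xi> \<bullet> xc v + yc \<xi> \<bullet> yc v)) + 2 * (tc \<xi> * tc v)))) (at \<xi>)"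
    unfolding has_field_derivative_def lreg_def[abs_def] using has_derivative_compose[OF dA] by blast
  then show ?thesis
    by (rule has_derivative_eq_rhs) (use assms areg_pos[OF assms(1), of \<gamma> \<xi>] in \<open>auto simp: \<rho>_def field_simps\<close>)
qed

text \<open>The closed form of the horizontal gradient of h composed with \<open>lreg\<close>. It
  still makes sense at \<delta> = 0, where it serves as the gradient of h (ln N) without any
  differentiation of N on r = 0.\<close>

definition greg :: "real \<Rightarrow> (real \<Rightarrow> real) \<Rightarrow> real \<Rightarrow> 'n::finite pt \<Rightarrow> (real^'n) \<times> (real^'n)" where
  "greg \<gamma> h \<delta> \<xi> = (rderiv h (lreg \<gamma> \<delta> \<xi>) / areg \<gamma> \<delta> \<xi>) *\<^sub>R
     ((xc \<xi> \<bullet> xc \<xi> + yc \<xi> \<bullet> yc \<xi> + \<delta>) powr (2*\<gamma>-1) *\<^sub>R (xc \<xi>, yc \<xi>) + (rr \<xi> powr (2*\<gamma>-2) * tc \<xi>) *\<^sub>R (yc \<xi>, - xc \<xi>))"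

lemma gradL_profile:
  assumes h: "smooth h" and \<delta>: "\<delta> > 0" and \<gamma>: "\<gamma> > 0"
  shows "gradL \<gamma> (\<lambda>\<xi>. h (lreg \<gamma> \<delta> \<xi>)) \<xi> = greg \<gamma> h \<delta> \<xi>"
proof -
  define P where "P = (xc \<xi> \<bullet> xc \<xi> + yc \<xi> \<bullet> yc \<xi> + \<delta>) powr (2*\<gamma>-1)"
  define A where "A = areg \<gamma> \<delta> \<xi>"
  define h' where "h' = rderiv h (lreg \<gamma> \<delta> \<xi>)"
  have "((\<lambda>\<xi>. h (lreg \<gamma> \<delta> \<xi>)) has_derivative (\<lambda>v. h' * ((P * (xc \<xi> \<bullet> xc v + yc \<xi> \<bullet> yc v)
     + tc \<xi> * tc v / (2*\<gamma>)) / A))) (at \<xi>)"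
    using has_derivative_compose[OF lreg_deriv[OF \<delta> \<gamma>] rderiv_works[OF h, unfolded has_field_derivative_def]]
    unfolding P_def A_def h'_def .
  from frechet_derivative_at[OF this, symmetric]
  have D: "frechet_derivative (\<lambda>\<xi>. h (lreg \<gamma> \<delta> \<xi>)) (at \<xi>) = (\<lambda>v. h' * ((P * (xc \<xi> \<bullet> xc v + yc \<xi> \<bullet> yc v)
     + tc \<xi> * tc v / (2*\<gamma>)) / A))" .
  have A: "A > 0" unfolding A_def by (rule areg_pos[OF \<delta>])
  have X: "Xf \<gamma> (\<lambda>\<xi>. h (lreg \<gamma> \<delta> \<xi>)) i \<xi> = h' / A * (P * xc \<xi> $ i + (rr \<xi> powr (2*\<gamma>-2) * tc \<xi>) * yc \<xi> $ i)" for i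
    unfolding Xf_def D using \<gamma> A by (simp add: inner_axis field_simps)
  have Y: "Yf \<gamma> (\<lambda>\<xi>. h (lreg \<gamma> \<delta> \<xi>)) i \<xi> = h' / A * (P * yc \<xi> $ i - (rr \<xi> powr (2*\<gamma>-2) * tc \<xi>) * xc \<xi> $ i)" for i
    unfolding Yf_def D using \<gamma> A by (simp add: inner_axis field_simps)
  show ?thesis
    unfolding gradL_def X Y greg_def A_def[symmetric] P_def[symmetric] h'_def[symmetric]
    by (simp add: vec_eq_iff)
qed

text \<open>The vectors (x, y) and (y, -x) are orthogonal of length r. Their coefficients P =
  r^(4\<gamma>-2) and q = r^(2\<gamma>-2) t satisfy (P^2 + q^2) r^2 = r^(4\<gamma>-2) N^(4\<gamma>),
  so the gradient of ln N has length r^(2\<gamma>-1) / N^(2\<gamma>). It is parallel to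
  \<open>hor\<close>, in the ratio q/P = t / r^(2\<gamma>).\<close>

lemma norm_greg_0:
  assumes \<gamma>: "\<gamma> \<ge> 1" and \<xi>: "\<xi> \<noteq> 0"
  shows "norm (greg \<gamma> h 0 \<xi>) = \<bar>rderiv h (ln (NN \<gamma> \<xi>))\<bar> * NN \<gamma> \<xi> powr (-1) * (rr \<xi> powr (2*\<gamma>-1) / NN \<gamma> \<xi> powr (2*\<gamma>-1))"
proof -
  let ?N = "NN \<gamma> \<xi>" and ?r = "rr \<xi>"
  have g0: "\<gamma> > 0" using \<gamma> by simp
  have N: "?N > 0" by (rule NN_pos[OF g0 \<xi>])
  define P where "P = ?r powr (4*\<gamma>-2)"
  define q where "q = ?r powr (2*\<gamma>-2) * tc \<xi>"
  have P: "(xc \<xi> \<bullet> xc \<xi> + yc \<xi> \<bullet> yc \<xi> + 0) powr (2*\<gamma>-1) = P"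
    unfolding P_def add_0_right rr_square_powr by (simp add: algebra_simps)
  have "(norm (P *\<^sub>R (xc \<xi>, yc \<xi>) + q *\<^sub>R (yc \<xi>, - xc \<xi>)))\<^sup>2
    = (norm (P *\<^sub>R xc \<xi> + q *\<^sub>R yc \<xi>))\<^sup>2 + (norm (P *\<^sub>R yc \<xi> - q *\<^sub>R xc \<xi>))\<^sup>2"
    by (simp add: norm_Pair)
  also have "\<dots> = (P\<^sup>2 + q\<^sup>2) * (xc \<xi> \<bullet> xc \<xi> + yc \<xi> \<bullet> yc \<xi>)"
    by (simp only: power2_norm_eq_inner inner_add_left inner_add_right inner_diff_left inner_diff_right
        inner_scaleR_left inner_scaleR_right inner_commute[of "yc \<xi>" "xc \<xi>"]) algebra
  also have "\<dots> = (?r powr (2*\<gamma>-1) * ?N powr (2*\<gamma>))\<^sup>2"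
  proof (cases "?r = 0")
    case True
    then show ?thesis by (simp add: rr_square[symmetric])
  next
    case False
    then have r: "?r > 0" using rr_nonneg[of \<xi>] by linarith
    have sq: "(z powr a)\<^sup>2 = z powr (2*a)" for z a :: real by (simp add: power2_eq_square powr_add[symmetric])
    have r2: "?r\<^sup>2 = ?r powr 2" using r by (simp add: powr_numeral)
    have "(P\<^sup>2 + q\<^sup>2) * ?r\<^sup>2 = ?r powr (8*\<gamma>-4) * ?r powr 2 + ?r powr (4*\<gamma>-4) * ?r powr 2 * (tc \<xi>)\<^sup>2"
      unfolding P_def q_def power_mult_distrib sq r2 by (simp add: algebra_simps)
    also have "\<dots> = ?r powr (4*\<gamma>-2) * ?r powr (4*\<gamma>) + ?r powr (4*\<gamma>-2) * (tc \<xi>)\<^sup>2"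
      unfolding powr_add[symmetric] by simp
    also have "\<dots> = ?r powr (4*\<gamma>-2) * ?N powr (4*\<gamma>)" unfolding NN_power[OF g0] by (simp add: distrib_left)
    also have "\<dots> = (?r powr (2*\<gamma>-1) * ?N powr (2*\<gamma>))\<^sup>2"
      unfolding power_mult_distrib sq by simp
    finally show ?thesis by (simp add: rr_square)
  qed
  finally have n: "norm (P *\<^sub>R (xc \<xi>, yc \<xi>) + q *\<^sub>R (yc \<xi>, - xc \<xi>)) = ?r powr (2*\<gamma>-1) * ?N powr (2*\<gamma>)"
    by (simp add: power2_eq_iff_nonneg)
  have "norm (greg \<gamma> h 0 \<xi>) = \<bar>rderiv h (ln ?N)\<bar> / ?N powr (4*\<gamma>) * (?r powr (2*\<gamma>-1) * ?N powr (2*\<gamma>))"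
    unfolding greg_def P q_def[symmetric] norm_scaleR n lreg_0[OF g0] areg_0[OF g0] by simp
  also have "\<dots> = \<bar>rderiv h (ln ?N)\<bar> * ?r powr (2*\<gamma>-1) * (?N powr (-(4*\<gamma>)) * ?N powr (2*\<gamma>))"
    by (simp add: powr_minus divide_inverse)
  also have "?N powr (-(4*\<gamma>)) * ?N powr (2*\<gamma>) = ?N powr (-1) * ?N powr (-(2*\<gamma>-1))"
    unfolding powr_add[symmetric] by simp
  also have "?N powr (-(2*\<gamma>-1)) = inverse (?N powr (2*\<gamma>-1))" by (rule powr_minus)
  finally show ?thesis by (simp add: divide_inverse mult_ac)
qed

lemma rderiv_zero_off:
  assumes h: "smooth h" and z: "\<forall>s. s \<notin> {c..d} \<longrightarrow> h s = 0" and s: "s \<notin> {c..d}"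
  shows "rderiv h s = 0"
proof -
  have "(h has_real_derivative 0) (at s)"
    by (rule has_field_derivative_transform_within_open[of "\<lambda>_. 0" _ _ "- {c..d}"]) (use s z in auto)
  then show ?thesis using DERIV_unique[OF rderiv_works[OF h]] by auto
qed

text \<open>For all small \<delta>, including 0, the regularised profiles live in one fixed gauge
  annulus. The upper bound is monotonicity of \<open>areg\<close> in \<delta>. For the lower one let
  c0 = exp c / 2: where N < c0, \<open>areg\<close> is at most (4^\<gamma> + 1) c0^(4\<gamma>),
  while \<open>lreg\<close> \<ge> c requires at least (2 c0)^(4\<gamma>) = 16^\<gamma>
  c0^(4\<gamma>). These are incompatible for \<gamma> \<ge> 1.\<close>

lemma lreg_range:
  assumes \<gamma>: "\<gamma> \<ge> 1" and \<delta>: "0 \<le> \<delta>" "\<delta> \<le> (exp c / 2)\<^sup>2" and A: "areg \<gamma> \<delta> \<xi> > 0"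
    and l: "lreg \<gamma> \<delta> \<xi> \<in> {c..d}"
  shows "exp c / 2 \<le> NN \<gamma> \<xi>" "NN \<gamma> \<xi> \<le> exp d"
proof -
  have g0: "\<gamma> > 0" using \<gamma> by simp
  define c0 where "c0 = exp c / 2"
  have c0: "c0 > 0" by (simp add: c0_def)
  have lA: "4*\<gamma>*c \<le> ln (areg \<gamma> \<delta> \<xi>)" "ln (areg \<gamma> \<delta> \<xi>) \<le> 4*\<gamma>*d"
    using l g0 by (auto simp: lreg_def field_simps)
  have "exp (4*\<gamma>*c) \<le> exp (ln (areg \<gamma> \<delta> \<xi>))" "exp (ln (areg \<gamma> \<delta> \<xi>)) \<le> exp (4*\<gamma>*d)"
    using lA by (simp_all only: exp_le_cancel_iff)
  then have eA: "exp (4*\<gamma>*c) \<le> areg \<gamma> \<delta> \<xi>" "areg \<gamma> \<delta> \<xi> \<le> exp (4*\<gamma>*d)" using A by simp_all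
  have "NN \<gamma> \<xi> powr (4*\<gamma>) \<le> exp (4*\<gamma>*d)" using eA(2) areg_mono[OF g0 \<delta>(1), of \<xi>] by (simp add: areg_0 g0)
  then have "NN \<gamma> \<xi> powr (4*\<gamma>) \<le> exp d powr (4*\<gamma>)" by (simp add: exp_powr_real mult_ac)
  then show "NN \<gamma> \<xi> \<le> exp d" using powr_less_mono2[of "4*\<gamma>" "exp d" "NN \<gamma> \<xi>"] g0 by (force simp: not_less[symmetric])
  show "exp c / 2 \<le> NN \<gamma> \<xi>"
  proof (rule ccontr)
    assume "\<not> exp c / 2 \<le> NN \<gamma> \<xi>"
    then have N: "NN \<gamma> \<xi> \<le> c0" by (simp add: c0_def)
    have "(rr \<xi>)\<^sup>2 \<le> c0\<^sup>2" using rr_le_NN[OF g0, of \<xi>] N by (intro power_mono) auto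
    then have "(xc \<xi> \<bullet> xc \<xi> + yc \<xi> \<bullet> yc \<xi> + \<delta>) powr (2*\<gamma>) \<le> (2 * c0\<^sup>2) powr (2*\<gamma>)"
      using \<delta> g0 unfolding rr_square c0_def by (intro powr_mono2) auto
    moreover have "(tc \<xi>)\<^sup>2 \<le> NN \<gamma> \<xi> powr (4*\<gamma>)" unfolding NN_power[OF g0] by simp
    moreover have "NN \<gamma> \<xi> powr (4*\<gamma>) \<le> c0 powr (4*\<gamma>)" using N g0 by (intro powr_mono2) auto
    ultimately have a: "areg \<gamma> \<delta> \<xi> \<le> (2 * c0\<^sup>2) powr (2*\<gamma>) + c0 powr (4*\<gamma>)" unfolding areg_def by linarith
    have e1: "(2 * c0\<^sup>2) powr (2*\<gamma>) = 4 powr \<gamma> * c0 powr (4*\<gamma>)"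
    proof -
      have "c0\<^sup>2 = c0 powr 2" using c0 by (simp add: powr_numeral)
      moreover have "(4::real) powr \<gamma> = 2 powr (2*\<gamma>)" by (simp add: powr_powr[symmetric] powr_numeral)
      ultimately show ?thesis by (simp add: powr_mult powr_powr)
    qed
    have e2: "exp (4*\<gamma>*c) = 16 powr \<gamma> * c0 powr (4*\<gamma>)"
    proof -
      have "(16::real) powr \<gamma> = 2 powr (4*\<gamma>)" by (simp add: powr_powr[symmetric] powr_numeral)
      then have "16 powr \<gamma> * c0 powr (4*\<gamma>) = (2 * c0) powr (4*\<gamma>)" by (simp add: powr_mult)
      then show ?thesis by (simp add: c0_def exp_powr_real mult_ac)
    qed
    have "(4::real) powr \<gamma> \<ge> 4 powr 1" using \<gamma> by (intro powr_mono) auto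
    then have q: "(4::real) powr \<gamma> \<ge> 4" by simp
    have "(16::real) powr \<gamma> = 4 powr \<gamma> * 4 powr \<gamma>" by (simp add: powr_mult[symmetric])
    moreover have "(4::real) powr \<gamma> * 4 \<le> 4 powr \<gamma> * 4 powr \<gamma>" using q by (intro mult_left_mono) auto
    ultimately have "4 powr \<gamma> + 1 < (16::real) powr \<gamma>" using q by linarith
    then have "(4 powr \<gamma> + 1) * c0 powr (4*\<gamma>) < 16 powr \<gamma> * c0 powr (4*\<gamma>)" using c0 by (intro mult_strict_right_mono) auto
    then show False using a eA(1) unfolding e1 e2 by (simp add: distrib_right)
  qed
qed

lemma measurable_profile:
  assumes h: "smooth h"
  shows "(\<lambda>\<xi>::'n::finite pt. h (lreg \<gamma> \<delta> \<xi>)) \<in> borel_measurable borel"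
    "greg \<gamma> h \<delta> \<in> borel_measurable (borel :: 'n::finite pt measure)"
proof -
  have [measurable]: "h \<in> borel_measurable borel" "rderiv h \<in> borel_measurable borel"
    by (rule smooth_measurable[OF h], rule smooth_measurable[OF smooth_rderiv[OF h]])
  have [measurable]: "(areg \<gamma> \<delta> :: 'n pt \<Rightarrow> real) \<in> borel_measurable borel" unfolding areg_def by measurable
  have [measurable]: "(lreg \<gamma> \<delta> :: 'n pt \<Rightarrow> real) \<in> borel_measurable borel" unfolding lreg_def by measurable
  show "(\<lambda>\<xi>::'n pt. h (lreg \<gamma> \<delta> \<xi>)) \<in> borel_measurable borel" by measurable
  have m: "(\<lambda>\<xi>::'n pt. (xc \<xi>, yc \<xi>)) \<in> borel_measurable borel" "(\<lambda>\<xi>::'n pt. (yc \<xi>, - xc \<xi>)) \<in> borel_measurable borel"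
    by (intro borel_measurable_Pair; measurable)+
  note [measurable] = m
  show "greg \<gamma> h \<delta> \<in> borel_measurable (borel :: 'n pt measure)" unfolding greg_def by measurable
qed

lemma norm_xy: "norm (xc \<xi>, yc \<xi>) = rr \<xi>" "norm (yc \<xi>, - xc \<xi>) = rr \<xi>"
  by (simp_all add: norm_Pair rr_def add.commute)

lemma areg_nonneg: "areg \<gamma> \<delta> \<xi> \<ge> 0"
  by (simp add: areg_def)

lemma greg_zero_off:
  assumes \<gamma>: "\<gamma> \<ge> 1" and h: "smooth h" and z: "\<forall>s. s \<notin> {c..d} \<longrightarrow> h s = 0"
    and \<delta>: "0 \<le> \<delta>" "\<delta> \<le> (exp c / 2)\<^sup>2" and \<xi>: "\<not> (exp c / 2 \<le> NN \<gamma> \<xi> \<and> NN \<gamma> \<xi> \<le> exp d)"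
  shows "greg \<gamma> h \<delta> \<xi> = 0"
proof (cases "areg \<gamma> \<delta> \<xi> > 0")
  case True
  then have "lreg \<gamma> \<delta> \<xi> \<notin> {c..d}" using lreg_range[OF \<gamma> \<delta> True] \<xi> by blast
  then have "rderiv h (lreg \<gamma> \<delta> \<xi>) = 0" by (rule rderiv_zero_off[OF h z])
  then show ?thesis by (simp add: greg_def zero_prod_def)
next
  case False
  then have "areg \<gamma> \<delta> \<xi> = 0" using areg_nonneg[of \<gamma> \<delta> \<xi>] by linarith
  then show ?thesis by (simp add: greg_def zero_prod_def)
qed

text \<open>The bound is uniform in \<delta>, as dominated convergence requires. On the annulus the
  denominator stays above c0^(4\<gamma>) because \<open>areg\<close> increases with \<delta>, and
  r^(2\<gamma>-2) stays bounded because \<gamma> \<ge> 1; off the annulus the field is 0.\<close>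

lemma greg_bounded:
  assumes \<gamma>: "\<gamma> \<ge> 1" and h: "smooth h" and z: "\<forall>s. s \<notin> {c..d} \<longrightarrow> h s = 0"
  shows "\<exists>M. \<forall>\<delta> \<xi>. 0 \<le> \<delta> \<and> \<delta> \<le> (exp c / 2)\<^sup>2 \<longrightarrow> norm (greg \<gamma> h \<delta> (\<xi>::'n::finite pt)) \<le> M"
proof -
  have g0: "\<gamma> > 0" using \<gamma> by simp
  have "bounded (rderiv h ` {c..d})"
    using smooth_continuous[OF smooth_rderiv[OF h]] continuous_on_subset
    by (intro compact_imp_bounded compact_continuous_image) blast+
  then obtain H where "\<forall>y\<in>rderiv h ` {c..d}. norm y \<le> H" unfolding bounded_iff by blast
  then have H: "\<bar>rderiv h s\<bar> \<le> \<bar>H\<bar>" for s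
    using rderiv_zero_off[OF h z, of s] by (cases "s \<in> {c..d}") force+
  define D where "D = exp d"
  define c0 where "c0 = exp c / 2"
  have c0: "c0 > 0" by (simp add: c0_def)
  define M where "M = \<bar>H\<bar> / c0 powr (4*\<gamma>) * ((D\<^sup>2 + c0\<^sup>2) powr (2*\<gamma>-1) * D + (D powr (2*\<gamma>-2) * D powr (2*\<gamma>)) * D)"
  have M0: "M \<ge> 0" unfolding M_def D_def by simp
  have "norm (greg \<gamma> h \<delta> \<xi>) \<le> M" if \<delta>: "0 \<le> \<delta>" "\<delta> \<le> (exp c / 2)\<^sup>2" for \<delta> and \<xi> :: "'n pt"
  proof (cases "exp c / 2 \<le> NN \<gamma> \<xi> \<and> NN \<gamma> \<xi> \<le> exp d")
    case False
    then show ?thesis using greg_zero_off[OF \<gamma> h z \<delta> False] M0 by simp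
  next
    case True
    then have N: "c0 \<le> NN \<gamma> \<xi>" "NN \<gamma> \<xi> \<le> D" by (simp_all add: c0_def D_def)
    have r: "rr \<xi> \<le> D" using rr_le_NN[OF g0, of \<xi>] N by linarith
    have A: "c0 powr (4*\<gamma>) \<le> areg \<gamma> \<delta> \<xi>"
      using areg_mono[OF g0 \<delta>(1), of \<xi>] powr_mono2[of "4*\<gamma>" c0 "NN \<gamma> \<xi>"] N c0 g0 by (simp add: areg_0)
    have "\<bar>rderiv h (lreg \<gamma> \<delta> \<xi>) / areg \<gamma> \<delta> \<xi>\<bar> \<le> \<bar>H\<bar> / c0 powr (4*\<gamma>)"
      unfolding abs_divide using A H c0 by (intro frac_le) auto
    moreover have "norm ((xc \<xi> \<bullet> xc \<xi> + yc \<xi> \<bullet> yc \<xi> + \<delta>) powr (2*\<gamma>-1) *\<^sub>R (xc \<xi>, yc \<xi>) + (rr \<xi> powr (2*\<gamma>-2) * tc \<xi>) *\<^sub>R (yc \<xi>, - xc \<xi>))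
      \<le> (D\<^sup>2 + c0\<^sup>2) powr (2*\<gamma>-1) * D + (D powr (2*\<gamma>-2) * D powr (2*\<gamma>)) * D"
    proof (rule norm_triangle_mono)
      have "(rr \<xi>)\<^sup>2 \<le> D\<^sup>2" using r by (intro power_mono) auto
      then have "(xc \<xi> \<bullet> xc \<xi> + yc \<xi> \<bullet> yc \<xi> + \<delta>) powr (2*\<gamma>-1) \<le> (D\<^sup>2 + c0\<^sup>2) powr (2*\<gamma>-1)"
        using \<delta> \<gamma> unfolding rr_square c0_def by (intro powr_mono2) auto
      then show "norm ((xc \<xi> \<bullet> xc \<xi> + yc \<xi> \<bullet> yc \<xi> + \<delta>) powr (2*\<gamma>-1) *\<^sub>R (xc \<xi>, yc \<xi>)) \<le> (D\<^sup>2 + c0\<^sup>2) powr (2*\<gamma>-1) * D"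
        unfolding norm_scaleR norm_xy using r by (intro mult_mono) auto
      have "rr \<xi> powr (2*\<gamma>-2) \<le> D powr (2*\<gamma>-2)" using r \<gamma> by (intro powr_mono2) auto
      moreover have "\<bar>tc \<xi>\<bar> \<le> D powr (2*\<gamma>)"
        using tc_le_NN[OF g0, of \<xi>] powr_mono2[of "2*\<gamma>" "NN \<gamma> \<xi>" D] N g0 by auto
      ultimately show "norm ((rr \<xi> powr (2*\<gamma>-2) * tc \<xi>) *\<^sub>R (yc \<xi>, - xc \<xi>)) \<le> (D powr (2*\<gamma>-2) * D powr (2*\<gamma>)) * D"
        unfolding norm_scaleR norm_xy real_norm_def abs_mult using r by (intro mult_mono) auto
    qed
    ultimately show ?thesis unfolding greg_def norm_scaleR M_def real_norm_def by (intro mult_mono) auto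
  qed
  then show ?thesis by blast
qed

section \<open>Cut-off functions of N as elements of the closure\<close>

lemma tendsto_greg:
  assumes \<gamma>: "\<gamma> \<ge> 1" and h: "smooth h" and \<xi>: "\<xi> \<noteq> 0" and \<delta>: "\<delta> \<longlonglongrightarrow> 0" "\<And>k. \<delta> k \<ge> 0"
  shows "(\<lambda>k. h (lreg \<gamma> (\<delta> k) \<xi>)) \<longlonglongrightarrow> h (lreg \<gamma> 0 \<xi>)" "(\<lambda>k. greg \<gamma> h (\<delta> k) \<xi>) \<longlonglongrightarrow> greg \<gamma> h 0 \<xi>"
proof -
  have g0: "\<gamma> > 0" using \<gamma> by simp
  have A0: "areg \<gamma> 0 \<xi> \<noteq> 0" using NN_pos[OF g0 \<xi>] by (simp add: areg_0[OF g0])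
  have pw: "(\<lambda>k. (xc \<xi> \<bullet> xc \<xi> + yc \<xi> \<bullet> yc \<xi> + \<delta> k) powr a) \<longlonglongrightarrow> (xc \<xi> \<bullet> xc \<xi> + yc \<xi> \<bullet> yc \<xi> + 0) powr a"
    if "a > 0" for a
    by (rule tendsto_powr'[OF tendsto_add[OF tendsto_const \<delta>(1)] tendsto_const])
       (use that \<delta>(2) in \<open>auto intro!: always_eventually add_nonneg_nonneg\<close>)
  have a: "(\<lambda>k. areg \<gamma> (\<delta> k) \<xi>) \<longlonglongrightarrow> areg \<gamma> 0 \<xi>"
    unfolding areg_def using g0 by (intro tendsto_add pw tendsto_const) simp
  have l: "(\<lambda>k. lreg \<gamma> (\<delta> k) \<xi>) \<longlonglongrightarrow> lreg \<gamma> 0 \<xi>"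
    unfolding lreg_def using g0 A0 by (intro tendsto_divide tendsto_ln a tendsto_const) auto
  have c: "isCont f x" if "smooth f" for f :: "real \<Rightarrow> real" and x
    using smooth_continuous[OF that] by (simp add: continuous_on_eq_continuous_at)
  show "(\<lambda>k. h (lreg \<gamma> (\<delta> k) \<xi>)) \<longlonglongrightarrow> h (lreg \<gamma> 0 \<xi>)"
    by (rule isCont_tendsto_compose[OF c[OF h] l])
  show "(\<lambda>k. greg \<gamma> h (\<delta> k) \<xi>) \<longlonglongrightarrow> greg \<gamma> h 0 \<xi>"
    unfolding greg_def using \<gamma> A0
    by (intro tendsto_scaleR tendsto_add tendsto_divide isCont_tendsto_compose[OF c[OF smooth_rderiv[OF h]] l] a pw tendsto_const) auto
qed

text \<open>The approximants are h composed with \<open>lreg\<close> for \<delta> tending to 0;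
  their supports lie in a common compact annulus around the origin. So \<Omega> has to contain only
  a punctured gauge ball, and the weight is bounded only on the annulus: it may be singular at the
  origin or at the boundary of \<Omega>.\<close>

lemma profile_in_DL:
  fixes w :: "'n::finite pt \<Rightarrow> real"
  assumes \<gamma>: "\<gamma> \<ge> 1" and p: "p > 1" and h: "smooth h" and z: "\<forall>s. s \<notin> {c..d} \<longrightarrow> h s = 0"
    and Om: "\<And>\<xi>. \<xi> \<noteq> 0 \<Longrightarrow> NN \<gamma> \<xi> \<le> exp d \<Longrightarrow> \<xi> \<in> \<Omega>" and O: "open \<Omega>"
    and [measurable]: "w \<in> borel_measurable borel" and w: "\<And>\<xi>. w \<xi> \<ge> 0"
    and W: "\<And>\<xi>. exp c / 2 \<le> NN \<gamma> \<xi> \<Longrightarrow> NN \<gamma> \<xi> \<le> exp d \<Longrightarrow> w \<xi> \<le> W"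
  shows "(\<lambda>\<xi>. h (ln (NN \<gamma> \<xi>)), greg \<gamma> h 0) \<in> DL \<gamma> p \<Omega> w"
proof -
  have g0: "\<gamma> > 0" using \<gamma> by simp
  define c0 where "c0 = exp c / 2"
  have c0: "c0 > 0" by (simp add: c0_def)
  define K where "K = {\<xi>::'n pt. c0 \<le> NN \<gamma> \<xi> \<and> NN \<gamma> \<xi> \<le> exp d}"
  have Kc: "closed K" unfolding K_def Collect_conj_eq
    by (intro closed_Int closed_Collect_le continuous_on_NN[OF g0] continuous_intros)
  have K_sub: "K \<subseteq> {\<xi>. NN \<gamma> \<xi> \<le> exp d}" by (auto simp: K_def)
  have Kcomp: "compact K"
    using compact_Int_closed[OF compact_NN_le[OF g0, of "exp d"] Kc] K_sub by (simp add: Int_absorb1)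
  have K0: "\<xi> \<noteq> 0" if "\<xi> \<in> K" for \<xi> using that c0 NN_eq_0_iff[OF g0, of \<xi>] by (auto simp: K_def)
  \<comment> \<open>The largest of these is c0^2, the threshold up to which the supports are known
    to stay in the annulus.\<close>
  define \<delta> where "\<delta> k = c0\<^sup>2 / real (Suc k)" for k
  have \<delta>: "\<delta> k > 0" "\<delta> k \<ge> 0" "\<delta> k \<le> (exp c / 2)\<^sup>2" for k
    using c0 unfolding c0_def[symmetric] by (auto simp: \<delta>_def field_simps)
  have \<delta>0: "\<delta> \<longlonglongrightarrow> 0" unfolding \<delta>_def[abs_def]
    using tendsto_mult[OF tendsto_const[of "c0\<^sup>2"] LIMSEQ_inverse_real_of_nat] by (simp add: divide_inverse)
  define \<phi> where "\<phi> k = (\<lambda>\<xi>::'n pt. h (lreg \<gamma> (\<delta> k) \<xi>))" for k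
  have gr: "gradL \<gamma> (\<phi> k) = greg \<gamma> h (\<delta> k)" for k
    unfolding \<phi>_def using gradL_profile[OF h \<delta>(1) g0] by (auto simp: fun_eq_iff)
  have tf: "test_fun \<Omega> (\<phi> k)" for k
  proof -
    have "{\<xi>. \<phi> k \<xi> \<noteq> 0} \<subseteq> K"
    proof
      fix \<xi> assume "\<xi> \<in> {\<xi>. \<phi> k \<xi> \<noteq> 0}"
      then have "lreg \<gamma> (\<delta> k) \<xi> \<in> {c..d}" using z by (auto simp: \<phi>_def)
      from lreg_range[OF \<gamma> \<delta>(2,3) areg_pos[OF \<delta>(1)] this] show "\<xi> \<in> K" by (simp add: K_def c0_def)
    qed
    then have cl: "closure {\<xi>. \<phi> k \<xi> \<noteq> 0} \<subseteq> K" using Kc by (rule closure_minimal)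
    then have "compact (closure {\<xi>. \<phi> k \<xi> \<noteq> 0})"
      using compact_Int_closed[OF Kcomp closed_closure, of "{\<xi>. \<phi> k \<xi> \<noteq> 0}"] by (simp add: Int_absorb1)
    moreover have "K \<subseteq> \<Omega>" using K0 Om by (auto simp: K_def)
    moreover have "smooth (\<phi> k)" unfolding \<phi>_def by (rule smooth_compose[OF h smooth_lreg[OF \<delta>(1)]])
    ultimately show ?thesis using cl unfolding test_fun_def by blast
  qed
  have m[measurable]: "greg \<gamma> h \<delta>' \<in> borel_measurable (borel :: 'n pt measure)" for \<delta>'
    by (rule measurable_profile(2)[OF h])
  have u: "(\<lambda>\<xi>::'n pt. h (ln (NN \<gamma> \<xi>))) \<in> borel_measurable borel"
    using measurable_profile(1)[OF h, of \<gamma> 0] by (simp add: lreg_0[OF g0])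
  have Om': "\<Omega> \<in> sets borel" using O by simp
  note [measurable] = Om'
  have ae: "AE \<xi> in lborel. \<xi> \<noteq> (0::'n pt)" by (rule AE_lborel_singleton)
  obtain M where M: "\<And>\<delta> \<xi>. 0 \<le> \<delta> \<Longrightarrow> \<delta> \<le> (exp c / 2)\<^sup>2 \<Longrightarrow> norm (greg \<gamma> h \<delta> (\<xi>::'n pt)) \<le> M"
    using greg_bounded[OF \<gamma> h z] by blast
  have "(\<lambda>k. \<integral>\<^sup>+ \<xi>. ennreal (norm (greg \<gamma> h (\<delta> k) \<xi> - greg \<gamma> h 0 \<xi>) powr p * w \<xi>) * indicator \<Omega> \<xi> \<partial>lborel) \<longlonglongrightarrow> (\<integral>\<^sup>+ \<xi>. 0 \<partial>(lborel :: 'n pt measure))"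
  proof (rule nn_integral_dominated_convergence[where w = "\<lambda>\<xi>. ennreal ((2*M) powr p * \<bar>W\<bar>) * indicator K \<xi>"])
    show "AE \<xi> in lborel. ennreal (norm (greg \<gamma> h (\<delta> k) \<xi> - greg \<gamma> h 0 \<xi>) powr p * w \<xi>) * indicator \<Omega> \<xi> \<le> ennreal ((2*M) powr p * \<bar>W\<bar>) * indicator K \<xi>" for k
    proof (rule AE_I2)
      fix \<xi> :: "'n pt"
      show "ennreal (norm (greg \<gamma> h (\<delta> k) \<xi> - greg \<gamma> h 0 \<xi>) powr p * w \<xi>) * indicator \<Omega> \<xi> \<le> ennreal ((2*M) powr p * \<bar>W\<bar>) * indicator K \<xi>"
      proof (cases "\<xi> \<in> K")
        case True
        have "norm (greg \<gamma> h (\<delta> k) \<xi> - greg \<gamma> h 0 \<xi>) \<le> 2 * M"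
          using norm_triangle_ineq4[of "greg \<gamma> h (\<delta> k) \<xi>" "greg \<gamma> h 0 \<xi>"] M[OF \<delta>(2,3), of k \<xi>] M[of 0 \<xi>] by simp
        then have "norm (greg \<gamma> h (\<delta> k) \<xi> - greg \<gamma> h 0 \<xi>) powr p \<le> (2*M) powr p" using p by (intro powr_mono2) auto
        moreover have "w \<xi> \<le> \<bar>W\<bar>" using W[of \<xi>] True by (auto simp: K_def c0_def)
        ultimately have "ennreal (norm (greg \<gamma> h (\<delta> k) \<xi> - greg \<gamma> h 0 \<xi>) powr p * w \<xi>) \<le> ennreal ((2*M) powr p * \<bar>W\<bar>)"
          using w[of \<xi>] by (intro ennreal_leI mult_mono) auto
        then show ?thesis using True by (auto simp: indicator_def)
      next
        case False
        then have off: "\<not> (exp c / 2 \<le> NN \<gamma> \<xi> \<and> NN \<gamma> \<xi> \<le> exp d)" by (simp add: K_def c0_def)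
        have "greg \<gamma> h (\<delta> k) \<xi> = 0" "greg \<gamma> h 0 \<xi> = 0"
          by (rule greg_zero_off[OF \<gamma> h z \<delta>(2,3) off], rule greg_zero_off[OF \<gamma> h z order_refl zero_le_power2 off])
        then show ?thesis using p by simp
      qed
    qed
    have "K \<in> sets borel" using Kc by simp
    then show "(\<integral>\<^sup>+\<xi>. ennreal ((2*M) powr p * \<bar>W\<bar>) * indicator K \<xi> \<partial>lborel) < \<infinity>"
      using emeasure_compact_finite[OF Kcomp] by (simp add: nn_integral_cmult_indicator ennreal_mult_less_top)
    show "(\<lambda>\<xi>. ennreal ((2*M) powr p * \<bar>W\<bar>) * indicator K \<xi>) \<in> borel_measurable lborel"
      using \<open>K \<in> sets borel\<close> by simp
    show "AE \<xi> in lborel. (\<lambda>k. ennreal (norm (greg \<gamma> h (\<delta> k) \<xi> - greg \<gamma> h 0 \<xi>) powr p * w \<xi>) * indicator \<Omega> \<xi>) \<longlonglongrightarrow> 0"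
      using ae
    proof eventually_elim
      case (elim \<xi>)
      have "(\<lambda>k. greg \<gamma> h (\<delta> k) \<xi> - greg \<gamma> h 0 \<xi>) \<longlonglongrightarrow> 0"
        using tendsto_diff[OF tendsto_greg(2)[OF \<gamma> h elim \<delta>0 \<delta>(2)] tendsto_const, of "greg \<gamma> h 0 \<xi>"] by simp
      then have n: "(\<lambda>k. norm (greg \<gamma> h (\<delta> k) \<xi> - greg \<gamma> h 0 \<xi>)) \<longlonglongrightarrow> 0" by (rule tendsto_norm_zero)
      have "(\<lambda>k. norm (greg \<gamma> h (\<delta> k) \<xi> - greg \<gamma> h 0 \<xi>) powr p) \<longlonglongrightarrow> 0 powr p"
        by (rule tendsto_powr'[OF n tendsto_const]) (use p in auto)
      from tendsto_ennrealI[OF tendsto_mult[OF this tendsto_const[of "w \<xi>"]]]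
      have "(\<lambda>k. ennreal (norm (greg \<gamma> h (\<delta> k) \<xi> - greg \<gamma> h 0 \<xi>) powr p * w \<xi>)) \<longlonglongrightarrow> 0" by simp
      then show ?case by (cases "\<xi> \<in> \<Omega>") simp_all
    qed
  qed measurable
  moreover have "AE \<xi> in lborel. \<xi> \<in> \<Omega> \<longrightarrow> (\<lambda>k. \<phi> k \<xi>) \<longlonglongrightarrow> h (ln (NN \<gamma> \<xi>))"
    using ae
  proof eventually_elim
    case (elim \<xi>)
    show ?case using tendsto_greg(1)[OF \<gamma> h elim \<delta>0 \<delta>(2)] by (simp add: \<phi>_def lreg_0[OF g0])
  qed
  ultimately show ?thesis unfolding DL_def using u m tf by (auto simp: gr intro!: exI[of _ \<phi>])
qed

section \<open>Sharpness\<close>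

text \<open>Intervals of ln N, half-open so that consecutive ones tile the space without the
  origin.\<close>

definition shell :: "real \<Rightarrow> real \<Rightarrow> real \<Rightarrow> 'n::finite pt set" where
  "shell \<gamma> a b = {\<xi>. exp a \<le> NN \<gamma> \<xi> \<and> NN \<gamma> \<xi> < exp b}"

lemma sets_shell [measurable]: "shell \<gamma> a b \<in> sets borel"
  unfolding shell_def by measurable

lemma emeasure_shell_shift:
  assumes "\<gamma> > 0"
  shows "emeasure (hmeas \<gamma> p) (shell \<gamma> (a + \<tau>) (b + \<tau>) :: 'n::finite pt set) = emeasure (hmeas \<gamma> p) (shell \<gamma> a b :: 'n pt set)"
proof -
  have i: "indicator (shell \<gamma> (a + \<tau>) (b + \<tau>)) (flow \<gamma> \<tau> \<xi>) = (indicator (shell \<gamma> a b) \<xi> :: ennreal)" for \<xi> :: "'n pt"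
    by (simp add: indicator_def shell_def flow_scales(1)[OF assms] exp_add mult.commute)
  have "emeasure (hmeas \<gamma> p) (shell \<gamma> a b :: 'n pt set) = (\<integral>\<^sup>+\<xi>. indicator (shell \<gamma> (a + \<tau>) (b + \<tau>)) (flow \<gamma> \<tau> \<xi>) \<partial>(hmeas \<gamma> p :: 'n pt measure))"
    unfolding i by simp
  also have "\<dots> = (\<integral>\<^sup>+\<xi>. indicator (shell \<gamma> (a + \<tau>) (b + \<tau>)) \<xi> \<partial>(hmeas \<gamma> p :: 'n pt measure))"
    by (rule nn_integral_hmeas_flow[OF assms]) simp
  finally show ?thesis by simp
qed

lemma shell_split: "a \<le> b \<Longrightarrow> b \<le> c \<Longrightarrow> shell \<gamma> a c = shell \<gamma> a b \<union> shell \<gamma> b c"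
proof -
  assume "a \<le> b" "b \<le> c"
  then have "exp a \<le> exp b" "exp b \<le> exp c" by simp_all
  then show ?thesis unfolding set_eq_iff shell_def Un_iff mem_Collect_eq by (smt (verit))
qed

lemma shell_disjoint: "b \<le> c \<Longrightarrow> shell \<gamma> a b \<inter> shell \<gamma> c d = {}"
proof -
  assume "b \<le> c"
  then have "exp b \<le> exp c" by simp
  then show ?thesis unfolding disjoint_iff shell_def mem_Collect_eq by (smt (verit))
qed

lemma shell_mono: "a' \<le> a \<Longrightarrow> b \<le> b' \<Longrightarrow> shell \<gamma> a b \<subseteq> shell \<gamma> a' b'"
proof -
  assume "a' \<le> a" "b \<le> b'"
  then have "exp a' \<le> exp a" "exp b \<le> exp b'" by simp_all
  then show ?thesis unfolding subset_iff shell_def mem_Collect_eq by (smt (verit))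
qed

lemma AE_rr_nonzero: "AE \<xi> in (lborel :: 'n::finite pt measure). rr \<xi> \<noteq> 0"
proof -
  obtain k :: "real^'n" where k: "k \<in> Basis" using nonempty_Basis by blast
  then have "(k, 0) \<in> (Basis :: 'n pt set)" by (simp add: Basis_prod_def)
  then have "AE \<xi> in (lborel :: 'n pt measure). \<xi> \<bullet> (k, 0) \<noteq> 0" by (rule AE_lborel_inner_neq)
  then show ?thesis
    by eventually_elim (auto simp: rr_eq_0_iff xc_def inner_prod_def)
qed

text \<open>Finite, because the density is at most 1 for N \<ge> 1 and gauge balls are compact.
  Positive, because otherwise invariance would make every integer translate of the shell null; these
  cover all points but the origin, and the density is positive almost everywhere.\<close>

lemma emeasure_unit_shell:
  assumes \<gamma>: "\<gamma> \<ge> 1" and p: "p > 1"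
  obtains \<mu> where "\<mu> > 0" "emeasure (hmeas \<gamma> p) (shell \<gamma> 0 1 :: 'n::finite pt set) = ennreal \<mu>"
proof -
  have g0: "\<gamma> > 0" using \<gamma> by simp
  let ?M = "hmeas \<gamma> p :: 'n pt measure"
  have "emeasure ?M (shell \<gamma> 0 1) = (\<integral>\<^sup>+\<xi>. ennreal (hdens \<gamma> p \<xi>) * indicator (shell \<gamma> 0 1) \<xi> \<partial>(lborel :: 'n pt measure))"
    by (simp add: emeasure_density)
  also have "\<dots> \<le> (\<integral>\<^sup>+\<xi>. indicator {\<xi>::'n pt. NN \<gamma> \<xi> \<le> exp 1} \<xi> \<partial>lborel)"
  proof (rule nn_integral_mono)
    fix \<xi> :: "'n pt"
    show "ennreal (hdens \<gamma> p \<xi>) * indicator (shell \<gamma> 0 1) \<xi> \<le> indicator {\<xi>. NN \<gamma> \<xi> \<le> exp 1} \<xi>"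
    proof (cases "\<xi> \<in> shell \<gamma> 0 1")
      case True
      then have N: "1 \<le> NN \<gamma> \<xi>" "NN \<gamma> \<xi> < exp 1" by (auto simp: shell_def)
      have "QQ TYPE('n) \<gamma> \<ge> 0" using g0 by (simp add: QQ_def)
      then have "NN \<gamma> \<xi> powr (- QQ TYPE('n) \<gamma>) \<le> 1" using powr_mono[of "- QQ TYPE('n) \<gamma>" 0 "NN \<gamma> \<xi>"] N by simp
      moreover have "rr \<xi> powr (p*(2*\<gamma>-1)) \<le> NN \<gamma> \<xi> powr (p*(2*\<gamma>-1))"
        using rr_le_NN[OF g0, of \<xi>] p \<gamma> by (intro powr_mono2) auto
      ultimately have "hdens \<gamma> p \<xi> \<le> 1 * 1" unfolding hdens_def using N by (intro mult_mono) auto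
      then show ?thesis using N by (simp add: indicator_def True)
    qed simp
  qed
  also have "\<dots> = emeasure lborel {\<xi>::'n pt. NN \<gamma> \<xi> \<le> exp 1}"
    using compact_NN_le[OF g0, of "exp 1"] by (intro nn_integral_indicator) (auto intro: borel_compact)
  also have "\<dots> < \<infinity>" by (rule emeasure_compact_finite[OF compact_NN_le[OF g0]])
  finally have fin: "emeasure ?M (shell \<gamma> 0 1) < \<infinity>" .
  have nz: "emeasure ?M (shell \<gamma> 0 1) \<noteq> 0"
  proof
    assume 0: "emeasure ?M (shell \<gamma> 0 1) = 0"
    have "emeasure ?M (shell \<gamma> (of_int j) (of_int j + 1)) = 0" for j :: int
      using emeasure_shell_shift[OF g0, of p 0 "of_int j" 1, where 'n = 'n] 0 by (simp add: add.commute)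
    then have "shell \<gamma> (of_int j) (of_int j + 1) \<in> null_sets ?M" for j :: int by (simp add: null_sets_def)
    then have "(\<Union>j::int. shell \<gamma> (of_int j) (of_int j + 1)) \<in> null_sets ?M" by (intro null_sets_UN) auto
    moreover have "{\<xi>::'n pt. \<xi> \<noteq> 0} \<subseteq> (\<Union>j::int. shell \<gamma> (of_int j) (of_int j + 1))"
    proof
      fix \<xi> :: "'n pt" assume "\<xi> \<in> {\<xi>. \<xi> \<noteq> 0}"
      then have N: "NN \<gamma> \<xi> > 0" using NN_pos[OF g0] by simp
      let ?j = "\<lfloor>ln (NN \<gamma> \<xi>)\<rfloor>"
      have "exp (of_int ?j) \<le> exp (ln (NN \<gamma> \<xi>))" "exp (ln (NN \<gamma> \<xi>)) < exp (of_int ?j + 1)"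
        unfolding exp_le_cancel_iff exp_less_cancel_iff by linarith+
      then show "\<xi> \<in> (\<Union>j::int. shell \<gamma> (of_int j) (of_int j + 1))" using N by (auto simp: shell_def)
    qed
    ultimately have "AE \<xi> in ?M. \<xi> = 0" by (intro AE_I'[of "\<Union>j::int. shell \<gamma> (of_int j) (of_int j + 1)"]) auto
    then have "AE \<xi> in (lborel :: 'n pt measure). 0 < ennreal (hdens \<gamma> p \<xi>) \<longrightarrow> \<xi> = 0" by (subst (asm) AE_density) auto
    then have "AE \<xi> in (lborel :: 'n pt measure). False"
      using AE_rr_nonzero AE_lborel_singleton[of "0::'n pt"]
    proof eventually_elim
      case (elim \<xi>)
      then have "rr \<xi> > 0" "NN \<gamma> \<xi> > 0" using rr_nonneg[of \<xi>] NN_pos[OF g0, of \<xi>] by linarith+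
      then have "hdens \<gamma> p \<xi> > 0" by (simp add: hdens_def)
      then show ?case using elim by simp
    qed
    then have "emeasure (lborel :: 'n pt measure) {\<xi> \<in> space lborel. True} = 0"
      by (intro emeasure_eq_0_AE) simp
    then show False by simp
  qed
  from fin obtain \<mu> where "emeasure ?M (shell \<gamma> 0 1) = ennreal \<mu>" "\<mu> \<ge> 0"
    by (cases "emeasure ?M (shell \<gamma> 0 1)" rule: ennreal_cases) auto
  then show thesis using nz by (intro that[of \<mu>]) (auto simp: less_le)
qed

lemma emeasure_shell_nat:
  assumes "\<gamma> > 0" and \<mu>: "emeasure (hmeas \<gamma> p) (shell \<gamma> 0 1 :: 'n::finite pt set) = ennreal \<mu>" "\<mu> \<ge> 0"
  shows "emeasure (hmeas \<gamma> p) (shell \<gamma> a (a + real n) :: 'n pt set) = ennreal (real n * \<mu>)"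
proof (induction n)
  case 0
  have "shell \<gamma> a (a + real 0) = ({} :: 'n pt set)" by (auto simp: shell_def)
  then show ?case by simp
next
  case (Suc n)
  have "shell \<gamma> a (a + real (Suc n)) = shell \<gamma> a (a + real n) \<union> (shell \<gamma> (a + real n) (a + real (Suc n)) :: 'n pt set)"
    by (rule shell_split) auto
  also have "emeasure (hmeas \<gamma> p) \<dots> = emeasure (hmeas \<gamma> p) (shell \<gamma> a (a + real n) :: 'n pt set)
      + emeasure (hmeas \<gamma> p) (shell \<gamma> (a + real n) (a + real (Suc n)) :: 'n pt set)"
    by (rule plus_emeasure[symmetric]) (auto simp: shell_disjoint)
  also have "emeasure (hmeas \<gamma> p) (shell \<gamma> (a + real n) (a + real (Suc n)) :: 'n pt set) = ennreal \<mu>"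
    using emeasure_shell_shift[OF assms(1), of p 0 "a + real n" 1, where 'n = 'n] \<mu> by (simp add: algebra_simps)
  also have "emeasure (hmeas \<gamma> p) (shell \<gamma> a (a + real n) :: 'n pt set) + ennreal \<mu> = ennreal (real (Suc n) * \<mu>)"
    unfolding Suc using \<mu> by (simp add: ennreal_plus[symmetric] algebra_simps del: ennreal_plus)
  finally show ?case .
qed

text \<open>Mass is proportional to the length in ln N for integer lengths; the \<plusminus>1
  absorbs the rounding. The logarithmic weight uses this with blocks of exponentially growing
  length.\<close>

lemma emeasure_shell_bounds:
  assumes "\<gamma> > 0" and \<mu>: "emeasure (hmeas \<gamma> p) (shell \<gamma> 0 1 :: 'n::finite pt set) = ennreal \<mu>" "\<mu> \<ge> 0"
    and ab: "a \<le> b"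
  shows "emeasure (hmeas \<gamma> p) (shell \<gamma> a b :: 'n pt set) \<le> ennreal ((b - a + 1) * \<mu>)"
    "ennreal ((b - a - 1) * \<mu>) \<le> emeasure (hmeas \<gamma> p) (shell \<gamma> a b :: 'n pt set)"
proof -
  note nat = emeasure_shell_nat[OF assms(1) \<mu>]
  define n where "n = nat \<lceil>b - a\<rceil>"
  have n: "b \<le> a + real n" "real n \<le> b - a + 1" using ab unfolding n_def by linarith+
  have "emeasure (hmeas \<gamma> p) (shell \<gamma> a b :: 'n pt set) \<le> emeasure (hmeas \<gamma> p) (shell \<gamma> a (a + real n) :: 'n pt set)"
    using n by (intro emeasure_mono shell_mono) auto
  also have "\<dots> \<le> ennreal ((b - a + 1) * \<mu>)" unfolding nat using n \<mu> by (intro ennreal_leI mult_right_mono) auto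
  finally show "emeasure (hmeas \<gamma> p) (shell \<gamma> a b :: 'n pt set) \<le> ennreal ((b - a + 1) * \<mu>)" .
  define m where "m = nat \<lfloor>b - a\<rfloor>"
  have m: "a + real m \<le> b" "b - a - 1 \<le> real m" using ab unfolding m_def by linarith+
  have "ennreal ((b - a - 1) * \<mu>) \<le> emeasure (hmeas \<gamma> p) (shell \<gamma> a (a + real m) :: 'n pt set)"
    unfolding nat using m \<mu> by (intro ennreal_leI mult_right_mono) auto
  also have "\<dots> \<le> emeasure (hmeas \<gamma> p) (shell \<gamma> a b :: 'n pt set)"
    using m by (intro emeasure_mono shell_mono) auto
  finally show "ennreal ((b - a - 1) * \<mu>) \<le> emeasure (hmeas \<gamma> p) (shell \<gamma> a b :: 'n pt set)" .
qed

text \<open>A test function that is exactly extremal on a long plateau of \<open>n\<close> comparable blocks and has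
  bounded energy on the two transition blocks beats any larger constant.\<close>

lemma sharp_compare:
  fixes B :: "nat \<Rightarrow> 'a set"
  assumes B[measurable]: "\<And>j. B j \<in> sets M" and disj: "disjoint_family B" and lo: "lo > 0"
    and blo: "\<And>j. ennreal lo \<le> emeasure M (B j)" and bhi: "\<And>j. emeasure M (B j) \<le> ennreal hi" and hi: "hi \<ge> 0"
    and A: "A \<ge> 0" and T: "T \<ge> 0" and C: "C > A"
  obtains n where "\<And>F U :: 'a \<Rightarrow> ennreal. (\<And>x. x \<in> space M \<Longrightarrow> F x \<le> ennreal A * indicator (\<Union>j\<in>{1..n}. B j) x
      + (ennreal T * indicator (B 0) x + ennreal T * indicator (B (Suc n)) x))
    \<Longrightarrow> (\<And>x. x \<in> space M \<Longrightarrow> indicator (\<Union>j\<in>{1..n}. B j) x \<le> U x)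
    \<Longrightarrow> \<not> ennreal C * (\<integral>\<^sup>+x. U x \<partial>M) \<le> (\<integral>\<^sup>+x. F x \<partial>M)"
proof -
  \<comment> \<open>The excess C - A over the plateau, whose mass is at least n lo, must beat the
    cost T of two transition blocks of mass at most hi.\<close>
  obtain n :: nat where n: "2 * T * hi / ((C - A) * lo) < real n" using reals_Archimedean2 by blast
  have CA: "(C - A) * lo > 0" using C lo by simp
  have n': "2 * T * hi < (C - A) * (real n * lo)" using n CA by (simp add: divide_less_eq mult_ac)
  define P where "P = (\<Union>j\<in>{1..n}. B j)"
  have [measurable]: "P \<in> sets M" unfolding P_def by auto
  have Psum: "emeasure M P = (\<Sum>j\<in>{1..n}. emeasure M (B j))"
    unfolding P_def using disj by (intro sum_emeasure[symmetric]) (auto simp: disjoint_family_on_def)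
  have "emeasure M P \<le> (\<Sum>j\<in>{1..n}. ennreal hi)" unfolding Psum by (intro sum_mono bhi)
  also have "\<dots> = ennreal (\<Sum>j\<in>{1..n}. hi)" using hi by (intro sum_ennreal) auto
  \<comment> \<open>Finiteness of the plateau mass allows A times it to be subtracted from both
    sides.\<close>
  finally have "emeasure M P < \<infinity>" by (metis ennreal_less_top infinity_ennreal_def order_le_less_trans)
  then obtain \<pi> where \<pi>: "emeasure M P = ennreal \<pi>" "\<pi> \<ge> 0"
    by (cases "emeasure M P" rule: ennreal_cases) auto
  have "ennreal (real n * lo) = (\<Sum>j\<in>{1..n}. ennreal lo)" using lo by (subst sum_ennreal) auto
  also have "\<dots> \<le> emeasure M P" unfolding Psum by (intro sum_mono blo)
  finally have \<pi>lo: "real n * lo \<le> \<pi>" using \<pi> by simp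
  show thesis
  proof (rule that[of n], rule notI)
    fix F U :: "'a \<Rightarrow> ennreal"
    assume F: "\<And>x. x \<in> space M \<Longrightarrow> F x \<le> ennreal A * indicator (\<Union>j\<in>{1..n}. B j) x
      + (ennreal T * indicator (B 0) x + ennreal T * indicator (B (Suc n)) x)"
      and U: "\<And>x. x \<in> space M \<Longrightarrow> indicator (\<Union>j\<in>{1..n}. B j) x \<le> U x"
      and le: "ennreal C * (\<integral>\<^sup>+x. U x \<partial>M) \<le> (\<integral>\<^sup>+x. F x \<partial>M)"
    have "ennreal (C * \<pi>) = ennreal C * (\<integral>\<^sup>+x. indicator P x \<partial>M)"
      using \<pi> A C by (simp add: ennreal_mult)
    also have "\<dots> \<le> ennreal C * (\<integral>\<^sup>+x. U x \<partial>M)"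
      unfolding P_def using U by (intro mult_left_mono nn_integral_mono) auto
    also have "\<dots> \<le> (\<integral>\<^sup>+x. F x \<partial>M)" by (rule le)
    also have "\<dots> \<le> (\<integral>\<^sup>+x. ennreal A * indicator P x + (ennreal T * indicator (B 0) x + ennreal T * indicator (B (Suc n)) x) \<partial>M)"
      unfolding P_def by (intro nn_integral_mono F)
    also have "\<dots> = ennreal A * emeasure M P + (ennreal T * emeasure M (B 0) + ennreal T * emeasure M (B (Suc n)))"
      by (simp add: nn_integral_add nn_integral_cmult_indicator)
    also have "\<dots> \<le> ennreal A * ennreal \<pi> + (ennreal T * ennreal hi + ennreal T * ennreal hi)"
      unfolding \<pi>(1) by (intro add_mono mult_left_mono bhi) auto
    also have "\<dots> = ennreal (A * \<pi> + (T * hi + T * hi))"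
      using A T hi \<pi> by (simp add: ennreal_mult'[symmetric] ennreal_plus[symmetric] del: ennreal_plus)
    finally have "C * \<pi> \<le> A * \<pi> + (T * hi + T * hi)"
      by (subst (asm) ennreal_le_iff) (use A T hi \<pi> in auto)
    then have "(C - A) * \<pi> \<le> 2 * T * hi" by (simp add: algebra_simps)
    moreover have "(C - A) * (real n * lo) \<le> (C - A) * \<pi>" using C \<pi>lo by (intro mult_left_mono) auto
    ultimately show False using n' by linarith
  qed
qed

section \<open>Cutoffs, and sharpness for the power weight\<close>

lemma smooth_exp: "smooth (\<lambda>x::real. exp (a * x))"
proof -
  have "(exp has_real_derivative exp x) (at x)" for x :: real by (rule DERIV_exp)
  from smooth_compose_family[of UNIV "\<lambda>k::nat. exp" "\<lambda>x. a * x" 0, OF this _] show ?thesis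
    using smooth_affine[of a 0] by simp
qed

text \<open>Both transitions have length 1, so one slope bound \<open>K\<close> can serve all c and
  d: lengthening the plateau does not make the transitions more expensive.\<close>

definition cutoff :: "real \<Rightarrow> real \<Rightarrow> real \<Rightarrow> (real \<Rightarrow> real) \<Rightarrow> bool" where
  "cutoff K c d \<psi> \<longleftrightarrow> smooth \<psi> \<and> (\<forall>x. 0 \<le> \<psi> x \<and> \<psi> x \<le> 1 \<and> \<bar>rderiv \<psi> x\<bar> \<le> K)
     \<and> (\<forall>x. x \<le> c \<or> d \<le> x \<longrightarrow> \<psi> x = 0 \<and> rderiv \<psi> x = 0) \<and> (\<forall>x\<in>{c+1..d-1}. \<psi> x = 1 \<and> rderiv \<psi> x = 0)"

lemma cutoff_exists:
  obtains K where "K \<ge> 0" "\<And>c d. \<exists>\<psi>. cutoff K c d \<psi>"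
proof -
  obtain S :: "real \<Rightarrow> real" and K where S: "smooth S" "\<And>x. x \<le> 0 \<Longrightarrow> S x = 0" "\<And>x. x \<ge> 1 \<Longrightarrow> S x = 1"
    "\<And>x. 0 \<le> S x" "\<And>x. S x \<le> 1" and K: "\<And>x. \<bar>rderiv S x\<bar> \<le> K" by (rule smooth_step_exists) blast
  have "cutoff (2*K) c d (\<lambda>x. S (x - c) * S (d - x))" for c d
  proof -
    define \<psi> where "\<psi> x = S (x - c) * S (d - x)" for x
    have "smooth (\<lambda>x. S (x - c))" "smooth (\<lambda>x. S (d - x))"
      using smooth_compose[OF S(1) smooth_affine[of 1 "-c"]] smooth_compose[OF S(1) smooth_affine[of "-1" d]] by simp_all
    then have sm: "smooth \<psi>" unfolding \<psi>_def[abs_def] by (rule smooth_mult)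
    have r: "0 \<le> \<psi> x" "\<psi> x \<le> 1" for x
      using S(4)[of "x-c"] S(5)[of "x-c"] S(4)[of "d-x"] S(5)[of "d-x"] by (auto simp: \<psi>_def intro: mult_le_one)
    have "rderiv \<psi> x = rderiv S (x - c) * S (d - x) - S (x - c) * rderiv S (d - x)" for x
    proof -
      have "((\<lambda>x. S (x - c)) has_real_derivative rderiv S (x - c)) (at x)"
      proof -
        have "((\<lambda>x. x - c) has_real_derivative 1) (at x)" by (auto intro!: derivative_eq_intros)
        from DERIV_chain2[where f = S, OF rderiv_works[OF S(1)] this] show ?thesis by simp
      qed
      moreover have "((\<lambda>x. S (d - x)) has_real_derivative - rderiv S (d - x)) (at x)"
      proof -
        have "((\<lambda>x. d - x) has_real_derivative -1) (at x)" by (auto intro!: derivative_eq_intros)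
        from DERIV_chain2[where f = S, OF rderiv_works[OF S(1)] this] show ?thesis by simp
      qed
      ultimately have "(\<psi> has_real_derivative rderiv S (x - c) * S (d - x) + - rderiv S (d - x) * S (x - c)) (at x)"
        unfolding \<psi>_def[abs_def] by (rule DERIV_mult)
      from DERIV_unique[OF rderiv_works[OF sm] this] show ?thesis by simp
    qed
    moreover have "\<bar>rderiv S (x - c) * S (d - x)\<bar> \<le> K * 1" "\<bar>S (x - c) * rderiv S (d - x)\<bar> \<le> 1 * K" for x
      unfolding abs_mult using K S(4,5) order_trans[OF abs_ge_zero K] by (intro mult_mono; simp)+
    ultimately have b: "\<bar>rderiv \<psi> x\<bar> \<le> 2 * K" for x by (smt (verit) mult_1 mult_1_right)
    \<comment> \<open>The values 0 and 1 are global extrema of \<psi>, so the derivative vanishes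
      wherever they are attained, including the end points of the plateau.\<close>
    have z: "rderiv \<psi> x = 0" if "\<psi> x = 0" for x
      by (rule DERIV_local_min[OF rderiv_works[OF sm], of 1]) (use r that in auto)
    have o: "rderiv \<psi> x = 0" if "\<psi> x = 1" for x
      by (rule DERIV_local_max[OF rderiv_works[OF sm], of 1]) (use r that in auto)
    have "cutoff (2*K) c d \<psi>" unfolding cutoff_def
      using sm r b z o S(2,3) by (auto simp: \<psi>_def)
    then show ?thesis by (simp add: \<psi>_def[abs_def])
  qed
  moreover have "2 * K \<ge> 0" using order_trans[OF abs_ge_zero K] by simp
  ultimately show thesis using that by blast
qed

lemma norm_greg_powr:
  fixes \<xi> :: "'n::finite pt"
  assumes \<gamma>: "\<gamma> \<ge> 1" and p: "p > 1" and \<xi>: "\<xi> \<noteq> 0"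
  shows "norm (greg \<gamma> h 0 \<xi>) powr p
     = hdens \<gamma> p \<xi> * (\<bar>rderiv h (ln (NN \<gamma> \<xi>))\<bar> powr p * NN \<gamma> \<xi> powr (QQ TYPE('n) \<gamma> - p))"
proof -
  have "norm (greg \<gamma> h 0 \<xi>) powr p = \<bar>rderiv h (ln (NN \<gamma> \<xi>))\<bar> powr p * NN \<gamma> \<xi> powr (-p)
      * (rr \<xi> powr (p*(2*\<gamma>-1)) / NN \<gamma> \<xi> powr (p*(2*\<gamma>-1)))"
  proof -
    have 1: "(NN \<gamma> \<xi> powr (-1)) powr p = NN \<gamma> \<xi> powr (-p)" by (simp only: powr_powr) simp
    have 2: "(rr \<xi> powr c / NN \<gamma> \<xi> powr c) powr p = rr \<xi> powr (p*c) / NN \<gamma> \<xi> powr (p*c)" for c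
      by (subst powr_divide) (simp_all add: powr_powr mult.commute)
    show ?thesis unfolding norm_greg_0[OF \<gamma> \<xi>] 1[symmetric] 2[symmetric]
      by (subst powr_mult | simp)+
  qed
  also have "NN \<gamma> \<xi> powr (-p) = NN \<gamma> \<xi> powr (- QQ TYPE('n) \<gamma>) * NN \<gamma> \<xi> powr (QQ TYPE('n) \<gamma> - p)"
    unfolding powr_add[symmetric] by simp
  finally show ?thesis unfolding hdens_def by (simp only: mult_ac)
qed

text \<open>The profile exp (-a s) \<psi>(s) in s = ln N is the extremal N^(-a) times a cutoff.
  Since a p = Q + \<beta>, the powers of N cancel against the weights, and with respect to the
  invariant measure the two integrands are \<psi>^p and \<bar>\<psi>' - a \<psi>\<bar>^p. On the
  plateau their ratio is exactly \<bar>a\<bar>^p.\<close>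

lemma sharp_power:
  fixes \<Omega> :: "'n::finite pt set"
  assumes \<gamma>: "\<gamma> \<ge> 1" and p: "p > 1" and O: "open \<Omega>" and e: "e > 0" "ball 0 e \<subseteq> \<Omega> \<union> {0}"
    and C: "C > (\<bar>QQ TYPE('n) \<gamma> + \<beta>\<bar> / p) powr p"
  shows "\<exists>(u, g) \<in> DL \<gamma> p \<Omega> (\<lambda>\<xi>. NN \<gamma> \<xi> powr (p + \<beta>)).
         \<not> (ennreal C *
           (\<integral>\<^sup>+ \<xi>. ennreal (\<bar>u \<xi>\<bar> powr p * NN \<gamma> \<xi> powr \<beta> *
               (rr \<xi> powr (p*(2*\<gamma>-1)) / NN \<gamma> \<xi> powr (p*(2*\<gamma>-1)))) * indicator \<Omega> \<xi> \<partial>lborel)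
         \<le> (\<integral>\<^sup>+ \<xi>. ennreal (norm (g \<xi>) powr p * NN \<gamma> \<xi> powr (p + \<beta>)) * indicator \<Omega> \<xi> \<partial>lborel))"
proof -
  have g0: "\<gamma> > 0" using \<gamma> by simp
  define Q where "Q = QQ TYPE('n) \<gamma>"
  define a where "a = (Q + \<beta>) / p"
  have ap: "a * p = Q + \<beta>" using p by (simp add: a_def)
  have Ca: "C > \<bar>a\<bar> powr p" using C p by (simp add: a_def Q_def)
  obtain \<mu> where \<mu>: "\<mu> > 0" "emeasure (hmeas \<gamma> p) (shell \<gamma> 0 1 :: 'n pt set) = ennreal \<mu>"
    by (rule emeasure_unit_shell[OF \<gamma> p])
  obtain K where K: "K \<ge> 0" "\<And>c d. \<exists>\<psi>. cutoff K c d \<psi>" by (rule cutoff_exists) blast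
  \<comment> \<open>For N \<le> 1 the comparison of norms gives a Euclidean norm of at most 3 N, so
    N \<le> e/4 stays inside the ball of radius e.\<close>
  define d where "d = ln (min 1 (e/4))"
  have ed: "exp d = min 1 (e/4)" using e by (simp add: d_def)
  have Om: "\<xi> \<in> \<Omega>" if "\<xi> \<noteq> 0" "NN \<gamma> \<xi> \<le> exp d" for \<xi>
  proof -
    have N: "NN \<gamma> \<xi> \<le> 1" "NN \<gamma> \<xi> \<le> e/4" using that ed by auto
    have "NN \<gamma> \<xi> powr (2*\<gamma>) \<le> NN \<gamma> \<xi> powr 1" using N \<gamma> NN_pos[OF g0 that(1)] by (intro powr_mono') auto
    then have "norm \<xi> < e" using norm_pt_le[OF g0, of \<xi>] N e NN_pos[OF g0 that(1)] by (simp add: field_simps)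
    then have "\<xi> \<in> ball 0 e" by simp
    then show ?thesis using e(2) that(1) by blast
  qed
  \<comment> \<open>Unit shells numbered towards the origin. Block 0 and block n+1 will carry the
    transitions, blocks 1 to n the plateau.\<close>
  define B where "B j = (shell \<gamma> (d - 1 - real j) (d - real j) :: 'n pt set)" for j :: nat
  have Bm: "emeasure (hmeas \<gamma> p) (B j) = ennreal \<mu>" for j
    using emeasure_shell_nat[OF g0 \<mu>(2), of "d - 1 - real j" 1] \<mu> by (simp add: B_def)
  have B_iff: "\<xi> \<in> B j \<longleftrightarrow> \<xi> \<noteq> 0 \<and> d - 1 - real j \<le> ln (NN \<gamma> \<xi>) \<and> ln (NN \<gamma> \<xi>) < d - real j" for \<xi> j
  proof (cases "\<xi> = 0")
    case True
    then show ?thesis using NN_eq_0_iff[OF g0, of \<xi>] by (simp add: B_def shell_def)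
  next
    case False
    then have "exp (ln (NN \<gamma> \<xi>)) = NN \<gamma> \<xi>" using NN_pos[OF g0] by simp
    then show ?thesis using False unfolding B_def shell_def by (metis (mono_tags, lifting) exp_le_cancel_iff exp_less_cancel_iff mem_Collect_eq)
  qed
  have disj: "disjoint_family B"
  proof (unfold disjoint_family_on_def, intro ballI impI)
    fix i j :: nat assume "i \<noteq> j"
    then have "real i + 1 \<le> real j \<or> real j + 1 \<le> real i" by linarith
    then show "B i \<inter> B j = {}" by (auto simp: B_iff)
  qed
  define T where "T = (K + \<bar>a\<bar>) powr p"
  \<comment> \<open>The number of blocks is fixed before the integrands, because the cutoff is built
    for that length. \<open>T\<close> bounds \<bar>\<psi>' - a \<psi>\<bar>^p for every cutoff with
    slope bound \<open>K\<close>.\<close>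
  obtain n where n: "\<And>F U :: 'n pt \<Rightarrow> ennreal. (\<And>x. x \<in> space (hmeas \<gamma> p) \<Longrightarrow> F x \<le> ennreal (\<bar>a\<bar> powr p) * indicator (\<Union>j\<in>{1..n}. B j) x
      + (ennreal T * indicator (B 0) x + ennreal T * indicator (B (Suc n)) x))
    \<Longrightarrow> (\<And>x. x \<in> space (hmeas \<gamma> p) \<Longrightarrow> indicator (\<Union>j\<in>{1..n}. B j) x \<le> U x)
    \<Longrightarrow> \<not> ennreal C * (\<integral>\<^sup>+x. U x \<partial>hmeas \<gamma> p) \<le> (\<integral>\<^sup>+x. F x \<partial>hmeas \<gamma> p)"
    by (rule sharp_compare[of B "hmeas \<gamma> p" \<mu> \<mu> "\<bar>a\<bar> powr p" T C])
       (use Bm \<mu> disj Ca in \<open>auto simp: T_def B_def\<close>)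
  \<comment> \<open>The n+2 unit blocks fill the interval from c to d.\<close>
  define c where "c = d - 2 - real n"
  obtain \<psi> where "cutoff K c d \<psi>" using K(2) by blast
  then have sm: "smooth \<psi>" and \<psi>: "\<And>x. 0 \<le> \<psi> x" "\<And>x. \<psi> x \<le> 1" "\<And>x. \<bar>rderiv \<psi> x\<bar> \<le> K"
    and off: "\<And>x. x \<le> c \<or> d \<le> x \<Longrightarrow> \<psi> x = 0" "\<And>x. x \<le> c \<or> d \<le> x \<Longrightarrow> rderiv \<psi> x = 0"
    and on: "\<And>x. x \<in> {c+1..d-1} \<Longrightarrow> \<psi> x = 1" "\<And>x. x \<in> {c+1..d-1} \<Longrightarrow> rderiv \<psi> x = 0"
    unfolding cutoff_def by blast+
  define h where "h s = exp (-a * s) * \<psi> s" for s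
  have h: "smooth h" unfolding h_def[abs_def] by (intro smooth_mult smooth_exp sm)
  have h': "rderiv h s = exp (-a * s) * (rderiv \<psi> s - a * \<psi> s)" for s
  proof -
    have "((\<lambda>s. exp (-a * s)) has_real_derivative -a * exp (-a * s)) (at s)"
      by (auto intro!: derivative_eq_intros)
    from DERIV_mult[OF this rderiv_works[OF sm, of s]]
    have "(h has_real_derivative -a * exp (-a * s) * \<psi> s + rderiv \<psi> s * exp (-a * s)) (at s)"
      unfolding h_def[abs_def] .
    from DERIV_unique[OF rderiv_works[OF h] this] show ?thesis by (simp add: algebra_simps)
  qed
  have z: "\<forall>s. s \<notin> {c..d} \<longrightarrow> h s = 0" using off by (auto simp: h_def)
  have pw: "(exp (-a * ln (NN \<gamma> \<xi>)) * x) powr p * NN \<gamma> \<xi> powr (Q+\<beta>) = x powr p" if "\<xi> \<noteq> 0" for \<xi> x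
  proof -
    have N: "NN \<gamma> \<xi> > 0" by (rule NN_pos[OF g0 that])
    have "exp (-a * ln (NN \<gamma> \<xi>)) = NN \<gamma> \<xi> powr (-a)" using N by (simp add: powr_def)
    then have E: "(exp (-a * ln (NN \<gamma> \<xi>)) * x) powr p = NN \<gamma> \<xi> powr (- (a * p)) * x powr p"
      by (simp add: powr_mult powr_powr)
    have "NN \<gamma> \<xi> powr (- (a * p)) * NN \<gamma> \<xi> powr (Q+\<beta>) = 1"
      using N unfolding powr_add[symmetric] ap by simp
    then have "x powr p * (NN \<gamma> \<xi> powr (- (a * p)) * NN \<gamma> \<xi> powr (Q+\<beta>)) = x powr p" by simp
    then show ?thesis unfolding E by (simp only: mult_ac)
  qed
  have DL: "(\<lambda>\<xi>. h (ln (NN \<gamma> \<xi>)), greg \<gamma> h 0) \<in> DL \<gamma> p \<Omega> (\<lambda>\<xi>. NN \<gamma> \<xi> powr (p + \<beta>))"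
  proof (rule profile_in_DL[OF \<gamma> p h z Om O])
    \<comment> \<open>The power is monotone on the annulus, in a direction depending on the sign of
      p + \<beta>; the sum of the two end values bounds it in both cases.\<close>
    show "NN \<gamma> \<xi> powr (p + \<beta>) \<le> exp d powr (p+\<beta>) + (exp c / 2) powr (p+\<beta>)"
      if "exp c / 2 \<le> NN \<gamma> \<xi>" "NN \<gamma> \<xi> \<le> exp d" for \<xi> :: "'n pt"
    proof (cases "p + \<beta> \<ge> 0")
      case True
      have "NN \<gamma> \<xi> powr (p + \<beta>) \<le> exp d powr (p+\<beta>)" using that True by (intro powr_mono2) auto
      then show ?thesis by (simp add: add_increasing2)
    next
      case False
      have "NN \<gamma> \<xi> powr (p + \<beta>) \<le> (exp c / 2) powr (p+\<beta>)" using that False by (intro powr_mono2') auto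
      then show ?thesis by (simp add: add_increasing)
    qed
  qed auto
  define F where "F \<xi> = ennreal (\<bar>rderiv h (ln (NN \<gamma> \<xi>))\<bar> powr p * NN \<gamma> \<xi> powr (Q+\<beta>))" for \<xi> :: "'n pt"
  define U where "U \<xi> = ennreal (\<bar>h (ln (NN \<gamma> \<xi>))\<bar> powr p * NN \<gamma> \<xi> powr (Q+\<beta>)) * indicator \<Omega> \<xi>" for \<xi> :: "'n pt"
  have F_eq: "F \<xi> = ennreal (\<bar>rderiv \<psi> (ln (NN \<gamma> \<xi>)) - a * \<psi> (ln (NN \<gamma> \<xi>))\<bar> powr p)" if "\<xi> \<noteq> 0" for \<xi>
    unfolding F_def h' abs_mult using pw[OF that] by simp
  have U_eq: "U \<xi> = ennreal (\<bar>\<psi> (ln (NN \<gamma> \<xi>))\<bar> powr p) * indicator \<Omega> \<xi>" if "\<xi> \<noteq> 0" for \<xi>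
    unfolding U_def h_def abs_mult using pw[OF that] by simp
  have plateau: "ln (NN \<gamma> \<xi>) \<in> {c+1..d-1}" "\<xi> \<noteq> 0" if "\<xi> \<in> (\<Union>j\<in>{1..n}. B j)" for \<xi>
  proof -
    from that obtain j where j: "1 \<le> j" "j \<le> n" "\<xi> \<in> B j" by auto
    then have "real j \<ge> 1" "real j \<le> real n" by auto
    then show "ln (NN \<gamma> \<xi>) \<in> {c+1..d-1}" "\<xi> \<noteq> 0" using j(3) by (auto simp: B_iff c_def)
  qed
  have "\<not> ennreal C * (\<integral>\<^sup>+\<xi>. U \<xi> \<partial>hmeas \<gamma> p) \<le> (\<integral>\<^sup>+\<xi>. F \<xi> \<partial>hmeas \<gamma> p)"
  proof (rule n)
    fix \<xi> :: "'n pt"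
    show "indicator (\<Union>j\<in>{1..n}. B j) \<xi> \<le> U \<xi>"
    proof (cases "\<xi> \<in> (\<Union>j\<in>{1..n}. B j)")
      case True
      note pl = plateau[OF True]
      have "NN \<gamma> \<xi> \<le> exp d"
      proof -
        have "exp (ln (NN \<gamma> \<xi>)) \<le> exp d" using pl by (simp only: exp_le_cancel_iff) simp
        then show ?thesis using NN_pos[OF g0 pl(2)] by simp
      qed
      then have "\<xi> \<in> \<Omega>" using Om pl by blast
      then show ?thesis unfolding U_eq[OF pl(2)] using on(1)[OF pl(1)] by (simp add: indicator_def)
    qed (simp add: indicator_def)
    show "F \<xi> \<le> ennreal (\<bar>a\<bar> powr p) * indicator (\<Union>j\<in>{1..n}. B j) \<xi> + (ennreal T * indicator (B 0) \<xi> + ennreal T * indicator (B (Suc n)) \<xi>)"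
    proof (cases "\<xi> = 0")
      case True
      then have "NN \<gamma> \<xi> = 0" using NN_eq_0_iff[OF g0, of \<xi>] by simp
      then show ?thesis by (simp add: F_def)
    next
      case False
      let ?s = "ln (NN \<gamma> \<xi>)"
      have FT: "F \<xi> \<le> ennreal T" unfolding F_eq[OF False] T_def
      proof (intro ennreal_leI powr_mono2)
        have "\<bar>a * \<psi> ?s\<bar> \<le> \<bar>a\<bar> * 1" unfolding abs_mult using \<psi>(1,2)[of ?s] by (intro mult_left_mono) auto
        then show "\<bar>rderiv \<psi> ?s - a * \<psi> ?s\<bar> \<le> K + \<bar>a\<bar>" using \<psi>(3)[of ?s] by linarith
      qed (use p in auto)
      consider "?s < c \<or> d \<le> ?s" | "\<xi> \<in> B 0" | "\<xi> \<in> B (Suc n)" | "c + 1 \<le> ?s" "?s < d - 1"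
        unfolding B_iff using False by (force simp: c_def)
      then show ?thesis
      proof cases
        case 1
        then have "F \<xi> = 0" unfolding F_eq[OF False] using off[of ?s] p by auto
        then show ?thesis by simp
      next
        case 2
        then show ?thesis using FT by (simp add: add_increasing add_increasing2)
      next
        case 3
        then show ?thesis using FT by (simp add: add_increasing)
      next
        case 4
        define j where "j = nat \<lceil>d - 1 - ?s\<rceil>"
        have j: "d - 1 - ?s \<le> real j" "real j < d - ?s" using 4 unfolding j_def by linarith+
        have "j \<ge> 1" "j \<le> n" using 4 unfolding j_def c_def by linarith+
        then have "\<xi> \<in> (\<Union>j\<in>{1..n}. B j)" using j False by (intro UN_I[of j]) (auto simp: B_iff)
        moreover have "F \<xi> = ennreal (\<bar>a\<bar> powr p)" unfolding F_eq[OF False] using on[of ?s] 4 by simp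
        ultimately show ?thesis by simp
      qed
    qed
  qed
  moreover have "(\<integral>\<^sup>+\<xi>. U \<xi> \<partial>hmeas \<gamma> p) = (\<integral>\<^sup>+ \<xi>. ennreal (\<bar>h (ln (NN \<gamma> \<xi>))\<bar> powr p * NN \<gamma> \<xi> powr \<beta> *
               (rr \<xi> powr (p*(2*\<gamma>-1)) / NN \<gamma> \<xi> powr (p*(2*\<gamma>-1)))) * indicator \<Omega> \<xi> \<partial>lborel)"
  proof -
    note [measurable] = smooth_measurable[OF h]
    have [measurable]: "\<Omega> \<in> sets borel" using O by simp
    have "(\<integral>\<^sup>+\<xi>. U \<xi> \<partial>hmeas \<gamma> p) = (\<integral>\<^sup>+\<xi>. ennreal (hdens \<gamma> p \<xi>) * U \<xi> \<partial>lborel)"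
      unfolding U_def by (rule nn_integral_density) measurable
    also have "\<dots> = (\<integral>\<^sup>+ \<xi>. ennreal (\<bar>h (ln (NN \<gamma> \<xi>))\<bar> powr p * NN \<gamma> \<xi> powr \<beta> *
               (rr \<xi> powr (p*(2*\<gamma>-1)) / NN \<gamma> \<xi> powr (p*(2*\<gamma>-1)))) * indicator \<Omega> \<xi> \<partial>lborel)"
    proof (rule nn_integral_cong)
      fix \<xi> :: "'n pt"
      have "NN \<gamma> \<xi> powr \<beta> = NN \<gamma> \<xi> powr (-Q) * NN \<gamma> \<xi> powr (Q+\<beta>)" unfolding powr_add[symmetric] by simp
      then have "hdens \<gamma> p \<xi> * (\<bar>h (ln (NN \<gamma> \<xi>))\<bar> powr p * NN \<gamma> \<xi> powr (Q+\<beta>)) = \<bar>h (ln (NN \<gamma> \<xi>))\<bar> powr p * NN \<gamma> \<xi> powr \<beta> *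
               (rr \<xi> powr (p*(2*\<gamma>-1)) / NN \<gamma> \<xi> powr (p*(2*\<gamma>-1)))"
        unfolding hdens_def Q_def by (simp only: mult_ac)
      then show "ennreal (hdens \<gamma> p \<xi>) * U \<xi> = ennreal (\<bar>h (ln (NN \<gamma> \<xi>))\<bar> powr p * NN \<gamma> \<xi> powr \<beta> *
               (rr \<xi> powr (p*(2*\<gamma>-1)) / NN \<gamma> \<xi> powr (p*(2*\<gamma>-1)))) * indicator \<Omega> \<xi>"
        unfolding U_def mult.assoc[symmetric] ennreal_mult'[OF hdens_nonneg, symmetric] by (simp only: mult.assoc)
    qed
    finally show ?thesis .
  qed
  moreover have "(\<integral>\<^sup>+\<xi>. ennreal (norm (greg \<gamma> h 0 \<xi>) powr p * NN \<gamma> \<xi> powr (p + \<beta>)) * indicator \<Omega> \<xi> \<partial>lborel) \<le> (\<integral>\<^sup>+\<xi>. F \<xi> \<partial>hmeas \<gamma> p)"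
  proof -
    note [measurable] = smooth_measurable[OF smooth_rderiv[OF h]]
    have "(\<integral>\<^sup>+\<xi>. F \<xi> \<partial>hmeas \<gamma> p) = (\<integral>\<^sup>+\<xi>. ennreal (hdens \<gamma> p \<xi>) * F \<xi> \<partial>lborel)"
      unfolding F_def by (rule nn_integral_density) measurable
    moreover have "(\<integral>\<^sup>+\<xi>. ennreal (norm (greg \<gamma> h 0 \<xi>) powr p * NN \<gamma> \<xi> powr (p + \<beta>)) * indicator \<Omega> \<xi> \<partial>lborel) \<le> \<dots>"
    proof (rule nn_integral_mono_AE)
      show "AE \<xi> in lborel. ennreal (norm (greg \<gamma> h 0 \<xi>) powr p * NN \<gamma> \<xi> powr (p + \<beta>)) * indicator \<Omega> \<xi> \<le> ennreal (hdens \<gamma> p \<xi>) * F \<xi>"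
        using AE_lborel_singleton[of "0 :: 'n pt"]
      proof eventually_elim
        case (elim \<xi>)
        have "NN \<gamma> \<xi> powr (Q - p) * NN \<gamma> \<xi> powr (p + \<beta>) = NN \<gamma> \<xi> powr (Q+\<beta>)" unfolding powr_add[symmetric] by simp
        then have "norm (greg \<gamma> h 0 \<xi>) powr p * NN \<gamma> \<xi> powr (p + \<beta>) = hdens \<gamma> p \<xi> * (\<bar>rderiv h (ln (NN \<gamma> \<xi>))\<bar> powr p * NN \<gamma> \<xi> powr (Q+\<beta>))"
          unfolding norm_greg_powr[OF \<gamma> p elim] Q_def[symmetric] by (simp only: mult.assoc)
        then show ?case unfolding F_def ennreal_mult'[OF hdens_nonneg, symmetric] by (simp add: indicator_def)
      qed
    qed
    ultimately show ?thesis by simp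
  qed
  ultimately show ?thesis using DL by (intro bexI[OF _ DL]) (auto dest: order_trans)
qed

section \<open>Sharpness for the logarithmic weight\<close>

lemma smooth_positive_truncation:
  obtains q :: "real \<Rightarrow> real" where "smooth q" "\<And>x. q x > 0" "\<And>x. x \<ge> 1 \<Longrightarrow> q x = x" "\<And>x. x \<le> 1 \<Longrightarrow> q x \<le> 1"
proof -
  obtain S :: "real \<Rightarrow> real" and K where S: "smooth S" "\<And>x. x \<le> 0 \<Longrightarrow> S x = 0" "\<And>x. x \<ge> 1 \<Longrightarrow> S x = 1"
    "\<And>x. 0 \<le> S x" "\<And>x. S x \<le> 1" "\<And>x. \<bar>rderiv S x\<bar> \<le> K" by (rule smooth_step_exists) blast
  \<comment> \<open>Interpolates from the constant 1 to the identity. It will replace the variable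
    ln (R/N), which takes all real values, by a positive one to which \<open>powr\<close> and
    \<open>ln\<close> apply smoothly; where q \<le> 1 the cutoff in ln q is 0, so the profile does
    not see the change.\<close>
  define q where "q x = 1 + (x + (-1)) * S x" for x
  have "smooth q" unfolding q_def[abs_def] by (intro smooth_add smooth_mult smooth_const smooth_id S(1))
  moreover have "q x > 0" for x
  proof (cases "x \<le> 0")
    case True then show ?thesis using S(2) by (simp add: q_def)
  next
    case False
    then have "(1 - x) * S x \<le> 1 - x \<or> x \<ge> 1" using S(5)[of x] by (cases "x \<ge> 1") (auto simp: mult_left_le)
    then show ?thesis using False S(3)[of x] by (auto simp: q_def algebra_simps)
  qed
  moreover have "q x = x" if "x \<ge> 1" for x using S(3)[OF that] by (simp add: q_def)
  moreover have "q x \<le> 1" if "x \<le> 1" for x using S(4)[of x] that by (simp add: q_def mult_nonpos_nonneg)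
  ultimately show thesis using that by blast
qed

text \<open>The profile is s powr b times a cutoff in ln s, where s = ln (R/N). Since b p + \<beta>
  = -1, the plateau integrand with respect to the invariant measure is 1/s, so the natural measure
  is the invariant one divided by s. Blocks of unit length in ln s have comparable, though not
  equal, masses for it. Large s means small N: the plateau extends towards the origin.\<close>

lemma sharp_log:
  fixes C \<beta> R :: real
  assumes \<gamma>: "\<gamma> \<ge> 1" and R: "R > 0" and \<beta>: "\<beta> < -1" and pQ: "p = QQ TYPE('n::finite) \<gamma>"
    and Om: "\<Omega> = {\<xi>::'n pt. NN \<gamma> \<xi> < R}"
    and C: "C > (\<bar>\<beta> + 1\<bar> / p) powr p"
  shows "\<exists>(u, g) \<in> DL \<gamma> p \<Omega> (\<lambda>\<xi>. ln (R / NN \<gamma> \<xi>) powr (p + \<beta>)).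
         \<not> (ennreal C *
           (\<integral>\<^sup>+ \<xi>. ennreal (\<bar>u \<xi>\<bar> powr p / NN \<gamma> \<xi> powr p * ln (R / NN \<gamma> \<xi>) powr \<beta> *
               (rr \<xi> powr (p*(2*\<gamma>-1)) / NN \<gamma> \<xi> powr (p*(2*\<gamma>-1)))) * indicator \<Omega> \<xi> \<partial>lborel)
         \<le> (\<integral>\<^sup>+ \<xi>. ennreal (norm (g \<xi>) powr p * ln (R / NN \<gamma> \<xi>) powr (p + \<beta>)) * indicator \<Omega> \<xi> \<partial>lborel))"
proof -
  have g0: "\<gamma> > 0" using \<gamma> by simp
  have p: "p > 1" unfolding pQ QQ_def using \<gamma> by (auto intro: add_nonneg_pos)
  have O: "open \<Omega>" unfolding Om by (intro open_Collect_less continuous_on_NN[OF g0] continuous_intros)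
  define b where "b = \<bar>\<beta> + 1\<bar> / p"
  have b0: "b > 0" using \<beta> p by (simp add: b_def)
  have bp: "b * p = - \<beta> - 1" using \<beta> p by (simp add: b_def)
  define s where "s \<xi> = ln (R / NN \<gamma> \<xi>)" for \<xi> :: "'n pt"
  have s_eq: "s \<xi> = ln R - ln (NN \<gamma> \<xi>)" if "\<xi> \<noteq> 0" for \<xi>
    using R NN_pos[OF g0 that] by (simp add: s_def ln_div)
  have [measurable]: "s \<in> borel_measurable borel" unfolding s_def by measurable
  have s_Om: "\<xi> \<in> \<Omega>" if "\<xi> \<noteq> 0" "s \<xi> > 0" for \<xi>
  proof -
    have "ln (NN \<gamma> \<xi>) < ln R" using that s_eq by simp
    then show ?thesis using R NN_pos[OF g0 that(1)] by (simp add: Om)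
  qed
  obtain \<mu> where \<mu>: "\<mu> > 0" "emeasure (hmeas \<gamma> p) (shell \<gamma> 0 1 :: 'n pt set) = ennreal \<mu>"
    by (rule emeasure_unit_shell[OF \<gamma> p])
  obtain K where K: "K \<ge> 0" "\<And>c d. \<exists>\<psi>. cutoff K c d \<psi>" by (rule cutoff_exists) blast
  \<comment> \<open>The maximum keeps the density harmless where s \<le> 1; the profile vanishes
    there. The integrands \<open>F\<close> and \<open>U\<close> below carry the compensating
    factor.\<close>
  define D where "D \<xi> = hdens \<gamma> p \<xi> / max 1 (s \<xi>)" for \<xi>
  have D0: "D \<xi> \<ge> 0" for \<xi> by (simp add: D_def)
  have [measurable]: "D \<in> borel_measurable borel" unfolding D_def by measurable
  let ?M = "density lborel (\<lambda>\<xi>. ennreal (D \<xi>))"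
  \<comment> \<open>These are the sets j+1 < ln s \<le> j+2. Their length in ln N grows like exp j,
    which the division by s compensates.\<close>
  define B where "B j = (shell \<gamma> (ln R - exp (real j + 2)) (ln R - exp (real j + 1)) :: 'n pt set)" for j :: nat
  have B_iff: "\<xi> \<in> B j \<longleftrightarrow> \<xi> \<noteq> 0 \<and> exp (real j + 1) < s \<xi> \<and> s \<xi> \<le> exp (real j + 2)" for \<xi> j
  proof (cases "\<xi> = 0")
    case True
    then show ?thesis using NN_eq_0_iff[OF g0, of \<xi>] by (simp add: B_def shell_def)
  next
    case False
    have e: "NN \<gamma> \<xi> = exp (ln (NN \<gamma> \<xi>))" using NN_pos[OF g0 False] by simp
    have "\<xi> \<in> B j \<longleftrightarrow> ln R - exp (real j + 2) \<le> ln (NN \<gamma> \<xi>) \<and> ln (NN \<gamma> \<xi>) < ln R - exp (real j + 1)"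
      unfolding B_def shell_def mem_Collect_eq by (subst (1 2) e) (simp only: exp_le_cancel_iff exp_less_cancel_iff)
    then show ?thesis using False s_eq[OF False] by auto
  qed
  have disj: "disjoint_family B"
  proof (unfold disjoint_family_on_def, intro ballI impI)
    fix i j :: nat assume "i \<noteq> j"
    then have "real i + 2 \<le> real j + 1 \<or> real j + 2 \<le> real i + 1" by linarith
    then have "exp (real i + 2) \<le> exp (real j + 1) \<or> exp (real j + 2) \<le> exp (real i + 1)"
      by (simp only: exp_le_cancel_iff)
    then show "B i \<inter> B j = {}" unfolding disjoint_iff B_iff by (smt (verit))
  qed
  have e2: "exp (-1::real) \<le> 1/2"
    using exp_ge_add_one_self[of "1::real"] by (simp add: exp_minus field_simps)
  have MB: "ennreal (\<mu> / 4) \<le> emeasure ?M (B j)" "emeasure ?M (B j) \<le> ennreal (exp 1 * \<mu>)" for j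
  proof -
    let ?a = "exp (real j + 1)" and ?b = "exp (real j + 2)"
    have ab: "ln R - ?b \<le> ln R - ?a" by simp
    note bd = emeasure_shell_bounds[OF g0 \<mu>(2) less_imp_le[OF \<mu>(1)] ab]
    have M: "emeasure ?M (B j) = (\<integral>\<^sup>+\<xi>. ennreal (D \<xi>) * indicator (B j) \<xi> \<partial>lborel)"
      by (simp add: emeasure_density B_def)
    have H: "ennreal x * emeasure (hmeas \<gamma> p) (B j) = (\<integral>\<^sup>+\<xi>. ennreal (x * hdens \<gamma> p \<xi>) * indicator (B j) \<xi> \<partial>lborel)" if "x \<ge> 0" for x
      using that by (simp add: emeasure_density B_def nn_integral_cmult[symmetric] ennreal_mult mult.assoc)
    have Dx: "D \<xi> = inverse (s \<xi>) * hdens \<gamma> p \<xi>" "inverse ?b \<le> inverse (s \<xi>)" "inverse (s \<xi>) \<le> inverse ?a" if "\<xi> \<in> B j" for \<xi>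
    proof -
      have 1: "?a < s \<xi>" "s \<xi> \<le> ?b" using that by (auto simp: B_iff)
      moreover have "1 \<le> ?a" by simp
      ultimately have "s \<xi> > 1" by linarith
      then show "D \<xi> = inverse (s \<xi>) * hdens \<gamma> p \<xi>" by (simp add: D_def divide_inverse)
      show "inverse ?b \<le> inverse (s \<xi>)" using 1 \<open>s \<xi> > 1\<close> by (intro le_imp_inverse_le) auto
      show "inverse (s \<xi>) \<le> inverse ?a" using 1 by (intro le_imp_inverse_le) auto
    qed
    have "emeasure ?M (B j) \<le> ennreal (inverse ?a) * emeasure (hmeas \<gamma> p) (B j)"
      unfolding M H[OF inverse_nonnegative_iff_nonnegative[THEN iffD2, OF exp_ge_zero]]
      by (intro nn_integral_mono) (auto simp: indicator_def Dx intro!: ennreal_leI mult_right_mono)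
    also have "\<dots> \<le> ennreal (inverse ?a) * ennreal ((?b - ?a + 1) * \<mu>)"
      using bd(1) unfolding B_def by (intro mult_left_mono) (auto simp: algebra_simps)
    also have "\<dots> = ennreal (inverse ?a * ((?b - ?a + 1) * \<mu>))" by (simp add: ennreal_mult')
    \<comment> \<open>As ?b is e times ?a and ?a \<ge> 1, the factor is e - 1 + 1/?a, at most
      e.\<close>
    also have "\<dots> \<le> ennreal (exp 1 * \<mu>)"
    proof (rule ennreal_leI)
      have "?b = exp 1 * ?a" by (simp add: exp_add[symmetric])
      moreover have "1 \<le> ?a" by simp
      ultimately have "inverse ?a * (?b - ?a + 1) \<le> exp 1" by (simp add: field_simps)
      then have "inverse ?a * (?b - ?a + 1) * \<mu> \<le> exp 1 * \<mu>" using \<mu>(1) by (intro mult_right_mono) auto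
      then show "inverse ?a * ((?b - ?a + 1) * \<mu>) \<le> exp 1 * \<mu>" by (simp only: mult.assoc)
    qed
    finally show "emeasure ?M (B j) \<le> ennreal (exp 1 * \<mu>)" .
    \<comment> \<open>From ?a \<le> ?b/2 and ?b \<ge> 4 the factor is at least 1 - 1/2 -
      1/4.\<close>
    have "ennreal (\<mu> / 4) \<le> ennreal (inverse ?b * ((?b - ?a - 1) * \<mu>))"
    proof (rule ennreal_leI)
      have "?a = exp (-1) * ?b" by (simp add: exp_add[symmetric])
      then have "?a \<le> ?b / 2" using mult_right_mono[OF e2, of ?b] by simp
      moreover have "?b \<ge> exp (1 + 1)" by simp
      then have "?b \<ge> 4" using mult_mono[OF exp_ge_add_one_self[of "1::real"] exp_ge_add_one_self[of "1::real"]] unfolding exp_add by simp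
      ultimately have "1/4 \<le> inverse ?b * (?b - ?a - 1)" by (simp add: field_simps)
      then have "1/4 * \<mu> \<le> inverse ?b * (?b - ?a - 1) * \<mu>" using \<mu>(1) by (intro mult_right_mono) auto
      then show "\<mu> / 4 \<le> inverse ?b * ((?b - ?a - 1) * \<mu>)" by (simp add: mult.assoc)
    qed
    also have "\<dots> = ennreal (inverse ?b) * ennreal ((?b - ?a - 1) * \<mu>)" by (simp add: ennreal_mult')
    also have "\<dots> \<le> ennreal (inverse ?b) * emeasure (hmeas \<gamma> p) (B j)"
      using bd(2) unfolding B_def by (intro mult_left_mono) (auto simp: algebra_simps)
    also have "\<dots> \<le> emeasure ?M (B j)"
      unfolding M H[OF inverse_nonnegative_iff_nonnegative[THEN iffD2, OF exp_ge_zero]]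
      by (intro nn_integral_mono) (auto simp: indicator_def Dx intro!: ennreal_leI mult_right_mono)
    finally show "ennreal (\<mu> / 4) \<le> emeasure ?M (B j)" .
  qed
  define T where "T = (K + b) powr p"
  obtain n where n: "\<And>F U :: 'n pt \<Rightarrow> ennreal. (\<And>x. x \<in> space ?M \<Longrightarrow> F x \<le> ennreal (b powr p) * indicator (\<Union>j\<in>{1..n}. B j) x
      + (ennreal T * indicator (B 0) x + ennreal T * indicator (B (Suc n)) x))
    \<Longrightarrow> (\<And>x. x \<in> space ?M \<Longrightarrow> indicator (\<Union>j\<in>{1..n}. B j) x \<le> U x)
    \<Longrightarrow> \<not> ennreal C * (\<integral>\<^sup>+x. U x \<partial>?M) \<le> (\<integral>\<^sup>+x. F x \<partial>?M)"
    by (rule sharp_compare[of B ?M "\<mu>/4" "exp 1 * \<mu>" "b powr p" T C])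
       (use MB \<mu> disj C in \<open>auto simp: T_def B_def b_def\<close>)
  \<comment> \<open>In ln s the n+2 blocks fill the interval from 1 to n+3; the transitions occupy
    the first and the last.\<close>
  obtain \<psi> where "cutoff K 1 (real n + 3) \<psi>" using K(2) by blast
  then have sm: "smooth \<psi>" and \<psi>: "\<And>x. 0 \<le> \<psi> x" "\<And>x. \<psi> x \<le> 1" "\<And>x. \<bar>rderiv \<psi> x\<bar> \<le> K"
    and off: "\<And>x. x \<le> 1 \<or> real n + 3 \<le> x \<Longrightarrow> \<psi> x = 0" "\<And>x. x \<le> 1 \<or> real n + 3 \<le> x \<Longrightarrow> rderiv \<psi> x = 0"
    and on: "\<And>x. x \<in> {1+1..real n + 3-1} \<Longrightarrow> \<psi> x = 1" "\<And>x. x \<in> {1+1..real n + 3-1} \<Longrightarrow> rderiv \<psi> x = 0"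
    unfolding cutoff_def by blast+
  obtain q :: "real \<Rightarrow> real" where q: "smooth q" "\<And>x. q x > 0" "\<And>x. x \<ge> 1 \<Longrightarrow> q x = x" "\<And>x. x \<le> 1 \<Longrightarrow> q x \<le> 1"
    by (rule smooth_positive_truncation) blast
  define h where "h x = q (ln R - x) powr b * \<psi> (ln (q (ln R - x)))" for x
  have "smooth (\<lambda>x. q (ln R - x))" using smooth_compose[OF q(1) smooth_affine[of "-1" "ln R"]] by simp
  then have h: "smooth h" unfolding h_def[abs_def]
    by (intro smooth_mult smooth_powr smooth_compose[OF sm] smooth_ln q(2))
  define c where "c = ln R - exp (real n + 3)"
  define d where "d = ln R - exp 1"
  have h_val: "h x = (ln R - x) powr b * \<psi> (ln (ln R - x))" if "ln R - x \<ge> 1" for x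
    using q(3)[OF that] by (simp add: h_def)
  have z: "\<forall>x. x \<notin> {c..d} \<longrightarrow> h x = 0"
  proof (intro allI impI)
    fix x assume "x \<notin> {c..d}"
    \<comment> \<open>In the first range q is not the identity and ln q \<le> 0; in the second q is
      the identity and ln s < 1; in the third ln s exceeds n + 3. The cutoff vanishes in
      each.\<close>
    then consider "ln R - x \<le> 1" | "ln R - x > 1" "ln R - x < exp 1" | "ln R - x > exp (real n + 3)"
      by (fastforce simp: c_def d_def)
    then show "h x = 0"
    proof cases
      case 1
      then have "ln (q (ln R - x)) \<le> 0" using q(2,4) by simp
      then show ?thesis using off(1) by (simp add: h_def)
    next
      case 2
      then have "ln (ln R - x) < ln (exp 1)" by (subst ln_less_cancel_iff) auto
      then show ?thesis using off(1) 2 by (simp add: h_val)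
    next
      case 3
      then have "0 < ln R - x" using less_trans[OF exp_gt_zero] by blast
      with 3 have "ln (exp (real n + 3)) < ln (ln R - x)" by (subst ln_less_cancel_iff) auto
      then have "real n + 3 \<le> ln (ln R - x)" by simp
      then have "\<psi> (ln (ln R - x)) = 0" using off(1) by blast
      moreover have "1 \<le> ln R - x"
        using 3 order_trans[OF one_le_exp_iff[THEN iffD2] less_imp_le[OF 3]] by simp
      ultimately show ?thesis by (simp add: h_val)
    qed
  qed
  have h': "rderiv h x = - ((ln R - x) powr (b-1) * (b * \<psi> (ln (ln R - x)) + rderiv \<psi> (ln (ln R - x))))" if x: "ln R - x > 1" for x
  proof -
    define y where "y = ln R - x"
    have y: "y > 1" using x by (simp add: y_def)
    have l: "((\<lambda>x. ln R - x) has_real_derivative -1) (at x)" by (auto intro!: derivative_eq_intros)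
    have p1: "((\<lambda>y. y powr b) has_real_derivative b * y powr (b-1)) (at (ln R - x))"
      using y by (auto intro!: derivative_eq_intros simp: y_def)
    have ln1: "(ln has_real_derivative inverse y) (at (ln R - x))"
      using y DERIV_ln[of y] by (simp add: y_def)
    have d1: "((\<lambda>x. (ln R - x) powr b) has_real_derivative b * y powr (b-1) * -1) (at x)"
      using DERIV_chain2[where f = "\<lambda>y. y powr b", OF p1 l] .
    have d2: "((\<lambda>x. ln (ln R - x)) has_real_derivative inverse y * -1) (at x)"
      using DERIV_chain2[where f = ln, OF ln1 l] .
    have d3: "((\<lambda>x. \<psi> (ln (ln R - x))) has_real_derivative rderiv \<psi> (ln (ln R - x)) * (inverse y * -1)) (at x)"
      by (rule DERIV_chain2[where f = \<psi>, OF rderiv_works[OF sm] d2])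
    have "((\<lambda>x. (ln R - x) powr b * \<psi> (ln (ln R - x))) has_real_derivative
       b * y powr (b-1) * -1 * \<psi> (ln (ln R - x)) + rderiv \<psi> (ln (ln R - x)) * (inverse y * -1) * (ln R - x) powr b) (at x)"
      by (rule DERIV_mult[OF d1 d3])
    then have "(h has_real_derivative
       b * y powr (b-1) * -1 * \<psi> (ln (ln R - x)) + rderiv \<psi> (ln (ln R - x)) * (inverse y * -1) * (ln R - x) powr b) (at x)"
      by (rule has_field_derivative_transform_within_open[of _ _ _ "{..<ln R - 1}"]) (use x h_val in auto)
    from DERIV_unique[OF rderiv_works[OF h] this]
    have "rderiv h x = - (b * y powr (b-1) * \<psi> (ln y) + rderiv \<psi> (ln y) * (inverse y * y powr b))"
      by (simp add: y_def[symmetric])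
    moreover have "inverse y * y powr b = y powr (b-1)" using y by (simp add: powr_diff divide_inverse mult.commute)
    ultimately show ?thesis by (simp add: y_def[symmetric] algebra_simps)
  qed
  have DL: "(\<lambda>\<xi>. h (ln (NN \<gamma> \<xi>)), greg \<gamma> h 0) \<in> DL \<gamma> p \<Omega> (\<lambda>\<xi>. ln (R / NN \<gamma> \<xi>) powr (p + \<beta>))"
  proof (rule profile_in_DL[OF \<gamma> p h z _ O])
    fix \<xi> :: "'n pt" assume x: "\<xi> \<noteq> 0" "NN \<gamma> \<xi> \<le> exp d"
    then have "ln (NN \<gamma> \<xi>) \<le> ln (exp d)" using NN_pos[OF g0 x(1)] by (subst ln_le_cancel_iff) auto
    then have "s \<xi> \<ge> exp 1" using s_eq[OF x(1)] by (simp add: d_def)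
    then show "\<xi> \<in> \<Omega>" using s_Om x(1) less_le_trans[OF exp_gt_zero] by blast
  next
    fix \<xi> :: "'n pt" assume x: "exp c / 2 \<le> NN \<gamma> \<xi>" "NN \<gamma> \<xi> \<le> exp d"
    have "0 < exp c / 2" by simp
    then have N: "NN \<gamma> \<xi> > 0" using x by linarith
    then have x0: "\<xi> \<noteq> 0" using NN_eq_0_iff[OF g0, of \<xi>] by auto
    have "ln (NN \<gamma> \<xi>) \<le> ln (exp d)" using N x by (subst ln_le_cancel_iff) auto
    then have s1: "exp 1 \<le> s \<xi>" using s_eq[OF x0] by (simp add: d_def)
    have "ln (exp c / 2) \<le> ln (NN \<gamma> \<xi>)" using N x by (subst ln_le_cancel_iff) auto
    then have s2: "s \<xi> \<le> ln R - ln (exp c / 2)" using s_eq[OF x0] by simp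
    have s0: "0 \<le> s \<xi>" using s1 exp_gt_zero[of "1::real"] by linarith
    have "s \<xi> powr (p + \<beta>) \<le> exp 1 powr (p + \<beta>) + (ln R - ln (exp c / 2)) powr (p + \<beta>)"
    proof (cases "p + \<beta> \<ge> 0")
      case True
      then have "s \<xi> powr (p + \<beta>) \<le> (ln R - ln (exp c / 2)) powr (p + \<beta>)" using s2 s0 by (intro powr_mono2) auto
      then show ?thesis by (simp add: add_increasing)
    next
      case False
      then have "s \<xi> powr (p + \<beta>) \<le> exp 1 powr (p + \<beta>)" using s1 by (intro powr_mono2') auto
      then show ?thesis by (simp add: add_increasing2)
    qed
    then show "ln (R / NN \<gamma> \<xi>) powr (p + \<beta>) \<le> exp 1 powr (p + \<beta>) + (ln R - ln (exp c / 2)) powr (p + \<beta>)"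
      by (simp only: s_def)
  qed auto
  define F where "F \<xi> = ennreal (\<bar>rderiv h (ln (NN \<gamma> \<xi>))\<bar> powr p * s \<xi> powr (p + \<beta>) * max 1 (s \<xi>))" for \<xi>
  define U where "U \<xi> = ennreal (\<bar>h (ln (NN \<gamma> \<xi>))\<bar> powr p * s \<xi> powr \<beta> * max 1 (s \<xi>)) * indicator \<Omega> \<xi>" for \<xi>
  have F_low: "F \<xi> = 0" if "\<xi> \<noteq> 0" "s \<xi> \<le> 1" for \<xi>
  proof -
    have "(1::real) < exp 1" by simp
    then have "ln (NN \<gamma> \<xi>) \<notin> {c..d}" 
      using that(2) s_eq[OF that(1)] unfolding d_def atLeastAtMost_iff by linarith
    then show ?thesis using rderiv_zero_off[OF h z] p by (simp add: F_def)
  qed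
  have F_eq: "F \<xi> = ennreal (\<bar>b * \<psi> (ln (s \<xi>)) + rderiv \<psi> (ln (s \<xi>))\<bar> powr p)" if "\<xi> \<noteq> 0" "s \<xi> > 1" for \<xi>
  proof -
    let ?D = "b * \<psi> (ln (s \<xi>)) + rderiv \<psi> (ln (s \<xi>))"
    have "\<bar>rderiv h (ln (NN \<gamma> \<xi>))\<bar> = s \<xi> powr (b-1) * \<bar>?D\<bar>"
      using h'[of "ln (NN \<gamma> \<xi>)"] s_eq[OF that(1)] that(2) by (simp add: abs_mult)
    then have "\<bar>rderiv h (ln (NN \<gamma> \<xi>))\<bar> powr p * s \<xi> powr (p + \<beta>) * max 1 (s \<xi>)
      = \<bar>?D\<bar> powr p * (s \<xi> powr ((b-1)*p) * s \<xi> powr (p + \<beta>) * s \<xi> powr 1)"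
      using that(2) by (simp add: powr_mult powr_powr)
    also have "s \<xi> powr ((b-1)*p) * s \<xi> powr (p + \<beta>) * s \<xi> powr 1 = s \<xi> powr 0"
      unfolding powr_add[symmetric] using bp by (intro arg_cong2[where f = "(powr)"]) (auto simp: algebra_simps)
    finally show ?thesis using that(2) by (simp add: F_def)
  qed
  have U_eq: "U \<xi> = ennreal (\<bar>\<psi> (ln (s \<xi>))\<bar> powr p) * indicator \<Omega> \<xi>" if "\<xi> \<noteq> 0" "s \<xi> > 1" for \<xi>
  proof -
    have "\<bar>h (ln (NN \<gamma> \<xi>))\<bar> = s \<xi> powr b * \<bar>\<psi> (ln (s \<xi>))\<bar>"
      using h_val[of "ln (NN \<gamma> \<xi>)"] s_eq[OF that(1)] that(2) by (simp add: abs_mult)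
    then have "\<bar>h (ln (NN \<gamma> \<xi>))\<bar> powr p * s \<xi> powr \<beta> * max 1 (s \<xi>)
      = \<bar>\<psi> (ln (s \<xi>))\<bar> powr p * (s \<xi> powr (b*p) * s \<xi> powr \<beta> * s \<xi> powr 1)"
      using that(2) by (simp add: powr_mult powr_powr)
    also have "s \<xi> powr (b*p) * s \<xi> powr \<beta> * s \<xi> powr 1 = s \<xi> powr 0"
      unfolding powr_add[symmetric] using bp by (intro arg_cong2[where f = "(powr)"]) (auto simp: algebra_simps)
    finally show ?thesis using that(2) by (simp add: U_def)
  qed
  have ln_B: "real j + 1 < ln (s \<xi>) \<and> ln (s \<xi>) \<le> real j + 2 \<longleftrightarrow> \<xi> \<in> B j" if "\<xi> \<noteq> 0" "s \<xi> > 0" for \<xi> j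
  proof -
    have e: "s \<xi> = exp (ln (s \<xi>))" using that by simp
    show ?thesis using that(1) unfolding B_iff by (subst (3 4) e) (simp only: exp_le_cancel_iff exp_less_cancel_iff simp_thms)
  qed
  have B_big: "s \<xi> > 1" "\<xi> \<noteq> 0" if "\<xi> \<in> B j" for \<xi> j
  proof -
    have "(1::real) \<le> exp (real j + 1)" by simp
    then show "s \<xi> > 1" "\<xi> \<noteq> 0" using that unfolding B_iff by linarith+
  qed
  have "\<not> ennreal C * (\<integral>\<^sup>+\<xi>. U \<xi> \<partial>?M) \<le> (\<integral>\<^sup>+\<xi>. F \<xi> \<partial>?M)"
  proof (rule n)
    fix \<xi> :: "'n pt"
    show "indicator (\<Union>j\<in>{1..n}. B j) \<xi> \<le> U \<xi>"
    proof (cases "\<xi> \<in> (\<Union>j\<in>{1..n}. B j)")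
      case True
      then obtain j where j: "1 \<le> j" "j \<le> n" "\<xi> \<in> B j" by auto
      note big = B_big[OF j(3)]
      have "real j + 1 < ln (s \<xi>)" "ln (s \<xi>) \<le> real j + 2" using ln_B[OF big(2), of j] j(3) big(1) by auto
      moreover have "1 \<le> real j" "real j \<le> real n" using j by auto
      ultimately have "\<psi> (ln (s \<xi>)) = 1" by (intro on(1)) auto
      moreover have "\<xi> \<in> \<Omega>" using s_Om big by simp
      ultimately show ?thesis unfolding U_eq[OF big(2,1)] by (simp add: indicator_def)
    qed (simp add: indicator_def)
    show "F \<xi> \<le> ennreal (b powr p) * indicator (\<Union>j\<in>{1..n}. B j) \<xi> + (ennreal T * indicator (B 0) \<xi> + ennreal T * indicator (B (Suc n)) \<xi>)"
    proof (cases "\<xi> = 0")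
      case True
      then have "NN \<gamma> \<xi> = 0" using NN_eq_0_iff[OF g0, of \<xi>] by simp
      then have "s \<xi> = 0" by (simp add: s_def)
      then show ?thesis by (simp add: F_def)
    next
      case False
      let ?t = "ln (s \<xi>)"
      show ?thesis
      proof (cases "s \<xi> > 1")
        case low: False
        then show ?thesis using F_low[OF False] by simp
      next
        case big: True
        note Fe = F_eq[OF False big]
        have FT: "F \<xi> \<le> ennreal T" unfolding Fe T_def
        proof (intro ennreal_leI powr_mono2)
          have "\<bar>b * \<psi> ?t\<bar> \<le> b * 1" unfolding abs_mult using \<psi>(1,2)[of ?t] b0 by (intro mult_mono) auto
          then show "\<bar>b * \<psi> ?t + rderiv \<psi> ?t\<bar> \<le> K + b" using \<psi>(3)[of ?t] by linarith
        qed (use p in auto)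
        have ln_B': "\<xi> \<in> B j \<longleftrightarrow> real j + 1 < ?t \<and> ?t \<le> real j + 2" for j using ln_B[OF False, of j] big by simp
        consider "?t \<le> 1 \<or> real n + 3 \<le> ?t" | "\<xi> \<in> B 0" | "\<xi> \<in> B (Suc n)" | "2 < ?t" "?t \<le> real n + 2"
          unfolding ln_B' by force
        then show ?thesis
        proof cases
          case 1
          then have "F \<xi> = 0" unfolding Fe using off[of ?t] p by auto
          then show ?thesis by simp
        next
          case 2
          then show ?thesis using FT by (simp add: add_increasing add_increasing2)
        next
          case 3
          then show ?thesis using FT by (simp add: add_increasing)
        next
          case 4
          \<comment> \<open>The blocks are open on the left and closed on the right in ln s, so the
            block index comes from the ceiling.\<close>
          define j where "j = nat (\<lceil>?t\<rceil> - 2)"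
          have j: "real j + 1 < ?t" "?t \<le> real j + 2" using 4 unfolding j_def by linarith+
          have "j \<ge> 1" "j \<le> n" using 4 unfolding j_def by linarith+
          then have "\<xi> \<in> (\<Union>j\<in>{1..n}. B j)" using j by (intro UN_I[of j]) (auto simp: ln_B')
          moreover have "F \<xi> = ennreal (b powr p)" unfolding Fe using on[of ?t] 4 b0 by simp
          ultimately show ?thesis by simp
        qed
      qed
    qed
  qed
  moreover have "(\<integral>\<^sup>+\<xi>. U \<xi> \<partial>?M) = (\<integral>\<^sup>+ \<xi>. ennreal (\<bar>h (ln (NN \<gamma> \<xi>))\<bar> powr p / NN \<gamma> \<xi> powr p * ln (R / NN \<gamma> \<xi>) powr \<beta> *
               (rr \<xi> powr (p*(2*\<gamma>-1)) / NN \<gamma> \<xi> powr (p*(2*\<gamma>-1)))) * indicator \<Omega> \<xi> \<partial>lborel)"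
  proof -
    note [measurable] = smooth_measurable[OF h]
    have [measurable]: "\<Omega> \<in> sets borel" using O by simp
    have "(\<integral>\<^sup>+\<xi>. U \<xi> \<partial>?M) = (\<integral>\<^sup>+\<xi>. ennreal (D \<xi>) * U \<xi> \<partial>lborel)"
      unfolding U_def by (rule nn_integral_density) measurable
    also have "\<dots> = (\<integral>\<^sup>+ \<xi>. ennreal (\<bar>h (ln (NN \<gamma> \<xi>))\<bar> powr p / NN \<gamma> \<xi> powr p * ln (R / NN \<gamma> \<xi>) powr \<beta> *
               (rr \<xi> powr (p*(2*\<gamma>-1)) / NN \<gamma> \<xi> powr (p*(2*\<gamma>-1)))) * indicator \<Omega> \<xi> \<partial>lborel)"
    proof (rule nn_integral_cong)
      fix \<xi> :: "'n pt"
      have "max 1 (s \<xi>) \<noteq> 0" by linarith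
      then have "D \<xi> * (\<bar>h (ln (NN \<gamma> \<xi>))\<bar> powr p * s \<xi> powr \<beta> * max 1 (s \<xi>)) = hdens \<gamma> p \<xi> * (\<bar>h (ln (NN \<gamma> \<xi>))\<bar> powr p * s \<xi> powr \<beta>)"
        by (simp add: D_def)
      also have "\<dots> = \<bar>h (ln (NN \<gamma> \<xi>))\<bar> powr p / NN \<gamma> \<xi> powr p * ln (R / NN \<gamma> \<xi>) powr \<beta> *
               (rr \<xi> powr (p*(2*\<gamma>-1)) / NN \<gamma> \<xi> powr (p*(2*\<gamma>-1)))"
        unfolding hdens_def pQ[symmetric] powr_minus s_def by (simp add: divide_inverse mult_ac)
      finally show "ennreal (D \<xi>) * U \<xi> = ennreal (\<bar>h (ln (NN \<gamma> \<xi>))\<bar> powr p / NN \<gamma> \<xi> powr p * ln (R / NN \<gamma> \<xi>) powr \<beta> *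
               (rr \<xi> powr (p*(2*\<gamma>-1)) / NN \<gamma> \<xi> powr (p*(2*\<gamma>-1)))) * indicator \<Omega> \<xi>"
        unfolding U_def mult.assoc[symmetric] ennreal_mult'[OF D0, symmetric] by (simp only: mult.assoc)
    qed
    finally show ?thesis .
  qed
  moreover have "(\<integral>\<^sup>+\<xi>. ennreal (norm (greg \<gamma> h 0 \<xi>) powr p * ln (R / NN \<gamma> \<xi>) powr (p + \<beta>)) * indicator \<Omega> \<xi> \<partial>lborel) \<le> (\<integral>\<^sup>+\<xi>. F \<xi> \<partial>?M)"
  proof -
    note [measurable] = smooth_measurable[OF smooth_rderiv[OF h]]
    have "(\<integral>\<^sup>+\<xi>. F \<xi> \<partial>?M) = (\<integral>\<^sup>+\<xi>. ennreal (D \<xi>) * F \<xi> \<partial>lborel)"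
      unfolding F_def by (rule nn_integral_density) measurable
    moreover have "(\<integral>\<^sup>+\<xi>. ennreal (norm (greg \<gamma> h 0 \<xi>) powr p * ln (R / NN \<gamma> \<xi>) powr (p + \<beta>)) * indicator \<Omega> \<xi> \<partial>lborel) \<le> \<dots>"
    proof (rule nn_integral_mono_AE)
      show "AE \<xi> in lborel. ennreal (norm (greg \<gamma> h 0 \<xi>) powr p * ln (R / NN \<gamma> \<xi>) powr (p + \<beta>)) * indicator \<Omega> \<xi> \<le> ennreal (D \<xi>) * F \<xi>"
        using AE_lborel_singleton[of "0 :: 'n pt"]
      proof eventually_elim
        case (elim \<xi>)
        have "max 1 (s \<xi>) \<noteq> 0" by linarith
        then have "D \<xi> * (\<bar>rderiv h (ln (NN \<gamma> \<xi>))\<bar> powr p * s \<xi> powr (p + \<beta>) * max 1 (s \<xi>))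
          = hdens \<gamma> p \<xi> * (\<bar>rderiv h (ln (NN \<gamma> \<xi>))\<bar> powr p * s \<xi> powr (p + \<beta>))"
          by (simp add: D_def)
        also have "\<dots> = norm (greg \<gamma> h 0 \<xi>) powr p * ln (R / NN \<gamma> \<xi>) powr (p + \<beta>)"
          unfolding norm_greg_powr[OF \<gamma> p elim] s_def pQ[symmetric] using NN_pos[OF g0 elim] by simp
        finally show ?case unfolding F_def ennreal_mult'[OF D0, symmetric] by (simp add: indicator_def)
      qed
    qed
    ultimately show ?thesis by simp
  qed
  ultimately show ?thesis using DL by (intro bexI[OF _ DL]) (auto dest: order_trans)
qed

section \<open>The Hardy inequalities\<close>

lemma DL_closure_const:
  fixes v w :: "'n::finite pt \<Rightarrow> real"
  assumes p: "p > 1" and Om: "open \<Omega>" and [measurable]: "v \<in> borel_measurable borel" "w \<in> borel_measurable borel"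
    and v: "\<And>\<xi>. v \<xi> \<ge> 0" and w: "\<And>\<xi>. w \<xi> \<ge> 0" and c: "c \<ge> 0"
    and test: "\<And>\<phi>. test_fun \<Omega> \<phi> \<Longrightarrow> (\<integral>\<^sup>+\<xi>. ennreal (c * (\<bar>\<phi> \<xi>\<bar> powr p * v \<xi>)) \<partial>lborel) \<le> (\<integral>\<^sup>+\<xi>. ennreal (norm (gradL \<gamma> \<phi> \<xi>) powr p * w \<xi>) \<partial>lborel)"
    and ug: "(u, g) \<in> DL \<gamma> p \<Omega> w"
  shows "ennreal c * (\<integral>\<^sup>+\<xi>. ennreal (\<bar>u \<xi>\<bar> powr p * v \<xi>) * indicator \<Omega> \<xi> \<partial>lborel) \<le> (\<integral>\<^sup>+\<xi>. ennreal (norm (g \<xi>) powr p * w \<xi>) * indicator \<Omega> \<xi> \<partial>lborel)"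
proof -
  have [measurable]: "\<Omega> \<in> sets borel" using Om by simp
  have [measurable]: "u \<in> borel_measurable borel" using ug by (simp add: DL_def)
  have "ennreal c * (\<integral>\<^sup>+\<xi>. ennreal (\<bar>u \<xi>\<bar> powr p * v \<xi>) * indicator \<Omega> \<xi> \<partial>lborel)
     = (\<integral>\<^sup>+\<xi>. ennreal c * (ennreal (\<bar>u \<xi>\<bar> powr p * v \<xi>) * indicator \<Omega> \<xi>) \<partial>lborel)"
    by (rule nn_integral_cmult[symmetric]) measurable
  also have "\<dots> = (\<integral>\<^sup>+\<xi>. ennreal (\<bar>u \<xi>\<bar> powr p * (c * v \<xi>)) * indicator \<Omega> \<xi> \<partial>lborel)"
  proof (rule nn_integral_cong)
    fix \<xi> :: "'n pt"
    have "ennreal (\<bar>u \<xi>\<bar> powr p * (c * v \<xi>)) = ennreal (c * (\<bar>u \<xi>\<bar> powr p * v \<xi>))"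
      by (simp only: mult.left_commute)
    then have "ennreal (\<bar>u \<xi>\<bar> powr p * (c * v \<xi>)) = ennreal c * ennreal (\<bar>u \<xi>\<bar> powr p * v \<xi>)"
      unfolding ennreal_mult'[OF c] .
    then show "ennreal c * (ennreal (\<bar>u \<xi>\<bar> powr p * v \<xi>) * indicator \<Omega> \<xi>) = ennreal (\<bar>u \<xi>\<bar> powr p * (c * v \<xi>)) * indicator \<Omega> \<xi>"
      by (simp only: mult.assoc)
  qed
  also have "\<dots> \<le> (\<integral>\<^sup>+\<xi>. ennreal (norm (g \<xi>) powr p * w \<xi>) * indicator \<Omega> \<xi> \<partial>lborel)"
  proof (rule DL_closure[OF p _ _ _ _ w _ ug])
    show "(\<integral>\<^sup>+\<xi>. ennreal (\<bar>\<phi> \<xi>\<bar> powr p * (c * v \<xi>)) \<partial>lborel) \<le> (\<integral>\<^sup>+\<xi>. ennreal (norm (gradL \<gamma> \<phi> \<xi>) powr p * w \<xi>) \<partial>lborel)"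
      if "test_fun \<Omega> \<phi>" for \<phi>
      using test[OF that] by (simp only: mult.left_commute)
  qed (use v c in auto)
  finally show ?thesis .
qed

abbreviation (input) hratio :: "real \<Rightarrow> real \<Rightarrow> 'n::finite pt \<Rightarrow> real" where
  "hratio \<gamma> p \<xi> \<equiv> rr \<xi> powr (p*(2*\<gamma>-1)) / NN \<gamma> \<xi> powr (p*(2*\<gamma>-1))"

text \<open>The right weight \<open>w\<close> need only dominate the power. The unweighted case is
  thus an instance with w = 1, although \<open>NN \<gamma> \<xi> powr 0\<close> is 0 at the origin
  and so is not literally the constant 1. When Q + \<beta> = 0 the left side is 0.\<close>

lemma hardy_power:
  fixes \<Omega> :: "'n::finite pt set"
  assumes \<gamma>: "\<gamma> \<ge> 1" and p: "p > 1" and O: "open \<Omega>" and Om: "\<beta> + QQ TYPE('n) \<gamma> < 0 \<longrightarrow> 0 \<notin> \<Omega>"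
    and w[measurable]: "w \<in> borel_measurable borel" "\<And>\<xi>. NN \<gamma> \<xi> powr (p + \<beta>) \<le> w \<xi>"
    and ug: "(u, g) \<in> DL \<gamma> p \<Omega> w"
  shows "ennreal ((\<bar>QQ TYPE('n) \<gamma> + \<beta>\<bar> / p) powr p) *
           (\<integral>\<^sup>+ \<xi>. ennreal (\<bar>u \<xi>\<bar> powr p * (NN \<gamma> \<xi> powr \<beta> * hratio \<gamma> p \<xi>)) * indicator \<Omega> \<xi> \<partial>lborel)
         \<le> (\<integral>\<^sup>+ \<xi>. ennreal (norm (g \<xi>) powr p * w \<xi>) * indicator \<Omega> \<xi> \<partial>lborel)"
proof (cases "QQ TYPE('n) \<gamma> + \<beta> = 0")
  case False
  show ?thesis
  proof (rule DL_closure_const[OF p O _ w(1) _ _ _ _ ug])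
    show "w \<xi> \<ge> 0" for \<xi> using order_trans[OF powr_ge_zero w(2)] .
    fix \<phi> assume \<phi>: "test_fun \<Omega> \<phi>"
    have "(\<integral>\<^sup>+\<xi>. ennreal ((\<bar>QQ TYPE('n) \<gamma> + \<beta>\<bar> / p) powr p * (\<bar>\<phi> \<xi>\<bar> powr p * (NN \<gamma> \<xi> powr \<beta> * hratio \<gamma> p \<xi>))) \<partial>lborel)
      \<le> (\<integral>\<^sup>+\<xi>. ennreal (norm (gradL \<gamma> \<phi> \<xi>) powr p * NN \<gamma> \<xi> powr (p + \<beta>)) \<partial>lborel)"
      using hardy_test_power[OF \<gamma> p \<phi> False] Om by (simp only: mult.assoc add.commute)
    also have "\<dots> \<le> (\<integral>\<^sup>+\<xi>. ennreal (norm (gradL \<gamma> \<phi> \<xi>) powr p * w \<xi>) \<partial>lborel)"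
      by (intro nn_integral_mono ennreal_leI mult_left_mono w(2)) simp
    finally show "(\<integral>\<^sup>+\<xi>. ennreal ((\<bar>QQ TYPE('n) \<gamma> + \<beta>\<bar> / p) powr p * (\<bar>\<phi> \<xi>\<bar> powr p * (NN \<gamma> \<xi> powr \<beta> * hratio \<gamma> p \<xi>))) \<partial>lborel)
      \<le> (\<integral>\<^sup>+\<xi>. ennreal (norm (gradL \<gamma> \<phi> \<xi>) powr p * w \<xi>) \<partial>lborel)" .
  qed simp_all
qed simp

text \<open>Again \<open>w\<close> only dominates the weight, so that w = 1 is admissible for
  \<beta> = -p: the zeroth \<open>powr\<close> of the logarithm is 0 rather than 1 where the
  logarithm vanishes.\<close>

lemma hardy_log:
  fixes u :: "'n::finite pt \<Rightarrow> real"
  assumes \<gamma>: "\<gamma> \<ge> 1" and R: "R > 0" and \<beta>: "\<beta> < -1" and p: "p = QQ TYPE('n) \<gamma>"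
    and w[measurable]: "w \<in> borel_measurable borel" "\<And>\<xi>. ln (R / NN \<gamma> \<xi>) powr (p + \<beta>) \<le> w \<xi>"
    and ug: "(u, g) \<in> DL \<gamma> p {\<xi>. NN \<gamma> \<xi> < R} w"
  shows "ennreal ((\<bar>\<beta> + 1\<bar> / p) powr p) *
           (\<integral>\<^sup>+ \<xi>. ennreal (\<bar>u \<xi>\<bar> powr p * (ln (R / NN \<gamma> \<xi>) powr \<beta> * hratio \<gamma> p \<xi> / NN \<gamma> \<xi> powr p)) * indicator {\<xi>. NN \<gamma> \<xi> < R} \<xi> \<partial>lborel)
         \<le> (\<integral>\<^sup>+ \<xi>. ennreal (norm (g \<xi>) powr p * w \<xi>) * indicator {\<xi>. NN \<gamma> \<xi> < R} \<xi> \<partial>lborel)"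
proof -
  have g0: "\<gamma> > 0" using \<gamma> by simp
  have p1: "p > 1" unfolding p QQ_def using \<gamma> by (auto intro: add_nonneg_pos)
  have O: "open {\<xi>::'n pt. NN \<gamma> \<xi> < R}" by (intro open_Collect_less continuous_on_NN[OF g0] continuous_intros)
  show ?thesis
  proof (rule DL_closure_const[OF p1 O _ w(1) _ _ _ _ ug])
    show "w \<xi> \<ge> 0" for \<xi> using order_trans[OF powr_ge_zero w(2)] .
    fix \<phi> :: "'n pt \<Rightarrow> real" assume \<phi>: "test_fun {\<xi>. NN \<gamma> \<xi> < R} \<phi>"
    have eq: "\<bar>\<phi> \<xi>\<bar> powr p * (ln (R / NN \<gamma> \<xi>) powr \<beta> * hratio \<gamma> p \<xi> / NN \<gamma> \<xi> powr p)
      = \<bar>\<phi> \<xi>\<bar> powr p / NN \<gamma> \<xi> powr p * ln (R / NN \<gamma> \<xi>) powr \<beta> * hratio \<gamma> p \<xi>" for \<xi>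
      by (simp only: divide_inverse mult_ac)
    have "(\<integral>\<^sup>+\<xi>. ennreal ((\<bar>\<beta> + 1\<bar> / p) powr p * (\<bar>\<phi> \<xi>\<bar> powr p * (ln (R / NN \<gamma> \<xi>) powr \<beta> * hratio \<gamma> p \<xi> / NN \<gamma> \<xi> powr p))) \<partial>lborel)
      \<le> (\<integral>\<^sup>+\<xi>. ennreal (norm (gradL \<gamma> \<phi> \<xi>) powr p * ln (R / NN \<gamma> \<xi>) powr (p + \<beta>)) \<partial>lborel)"
      unfolding eq by (rule hardy_test_log[OF \<gamma> R \<beta> p \<phi>])
    also have "\<dots> \<le> (\<integral>\<^sup>+\<xi>. ennreal (norm (gradL \<gamma> \<phi> \<xi>) powr p * w \<xi>) \<partial>lborel)"
      by (intro nn_integral_mono ennreal_leI mult_left_mono w(2)) simp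
    finally show "(\<integral>\<^sup>+\<xi>. ennreal ((\<bar>\<beta> + 1\<bar> / p) powr p * (\<bar>\<phi> \<xi>\<bar> powr p * (ln (R / NN \<gamma> \<xi>) powr \<beta> * hratio \<gamma> p \<xi> / NN \<gamma> \<xi> powr p))) \<partial>lborel)
      \<le> (\<integral>\<^sup>+\<xi>. ennreal (norm (gradL \<gamma> \<phi> \<xi>) powr p * w \<xi>) \<partial>lborel)" .
  qed simp_all
qed

theorem mainTheorem11:
  fixes \<gamma> :: real
  assumes "\<gamma> \<ge> 1"
  shows
  \<comment> \<open>(1) weighted Hardy inequality\<close>
  "(\<forall>(p::real) (\<beta>::real) (\<Omega>::'n::finite pt set).
      1 < p \<and> open \<Omega> \<and> (\<beta> + QQ TYPE('n) \<gamma> < 0 \<longrightarrow> 0 \<notin> \<Omega>) \<longrightarrow>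
      (\<forall>(u, g) \<in> DL \<gamma> p \<Omega> (\<lambda>\<xi>. NN \<gamma> \<xi> powr (p + \<beta>)).
         ennreal ((\<bar>QQ TYPE('n) \<gamma> + \<beta>\<bar> / p) powr p) *
           (\<integral>\<^sup>+ \<xi>. ennreal (\<bar>u \<xi>\<bar> powr p * NN \<gamma> \<xi> powr \<beta> *
               (rr \<xi> powr (p*(2*\<gamma>-1)) / NN \<gamma> \<xi> powr (p*(2*\<gamma>-1)))) * indicator \<Omega> \<xi> \<partial>lborel)
         \<le> (\<integral>\<^sup>+ \<xi>. ennreal (norm (g \<xi>) powr p * NN \<gamma> \<xi> powr (p + \<beta>)) * indicator \<Omega> \<xi> \<partial>lborel)))
   \<and>
  \<comment> \<open>(1), particular case beta = -p\<close>
   (\<forall>(p::real) (\<Omega>::'n::finite pt set).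
      1 < p \<and> open \<Omega> \<and> (QQ TYPE('n) \<gamma> - p < 0 \<longrightarrow> 0 \<notin> \<Omega>) \<longrightarrow>
      (\<forall>(u, g) \<in> DL \<gamma> p \<Omega> (\<lambda>\<xi>. 1).
         ennreal ((\<bar>QQ TYPE('n) \<gamma> - p\<bar> / p) powr p) *
           (\<integral>\<^sup>+ \<xi>. ennreal (\<bar>u \<xi>\<bar> powr p / NN \<gamma> \<xi> powr p *
               (rr \<xi> powr (p*(2*\<gamma>-1)) / NN \<gamma> \<xi> powr (p*(2*\<gamma>-1)))) * indicator \<Omega> \<xi> \<partial>lborel)
         \<le> (\<integral>\<^sup>+ \<xi>. ennreal (norm (g \<xi>) powr p) * indicator \<Omega> \<xi> \<partial>lborel)))
   \<and>
  \<comment> \<open>(1), sharpness of the constant when Omega \<union> {0} is a neighbourhood of the origin\<close>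
   (\<forall>(p::real) (\<beta>::real) (\<Omega>::'n::finite pt set).
      1 < p \<and> open \<Omega> \<and> (\<beta> + QQ TYPE('n) \<gamma> < 0 \<longrightarrow> 0 \<notin> \<Omega>) \<and>
      (\<exists>e>0. ball 0 e \<subseteq> \<Omega> \<union> {0}) \<longrightarrow>
      (\<forall>C > (\<bar>QQ TYPE('n) \<gamma> + \<beta>\<bar> / p) powr p.
        \<exists>(u, g) \<in> DL \<gamma> p \<Omega> (\<lambda>\<xi>. NN \<gamma> \<xi> powr (p + \<beta>)).
         \<not> (ennreal C *
           (\<integral>\<^sup>+ \<xi>. ennreal (\<bar>u \<xi>\<bar> powr p * NN \<gamma> \<xi> powr \<beta> *
               (rr \<xi> powr (p*(2*\<gamma>-1)) / NN \<gamma> \<xi> powr (p*(2*\<gamma>-1)))) * indicator \<Omega> \<xi> \<partial>lborel)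
         \<le> (\<integral>\<^sup>+ \<xi>. ennreal (norm (g \<xi>) powr p * NN \<gamma> \<xi> powr (p + \<beta>)) * indicator \<Omega> \<xi> \<partial>lborel))))
   \<and>
  \<comment> \<open>(2) critical case p = Q on the gauge ball of radius R\<close>
   (\<forall>(R::real) (\<beta>::real). R > 0 \<and> \<beta> < -1 \<longrightarrow>
      (let p = QQ TYPE('n) \<gamma>; \<Omega> = {\<xi>::'n pt. NN \<gamma> \<xi> < R} in
      \<forall>(u, g) \<in> DL \<gamma> p \<Omega> (\<lambda>\<xi>. ln (R / NN \<gamma> \<xi>) powr (p + \<beta>)).
         ennreal ((\<bar>\<beta> + 1\<bar> / p) powr p) *
           (\<integral>\<^sup>+ \<xi>. ennreal (\<bar>u \<xi>\<bar> powr p / NN \<gamma> \<xi> powr p * ln (R / NN \<gamma> \<xi>) powr \<beta> *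
               (rr \<xi> powr (p*(2*\<gamma>-1)) / NN \<gamma> \<xi> powr (p*(2*\<gamma>-1)))) * indicator \<Omega> \<xi> \<partial>lborel)
         \<le> (\<integral>\<^sup>+ \<xi>. ennreal (norm (g \<xi>) powr p * ln (R / NN \<gamma> \<xi>) powr (p + \<beta>)) * indicator \<Omega> \<xi> \<partial>lborel)))
   \<and>
  \<comment> \<open>(2), particular case beta = -p\<close>
   (\<forall>(R::real). R > 0 \<longrightarrow>
      (let p = QQ TYPE('n) \<gamma>; \<Omega> = {\<xi>::'n pt. NN \<gamma> \<xi> < R} in
      \<forall>(u, g) \<in> DL \<gamma> p \<Omega> (\<lambda>\<xi>. 1).
         ennreal (((p - 1) / p) powr p) *
           (\<integral>\<^sup>+ \<xi>. ennreal (\<bar>u \<xi>\<bar> powr p / (NN \<gamma> \<xi> * ln (R / NN \<gamma> \<xi>)) powr p *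
               (rr \<xi> powr (p*(2*\<gamma>-1)) / NN \<gamma> \<xi> powr (p*(2*\<gamma>-1)))) * indicator \<Omega> \<xi> \<partial>lborel)
         \<le> (\<integral>\<^sup>+ \<xi>. ennreal (norm (g \<xi>) powr p) * indicator \<Omega> \<xi> \<partial>lborel)))
   \<and>
  \<comment> \<open>(2), sharpness\<close>
   (\<forall>(R::real) (\<beta>::real). R > 0 \<and> \<beta> < -1 \<longrightarrow>
      (let p = QQ TYPE('n) \<gamma>; \<Omega> = {\<xi>::'n pt. NN \<gamma> \<xi> < R} in
      \<forall>C > (\<bar>\<beta> + 1\<bar> / p) powr p.
        \<exists>(u, g) \<in> DL \<gamma> p \<Omega> (\<lambda>\<xi>. ln (R / NN \<gamma> \<xi>) powr (p + \<beta>)).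
         \<not> (ennreal C *
           (\<integral>\<^sup>+ \<xi>. ennreal (\<bar>u \<xi>\<bar> powr p / NN \<gamma> \<xi> powr p * ln (R / NN \<gamma> \<xi>) powr \<beta> *
               (rr \<xi> powr (p*(2*\<gamma>-1)) / NN \<gamma> \<xi> powr (p*(2*\<gamma>-1)))) * indicator \<Omega> \<xi> \<partial>lborel)
         \<le> (\<integral>\<^sup>+ \<xi>. ennreal (norm (g \<xi>) powr p * ln (R / NN \<gamma> \<xi>) powr (p + \<beta>)) * indicator \<Omega> \<xi> \<partial>lborel))))"
proof (intro conjI allI impI)
  fix p \<beta> :: real and \<Omega> :: "'n pt set"
  assume A: "1 < p \<and> open \<Omega> \<and> (\<beta> + QQ TYPE('n) \<gamma> < 0 \<longrightarrow> 0 \<notin> \<Omega>)"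
  show "\<forall>(u, g) \<in> DL \<gamma> p \<Omega> (\<lambda>\<xi>. NN \<gamma> \<xi> powr (p + \<beta>)).
         ennreal ((\<bar>QQ TYPE('n) \<gamma> + \<beta>\<bar> / p) powr p) *
           (\<integral>\<^sup>+ \<xi>. ennreal (\<bar>u \<xi>\<bar> powr p * NN \<gamma> \<xi> powr \<beta> * hratio \<gamma> p \<xi>) * indicator \<Omega> \<xi> \<partial>lborel)
         \<le> (\<integral>\<^sup>+ \<xi>. ennreal (norm (g \<xi>) powr p * NN \<gamma> \<xi> powr (p + \<beta>)) * indicator \<Omega> \<xi> \<partial>lborel)"
    using hardy_power[OF assms, of p \<Omega> \<beta> "\<lambda>\<xi>. NN \<gamma> \<xi> powr (p + \<beta>)"] A
    unfolding mult.assoc by (intro ballI case_prodI2) simp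
next
  fix p :: real and \<Omega> :: "'n pt set"
  assume A: "1 < p \<and> open \<Omega> \<and> (QQ TYPE('n) \<gamma> - p < 0 \<longrightarrow> 0 \<notin> \<Omega>)"
  have eq: "\<bar>z\<bar> powr p / NN \<gamma> \<xi> powr p * hratio \<gamma> p \<xi> = \<bar>z\<bar> powr p * (NN \<gamma> \<xi> powr (-p) * hratio \<gamma> p \<xi>)" for z and \<xi> :: "'n pt"
    by (simp only: powr_minus divide_inverse mult_ac)
  show "\<forall>(u, g) \<in> DL \<gamma> p \<Omega> (\<lambda>\<xi>. 1).
         ennreal ((\<bar>QQ TYPE('n) \<gamma> - p\<bar> / p) powr p) *
           (\<integral>\<^sup>+ \<xi>. ennreal (\<bar>u \<xi>\<bar> powr p / NN \<gamma> \<xi> powr p * hratio \<gamma> p \<xi>) * indicator \<Omega> \<xi> \<partial>lborel)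
         \<le> (\<integral>\<^sup>+ \<xi>. ennreal (norm (g \<xi>) powr p) * indicator \<Omega> \<xi> \<partial>lborel)"
    using hardy_power[OF assms, of p \<Omega> "-p" "\<lambda>\<xi>. 1"] A
    unfolding eq by (intro ballI case_prodI2) simp
next
  fix p \<beta> C :: real and \<Omega> :: "'n pt set"
  assume A: "1 < p \<and> open \<Omega> \<and> (\<beta> + QQ TYPE('n) \<gamma> < 0 \<longrightarrow> 0 \<notin> \<Omega>) \<and> (\<exists>e>0. ball 0 e \<subseteq> \<Omega> \<union> {0})"
    and C: "(\<bar>QQ TYPE('n) \<gamma> + \<beta>\<bar> / p) powr p < C"
  then obtain e where "e > 0" "ball 0 e \<subseteq> \<Omega> \<union> {0}" by blast
  then show "\<exists>(u, g) \<in> DL \<gamma> p \<Omega> (\<lambda>\<xi>. NN \<gamma> \<xi> powr (p + \<beta>)).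
         \<not> (ennreal C * (\<integral>\<^sup>+ \<xi>. ennreal (\<bar>u \<xi>\<bar> powr p * NN \<gamma> \<xi> powr \<beta> * hratio \<gamma> p \<xi>) * indicator \<Omega> \<xi> \<partial>lborel)
         \<le> (\<integral>\<^sup>+ \<xi>. ennreal (norm (g \<xi>) powr p * NN \<gamma> \<xi> powr (p + \<beta>)) * indicator \<Omega> \<xi> \<partial>lborel))"
    using A C by (intro sharp_power[OF assms]) auto
next
  fix R \<beta> :: real
  assume A: "R > 0 \<and> \<beta> < -1"
  define p where "p = QQ TYPE('n) \<gamma>"
  define \<Omega> where "\<Omega> = {\<xi>::'n pt. NN \<gamma> \<xi> < R}"
  have eq: "\<bar>z\<bar> powr p / NN \<gamma> \<xi> powr p * ln (R / NN \<gamma> \<xi>) powr \<beta> * hratio \<gamma> p \<xi>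
     = \<bar>z\<bar> powr p * (ln (R / NN \<gamma> \<xi>) powr \<beta> * hratio \<gamma> p \<xi> / NN \<gamma> \<xi> powr p)" for z and \<xi> :: "'n pt"
    by (simp only: divide_inverse mult_ac)
  have "\<forall>(u, g) \<in> DL \<gamma> p \<Omega> (\<lambda>\<xi>. ln (R / NN \<gamma> \<xi>) powr (p + \<beta>)).
         ennreal ((\<bar>\<beta> + 1\<bar> / p) powr p) *
           (\<integral>\<^sup>+ \<xi>. ennreal (\<bar>u \<xi>\<bar> powr p / NN \<gamma> \<xi> powr p * ln (R / NN \<gamma> \<xi>) powr \<beta> * hratio \<gamma> p \<xi>) * indicator \<Omega> \<xi> \<partial>lborel)
         \<le> (\<integral>\<^sup>+ \<xi>. ennreal (norm (g \<xi>) powr p * ln (R / NN \<gamma> \<xi>) powr (p + \<beta>)) * indicator \<Omega> \<xi> \<partial>lborel)"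
    unfolding eq
  proof (intro ballI case_prodI2)
    fix z u and g :: "'n pt \<Rightarrow> (real^'n) \<times> (real^'n)" assume "z \<in> DL \<gamma> p \<Omega> (\<lambda>\<xi>. ln (R / NN \<gamma> \<xi>) powr (p + \<beta>))" "z = (u, g)"
    then have ug: "(u, g) \<in> DL \<gamma> p {\<xi>::'n pt. NN \<gamma> \<xi> < R} (\<lambda>\<xi>. ln (R / NN \<gamma> \<xi>) powr (p + \<beta>))" by (simp add: \<Omega>_def)
    from hardy_log[OF assms _ _ p_def _ _ ug] A show "ennreal ((\<bar>\<beta> + 1\<bar> / p) powr p) *
           (\<integral>\<^sup>+ \<xi>. ennreal (\<bar>u \<xi>\<bar> powr p * (ln (R / NN \<gamma> \<xi>) powr \<beta> * hratio \<gamma> p \<xi> / NN \<gamma> \<xi> powr p)) * indicator \<Omega> \<xi> \<partial>lborel)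
         \<le> (\<integral>\<^sup>+ \<xi>. ennreal (norm (g \<xi>) powr p * ln (R / NN \<gamma> \<xi>) powr (p + \<beta>)) * indicator \<Omega> \<xi> \<partial>lborel)"
      unfolding \<Omega>_def[symmetric] by simp
  qed
  then show "let p = QQ TYPE('n) \<gamma>; \<Omega> = {\<xi>::'n pt. NN \<gamma> \<xi> < R} in
      \<forall>(u, g) \<in> DL \<gamma> p \<Omega> (\<lambda>\<xi>. ln (R / NN \<gamma> \<xi>) powr (p + \<beta>)).
         ennreal ((\<bar>\<beta> + 1\<bar> / p) powr p) *
           (\<integral>\<^sup>+ \<xi>. ennreal (\<bar>u \<xi>\<bar> powr p / NN \<gamma> \<xi> powr p * ln (R / NN \<gamma> \<xi>) powr \<beta> * hratio \<gamma> p \<xi>) * indicator \<Omega> \<xi> \<partial>lborel)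
         \<le> (\<integral>\<^sup>+ \<xi>. ennreal (norm (g \<xi>) powr p * ln (R / NN \<gamma> \<xi>) powr (p + \<beta>)) * indicator \<Omega> \<xi> \<partial>lborel)"
    unfolding Let_def p_def \<Omega>_def .
next
  fix R :: real
  assume R: "R > 0"
  define p where "p = QQ TYPE('n) \<gamma>"
  define \<Omega> where "\<Omega> = {\<xi>::'n pt. NN \<gamma> \<xi> < R}"
  have p1: "p > 1" unfolding p_def QQ_def using assms by (auto intro: add_nonneg_pos)
  have eq: "ennreal (\<bar>z\<bar> powr p / (NN \<gamma> \<xi> * ln (R / NN \<gamma> \<xi>)) powr p * hratio \<gamma> p \<xi>) * indicator \<Omega> \<xi>
     = ennreal (\<bar>z\<bar> powr p * (ln (R / NN \<gamma> \<xi>) powr (-p) * hratio \<gamma> p \<xi> / NN \<gamma> \<xi> powr p)) * indicator \<Omega> \<xi>" for z and \<xi> :: "'n pt"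
  \<comment> \<open>Inside the punctured gauge ball the logarithm is nonnegative and the power of
    the product splits. At the origin both sides are 0 through division by 0, and outside the ball
    through the indicator.\<close>
  proof (cases "NN \<gamma> \<xi> > 0 \<and> \<xi> \<in> \<Omega>")
    case True
    then have "ln (R / NN \<gamma> \<xi>) \<ge> 0" by (simp add: \<Omega>_def)
    then have "(NN \<gamma> \<xi> * ln (R / NN \<gamma> \<xi>)) powr p = NN \<gamma> \<xi> powr p * ln (R / NN \<gamma> \<xi>) powr p"
      using True by (simp add: powr_mult)
    then show ?thesis by (simp add: powr_minus divide_inverse mult_ac)
  next
    case False
    then have "NN \<gamma> \<xi> = 0 \<or> \<xi> \<notin> \<Omega>" using NN_nonneg[of \<gamma> \<xi>] by linarith
    then show ?thesis by auto
  qed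
  have c: "\<bar>-p + 1\<bar> = p - 1" using p1 by simp
  have "\<forall>(u, g) \<in> DL \<gamma> p \<Omega> (\<lambda>\<xi>. 1).
         ennreal (((p - 1) / p) powr p) *
           (\<integral>\<^sup>+ \<xi>. ennreal (\<bar>u \<xi>\<bar> powr p / (NN \<gamma> \<xi> * ln (R / NN \<gamma> \<xi>)) powr p * hratio \<gamma> p \<xi>) * indicator \<Omega> \<xi> \<partial>lborel)
         \<le> (\<integral>\<^sup>+ \<xi>. ennreal (norm (g \<xi>) powr p) * indicator \<Omega> \<xi> \<partial>lborel)"
    unfolding eq
  proof (intro ballI case_prodI2)
    fix z u and g :: "'n pt \<Rightarrow> (real^'n) \<times> (real^'n)" assume "z \<in> DL \<gamma> p \<Omega> (\<lambda>\<xi>. 1)" "z = (u, g)"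
    then have ug: "(u, g) \<in> DL \<gamma> p {\<xi>::'n pt. NN \<gamma> \<xi> < R} (\<lambda>\<xi>. 1)" by (simp add: \<Omega>_def)
    have "-p < -1" using p1 by simp
    from hardy_log[OF assms R this p_def _ _ ug] show "ennreal (((p - 1) / p) powr p) *
           (\<integral>\<^sup>+ \<xi>. ennreal (\<bar>u \<xi>\<bar> powr p * (ln (R / NN \<gamma> \<xi>) powr (-p) * hratio \<gamma> p \<xi> / NN \<gamma> \<xi> powr p)) * indicator \<Omega> \<xi> \<partial>lborel)
         \<le> (\<integral>\<^sup>+ \<xi>. ennreal (norm (g \<xi>) powr p) * indicator \<Omega> \<xi> \<partial>lborel)"
      unfolding c by (simp add: \<Omega>_def)
  qed
  then show "let p = QQ TYPE('n) \<gamma>; \<Omega> = {\<xi>::'n pt. NN \<gamma> \<xi> < R} in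
      \<forall>(u, g) \<in> DL \<gamma> p \<Omega> (\<lambda>\<xi>. 1).
         ennreal (((p - 1) / p) powr p) *
           (\<integral>\<^sup>+ \<xi>. ennreal (\<bar>u \<xi>\<bar> powr p / (NN \<gamma> \<xi> * ln (R / NN \<gamma> \<xi>)) powr p * hratio \<gamma> p \<xi>) * indicator \<Omega> \<xi> \<partial>lborel)
         \<le> (\<integral>\<^sup>+ \<xi>. ennreal (norm (g \<xi>) powr p) * indicator \<Omega> \<xi> \<partial>lborel)"
    unfolding Let_def p_def \<Omega>_def .
next
  fix R \<beta> :: real
  assume A: "R > 0 \<and> \<beta> < -1"
  show "let p = QQ TYPE('n) \<gamma>; \<Omega> = {\<xi>::'n pt. NN \<gamma> \<xi> < R} in
      \<forall>C > (\<bar>\<beta> + 1\<bar> / p) powr p.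
        \<exists>(u, g) \<in> DL \<gamma> p \<Omega> (\<lambda>\<xi>. ln (R / NN \<gamma> \<xi>) powr (p + \<beta>)).
         \<not> (ennreal C *
           (\<integral>\<^sup>+ \<xi>. ennreal (\<bar>u \<xi>\<bar> powr p / NN \<gamma> \<xi> powr p * ln (R / NN \<gamma> \<xi>) powr \<beta> * hratio \<gamma> p \<xi>) * indicator \<Omega> \<xi> \<partial>lborel)
         \<le> (\<integral>\<^sup>+ \<xi>. ennreal (norm (g \<xi>) powr p * ln (R / NN \<gamma> \<xi>) powr (p + \<beta>)) * indicator \<Omega> \<xi> \<partial>lborel))"
    unfolding Let_def using A by (intro allI impI sharp_log[OF assms _ _ refl refl]) simp_all
qed

end
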